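(* Let $p>1$, let $k$ be a power of $2$, let $0<\varepsilon<1$ with $1/\varepsilon^2$ an integer, and let $n=k^p$. There is a sufficiently small constant $\delta>0$ such that any protocol in the $k$-party blackboard model that computes a $(1+\varepsilon)$-approximation to $F_p$ of the sites' inputs drawn from the distribution $\nu$ (described below) with error probability $\delta$ has communication complexity $\Omega(k^{p-1}/\varepsilon^2)$.
   Context: Blackboard model: $k$ sites each hold a private input; every message written by a site is seen by all sites; cost is the total number of bits written. Input distribution $\nu$: each site $S_i$ holds $1/\varepsilon^2$ blocks, each a vector of $n$ bits. Each block is generated independently as follows (distribution $\psi_n$): for each coordinate $\ell\in[n]$ pick $D_\ell$ uniformly from $[k]$; site $D_\ell$ gets a uniformly random bit in coordinate $\ell$ and all other sites get $0$. Then pick a special coordinate $M$ uniformly from $[n]$ and replace the inputs on coordinate $M$: with probability $1/2$ all of the first $k/2$ sites get $0$ there and with probability $1/2$ they all get $1$; independently, the same is done for the last $k/2$ sites. The $F_p$ instance: the universe consists of all (block, coordinate) pairs, i.e. $nk\cdot$ ... precisely $n/\varepsilon^2$ items; each site holds the set of items where its bit is $1$; if $c_j$ denotes the number of sites holding item $j$, then $F_p=\sum_j c_j^p$. A value $\tilde W$ is a $(1+\varepsilon)$-approximation of $W$ if $W\le\tilde W\le (1+\varepsilon)W$; error probability is over $\nu$ and the protocol's randomness. *)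

theory Defs
  imports "HOL-Probability.Probability"
begin

text \<open>
  Sites, blocks and coordinates are numbered from 0. A local input maps a block and a coordinate
  to a bit; a global input maps each site to its local input.
\<close>

type_synonym local_input = "nat \<Rightarrow> nat \<Rightarrow> bool"

type_synonym input = "nat \<Rightarrow> local_input"

definition inputs :: "nat \<Rightarrow> nat \<Rightarrow> nat \<Rightarrow> input set" where
  "inputs k B n = {x. \<forall>i b l. x i b l \<longrightarrow> i < k \<and> b < B \<and> l < n}"


text \<open>
  A deterministic blackboard protocol is a protocol tree. The position in the tree is the content
  of the blackboard, so that content determines who writes next. In \<open>Write i f t0 t1\<close>, site \<open>i\<close>
  writes the bit \<open>f\<close> of its own local input, and the protocol continues with \<open>t1\<close> if the bit is 1
  and with \<open>t0\<close> if it is 0. The output is a function of the final blackboard.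
\<close>

datatype protocol =
    Output real
  | Write nat "local_input \<Rightarrow> bool" protocol protocol

primrec result :: "protocol \<Rightarrow> input \<Rightarrow> real" where
  "result (Output w) x = w"
| "result (Write i f t0 t1) x = (if f (x i) then result t1 x else result t0 x)"

primrec bits_written :: "protocol \<Rightarrow> input \<Rightarrow> nat" where
  "bits_written (Output w) x = 0"
| "bits_written (Write i f t0 t1) x =
     Suc (if f (x i) then bits_written t1 x else bits_written t0 x)"

primrec writers :: "protocol \<Rightarrow> nat set" where
  "writers (Output w) = {}"
| "writers (Write i f t0 t1) = insert i (writers t0 \<union> writers t1)"

text \<open>
  A randomized protocol is a distribution on deterministic ones (public coins; private coins of
  the sites are a special case). Its communication complexity is the worst case over
  all inputs and all outcomes of the randomness.
\<close>

definition blackboard_protocol :: "nat \<Rightarrow> protocol pmf \<Rightarrow> bool" where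
  "blackboard_protocol k P \<longleftrightarrow> (\<forall>t \<in> set_pmf P. writers t \<subseteq> {..<k})"

definition communication_complexity :: "nat \<Rightarrow> nat \<Rightarrow> nat \<Rightarrow> protocol pmf \<Rightarrow> ereal" where
  "communication_complexity k B n P =
     (SUP t \<in> set_pmf P. SUP x \<in> inputs k B n. ereal (real (bits_written t x)))"


text \<open>One block, as a map from sites and coordinates to bits.\<close>

definition psi :: "nat \<Rightarrow> nat \<Rightarrow> (nat \<Rightarrow> nat \<Rightarrow> bool) pmf" where
  "psi k n =
     do {
       D \<leftarrow> Pi_pmf {..<n} 0 (\<lambda>_. pmf_of_set {..<k});
       U \<leftarrow> Pi_pmf {..<n} False (\<lambda>_. bernoulli_pmf (1/2));
       M \<leftarrow> pmf_of_set {..<n};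
       a \<leftarrow> bernoulli_pmf (1/2);
       b \<leftarrow> bernoulli_pmf (1/2);
       return_pmf (\<lambda>i l. i < k \<and> l < n \<and>
         (if l = M then (if i < k div 2 then a else b) else i = D l \<and> U l))
     }"

definition nu :: "nat \<Rightarrow> nat \<Rightarrow> nat \<Rightarrow> input pmf" where
  "nu k B n =
     map_pmf (\<lambda>X i b l. X b i l) (Pi_pmf {..<B} (\<lambda>_ _. False) (\<lambda>_. psi k n))"


definition Fp :: "real \<Rightarrow> nat \<Rightarrow> nat \<Rightarrow> nat \<Rightarrow> input \<Rightarrow> real" where
  "Fp p k B n x =
     (\<Sum>(b, l) \<in> {..<B} \<times> {..<n}. real (card {i. i < k \<and> x i b l}) powr p)"

definition is_approx :: "real \<Rightarrow> real \<Rightarrow> real \<Rightarrow> bool" where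
  "is_approx \<epsilon> W W' \<longleftrightarrow> W \<le> W' \<and> W' \<le> (1 + \<epsilon>) * W"

definition error_prob :: "real \<Rightarrow> real \<Rightarrow> nat \<Rightarrow> nat \<Rightarrow> nat \<Rightarrow> protocol pmf \<Rightarrow> real" where
  "error_prob p \<epsilon> k B n P =
     measure_pmf.prob (pair_pmf (nu k B n) P)
       {(x, t). \<not> is_approx \<epsilon> (Fp p k B n x) (result t x)}"

end

theory Submission
  imports Defs
begin

text \<open>
  Fix the public randomness and let \<open>C\<close> bound the number of bits written. A transcript is a function of
  the inputs with at most \<open>2^C\<close> values, so by the level-one inequality the squared Hellinger distances
  between the transcripts with one ordinary bit set to 0 and to 1 add up to at most \<open>4 C ln 2\<close>. An
  ordinary bit belongs to a random site and a random coordinate; hence for a random coordinate the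
  distances over all sites sum to \<open>O(C k / (n B))\<close> per block. By the product structure of transcript
  probabilities (Jayram's partition argument) this also bounds the distance caused by planting ones at all
  sites of a half. To compare planted with ordinary coordinates, one further coordinate of a block is
  pinned to zero: a block with planted coordinate \<open>M\<close> and pinned zero \<open>m\<close> is the same input as a block
  planted with zeros at \<open>m\<close> in which \<open>M\<close> is ordinary.

  Write \<open>(a, b)\<close> for the planted bits of a block. Since \<open>p > 1\<close>, the contribution of a block to the
  frequency moment contains a nonzero multiple of \<open>a b\<close>, so giving the pairs \<open>(a, b)\<close> a correlation
  \<open>\<rho> = \<omega> / sqrt B\<close> shifts the moment by more than its standard deviation and the allowed error, while
  the change of measure has bounded second moment. A correct protocol therefore tells correlated from
  independent pairs. By a chain rule over the blocks, the divergence of the two transcript distributions is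
  at most \<open>O(\<rho>\<^sup>2)\<close> times the sum of the Hellinger distances above, i.e. \<open>O(\<omega>\<^sup>2 C k / (n B))\<close>, which forces
  \<open>C \<ge> c n B / k\<close>. If \<open>B\<close> is too small for \<open>\<rho> \<le> 1/2\<close>, one compares all-zero with all-one planted bits,
  changing one block at a time.
\<close>

section \<open>Averages and the level-one inequality\<close>

text \<open>The factor \<open>B\<close> cannot be won from a single block: the allowed error is of
  the size of about \<open>sqrt B\<close> block contributions, so the planted bits of one block are
  invisible in the output. The test is therefore spread over all blocks, and it only pays off if the
  divergence is quadratic in \<rho>. The term linear in \<rho> has to vanish exactly; it does
  because transcript probabilities sum to 1 for every choice of the planted bits. The protocol is
  correct only on average under \<open>nu\<close>, where the pairs are independent. Carrying its
  error over to correlated pairs costs a factor \<open>exp (\<omega>\<^sup>2)\<close> under a square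
  root, so \<delta> must be of order \<open>exp (- \<omega>\<^sup>2)\<close>. Relative to
  \<open>k powr p\<close>, the coefficient of \<open>a b\<close> is
  \<open>1 - 2 * 2 powr (- p)\<close>, which tends to 0 as \<open>p\<close> tends to 1; hence
  \<omega>, \<delta> and the final constant depend on \<open>p\<close>. The level-one bound speaks
  about ordinary bits, the test about planted ones. Pinning a second coordinate bridges the two at
  the price of a constant probability per block: harmless in the chain rule, but exponential in
  \<open>B\<close> where all blocks must be active, which is affordable only for bounded
  \<open>B\<close>.\<close>

definition mean :: "'a set \<Rightarrow> ('a \<Rightarrow> real) \<Rightarrow> real" where
  "mean A f = (\<Sum>x\<in>A. f x) / real (card A)"

lemma mean_cong: "(\<And>x. x \<in> A \<Longrightarrow> f x = g x) \<Longrightarrow> mean A f = mean A g"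
  unfolding mean_def by simp

lemma mean_mono: "(\<And>x. x \<in> A \<Longrightarrow> f x \<le> g x) \<Longrightarrow> mean A f \<le> mean A g"
  unfolding mean_def by (intro divide_right_mono sum_mono) auto

lemma mean_nonneg: "(\<And>x. x \<in> A \<Longrightarrow> 0 \<le> f x) \<Longrightarrow> 0 \<le> mean A f"
  unfolding mean_def by (intro divide_nonneg_nonneg sum_nonneg) auto

lemma mean_const: "finite A \<Longrightarrow> A \<noteq> {} \<Longrightarrow> mean A (\<lambda>_. c) = c"
  unfolding mean_def by simp

lemma mean_add: "mean A (\<lambda>x. f x + g x) = mean A f + mean A g"
  unfolding mean_def by (simp add: sum.distrib add_divide_distrib)

lemma mean_cmult: "mean A (\<lambda>x. c * f x) = c * mean A f"
  unfolding mean_def by (simp add: sum_distrib_left)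

lemma mean_sum: "mean A (\<lambda>x. \<Sum>i\<in>I. f i x) = (\<Sum>i\<in>I. mean A (f i))"
  unfolding mean_def by (subst sum.swap) (simp add: sum_divide_distrib)

section \<open>Sums and averages over the discrete cube\<close>

lemma sum_Pow_insert:
  fixes f :: "'a set \<Rightarrow> real"
  assumes "finite A" "a \<notin> A"
  shows "(\<Sum>U\<in>Pow (insert a A). f U) = (\<Sum>U\<in>Pow A. f U + f (insert a U))"
proof -
  have "(\<Sum>U\<in>Pow (insert a A). f U) = (\<Sum>U\<in>Pow A. f U) + (\<Sum>U\<in>insert a ` Pow A. f U)"
    unfolding Pow_insert using assms by (intro sum.union_disjoint) auto
  also have "(\<Sum>U\<in>insert a ` Pow A. f U) = (\<Sum>U\<in>Pow A. f (insert a U))"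
    using assms by (intro sum.reindex_cong[of "insert a"]) (auto simp: inj_on_def)
  finally show ?thesis by (simp add: sum.distrib)
qed

lemma sum_Pow_split:
  fixes f :: "'a set \<Rightarrow> real"
  assumes "finite A" "a \<in> A"
  shows "(\<Sum>U\<in>Pow A. f U) = (\<Sum>U\<in>Pow (A - {a}). f U + f (insert a U))"
  using sum_Pow_insert[of "A - {a}" a f] assms by (simp add: insert_absorb)

text \<open>Both averages stay over \<open>Pow S\<close> with bit \<open>e\<close> overwritten, so
  every remaining set is counted twice. In this form a transcript law with one forced bit lives on
  the same sample space as the original law.\<close>

lemma mean_Pow_split:
  assumes "finite S" "e \<in> S"
  shows "mean (Pow S) f = (mean (Pow S) (\<lambda>U. f (U - {e})) + mean (Pow S) (\<lambda>U. f (insert e U))) / 2"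
proof -
  have "(\<Sum>U\<in>Pow S. f (U - {e})) = 2 * (\<Sum>U\<in>Pow (S - {e}). f U)"
    unfolding sum_Pow_split[OF assms] sum_distrib_left
    by (intro sum.cong) (auto simp: Diff_insert_absorb subset_Diff_insert)
  moreover have "(\<Sum>U\<in>Pow S. f (insert e U)) = 2 * (\<Sum>U\<in>Pow (S - {e}). f (insert e U))"
    unfolding sum_Pow_split[OF assms] sum_distrib_left by (intro sum.cong) auto
  moreover have "(\<Sum>U\<in>Pow S. f U) =
      (\<Sum>U\<in>Pow (S - {e}). f U) + (\<Sum>U\<in>Pow (S - {e}). f (insert e U))"
    unfolding sum_Pow_split[OF assms] by (simp add: sum.distrib)
  ultimately show ?thesis unfolding mean_def by (simp add: add_divide_distrib)
qed

section \<open>The level-one inequality\<close>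

lemma cosh_le_exp: "(exp w + exp (- w)) / 2 \<le> exp (w\<^sup>2 / 2)" for w :: real
proof -
  have pos: "(exp w + exp (- w)) / 2 \<le> exp (w\<^sup>2 / 2)" if "w \<ge> 0" for w :: real
  proof -
    \<comment> \<open>Hoeffding's estimate for a fair coin, taken at \<open>2 * w\<close>;
      recentring the coin turns it into the bound on the hyperbolic cosine.\<close>
    have "- (2 * w) * (1/2) + ln (1 + 1/2 * (exp (2 * w) - 1)) \<le> (2 * w)\<^sup>2 / 8"
      using that by (intro Hoeffdings_lemma_aux) auto
    hence "ln (1 + 1/2 * (exp (2 * w) - 1)) \<le> w + w\<^sup>2 / 2"
      by (simp add: power2_eq_square)
    moreover have p: "0 < 1 + 1/2 * (exp (2 * w) - 1)"
      using exp_gt_zero[of "2 * w"] by (simp add: field_simps add_pos_pos)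
    ultimately have "1 + 1/2 * (exp (2 * w) - 1) \<le> exp (w + w\<^sup>2 / 2)"
      by (metis exp_le_cancel_iff exp_ln)
    hence "exp (- w) * (1 + 1/2 * (exp (2 * w) - 1)) \<le> exp (- w) * exp (w + w\<^sup>2 / 2)"
      by simp
    also have "\<dots> = exp (w\<^sup>2 / 2)" by (simp flip: exp_add)
    also have "exp (- w) * (1 + 1/2 * (exp (2 * w) - 1)) = (exp w + exp (- w)) / 2"
      by (simp add: field_simps flip: exp_add)
    finally show ?thesis .
  qed
  show ?thesis
    using pos[of w] pos[of "- w"] by (cases "w \<ge> 0") (auto simp: add.commute)
qed

text \<open>The character of degree one. Up to normalisation, \<open>mean A (sgn_at e)\<close> is
  the level-one Fourier coefficient of the indicator of \<open>A\<close>.\<close>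

definition sgn_at :: "'a \<Rightarrow> 'a set \<Rightarrow> real" where
  "sgn_at e U = (if e \<in> U then - 1 else 1)"

lemma sum_Pow_exp_sgn_at:
  assumes "finite S"
  shows "(\<Sum>U\<in>Pow S. exp (\<Sum>e\<in>S. w e * sgn_at e U)) = (\<Prod>e\<in>S. exp (w e) + exp (- w e))"
  using assms
proof (induction S rule: finite_induct)
  case (insert a S)
  have 1: "(\<Sum>e\<in>S. w e * sgn_at e (insert a U)) = (\<Sum>e\<in>S. w e * sgn_at e U)" for U
    using insert.hyps by (intro sum.cong) (auto simp: sgn_at_def)
  have "(\<Sum>U\<in>Pow (insert a S). exp (\<Sum>e\<in>insert a S. w e * sgn_at e U)) =
     (\<Sum>U\<in>Pow S. exp (w a + (\<Sum>e\<in>S. w e * sgn_at e U)) + exp (- w a + (\<Sum>e\<in>S. w e * sgn_at e U)))"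
    unfolding sum_Pow_insert[OF insert.hyps]
  proof (rule sum.cong[OF refl])
    fix U assume "U \<in> Pow S"
    hence "a \<notin> U" using insert.hyps by auto
    thus "exp (\<Sum>e\<in>insert a S. w e * sgn_at e U) + exp (\<Sum>e\<in>insert a S. w e * sgn_at e (insert a U)) =
        exp (w a + (\<Sum>e\<in>S. w e * sgn_at e U)) + exp (- w a + (\<Sum>e\<in>S. w e * sgn_at e U))"
      using insert.hyps 1[of U] by (simp add: sgn_at_def)
  qed
  also have "\<dots> = (exp (w a) + exp (- w a)) * (\<Sum>U\<in>Pow S. exp (\<Sum>e\<in>S. w e * sgn_at e U))"
    unfolding exp_add sum.distrib sum_distrib_left[symmetric] by (simp add: algebra_simps)
  finally show ?case using insert by simp
qed simp

text \<open>Tilt the uniform measure in the direction of the centre of mass of \<open>A\<close>.\<close>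

lemma level_one_inequality:
  fixes S :: "'a set"
  assumes "finite S" "A \<subseteq> Pow S" "A \<noteq> {}"
  shows "(\<Sum>e\<in>S. (mean A (sgn_at e))\<^sup>2) \<le> 2 * ln (2 ^ card S / real (card A))"
proof -
  define w where "w e = mean A (sgn_at e)" for e
  define q where "q = (\<Sum>e\<in>S. (w e)\<^sup>2)"
  have finA: "finite A" using assms finite_subset by blast
  hence cA: "real (card A) > 0" using assms(3) by (simp add: card_gt_0_iff)
  define g where "g U = (\<Sum>e\<in>S. w e * sgn_at e U)" for U
  have mg: "mean A g = q"
    unfolding g_def mean_sum mean_cmult q_def by (simp add: w_def power2_eq_square)
  have "exp (\<Sum>U\<in>A. (1 / card A) *\<^sub>R g U) \<le> (\<Sum>U\<in>A. (1 / card A) * exp (g U))"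
    using finA assms(3) cA convex_on_exp[of 1]
    by (intro convex_on_sum[of A UNIV exp]) auto
  moreover have "(\<Sum>U\<in>A. (1 / card A) *\<^sub>R g U) = q"
    using mg unfolding mean_def by (simp add: sum_divide_distrib)
  ultimately have "exp q * card A \<le> (\<Sum>U\<in>A. exp (g U))"
    using cA by (simp add: sum_divide_distrib[symmetric] field_simps)
  also have "\<dots> \<le> (\<Sum>U\<in>Pow S. exp (g U))"
    using assms by (intro sum_mono2) auto
  also have "\<dots> = (\<Prod>e\<in>S. exp (w e) + exp (- w e))"
    unfolding g_def by (rule sum_Pow_exp_sgn_at[OF assms(1)])
  also have "\<dots> \<le> (\<Prod>e\<in>S. 2 * exp ((w e)\<^sup>2 / 2))"
  proof (intro prod_mono conjI)
    fix e show "exp (w e) + exp (- w e) \<le> 2 * exp ((w e)\<^sup>2 / 2)"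
      using cosh_le_exp[of "w e"] by simp
  qed (auto intro: add_nonneg_nonneg)
  also have "\<dots> = 2 ^ card S * exp (q / 2)"
    unfolding q_def using assms(1)
    by (simp add: prod.distrib exp_sum[symmetric] sum_divide_distrib)
  finally have "exp q * card A \<le> 2 ^ card S * exp (q / 2)" .
  hence "exp q / exp (q / 2) \<le> 2 ^ card S / card A"
    using cA by (simp add: field_simps)
  hence "exp (q / 2) \<le> 2 ^ card S / card A"
    by (simp flip: exp_diff)
  hence "q / 2 \<le> ln (2 ^ card S / card A)"
    using cA by (subst ln_ge_iff) auto
  thus ?thesis by (simp add: q_def w_def)
qed

section \<open>Hellinger distances caused by one random bit\<close>

text \<open>Squared Hellinger distance is at most the triangular discrimination; multiplied out
  because both masses may be 0.\<close>

lemma sqrt_diff_square_le: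
  fixes x y :: real
  assumes "0 \<le> x" "0 \<le> y"
  shows "(sqrt x - sqrt y)\<^sup>2 * (x + y) \<le> (x - y)\<^sup>2"
proof -
  have "x + y \<le> (sqrt x + sqrt y)\<^sup>2"
    using assms by (simp add: power2_sum)
  hence "(sqrt x - sqrt y)\<^sup>2 * (x + y) \<le> (sqrt x - sqrt y)\<^sup>2 * (sqrt x + sqrt y)\<^sup>2"
    by (intro mult_left_mono) auto
  also have "\<dots> = ((sqrt x - sqrt y) * (sqrt x + sqrt y))\<^sup>2"
    by (simp add: power_mult_distrib)
  also have "(sqrt x - sqrt y) * (sqrt x + sqrt y) = x - y"
    using assms by (simp add: algebra_simps)
  finally show ?thesis .
qed

definition prob_eq :: "'a set \<Rightarrow> ('a \<Rightarrow> 'b) \<Rightarrow> 'b \<Rightarrow> real" where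
  "prob_eq A f v = mean A (\<lambda>x. of_bool (f x = v))"

lemma prob_eq_nonneg: "0 \<le> prob_eq A f v"
  unfolding prob_eq_def by (rule mean_nonneg) auto

lemma sum_prob_eq:
  assumes "finite A" "A \<noteq> {}" "finite V" "f ` A \<subseteq> V"
  shows "(\<Sum>v\<in>V. prob_eq A f v) = 1"
proof -
  have "(\<Sum>v\<in>V. prob_eq A f v) = mean A (\<lambda>x. \<Sum>v\<in>V. of_bool (f x = v))"
    unfolding prob_eq_def mean_sum ..
  also have "\<dots> = mean A (\<lambda>_. 1)"
  proof (rule mean_cong)
    fix x assume "x \<in> A"
    hence fx: "f x \<in> V" using assms by auto
    have "(\<Sum>v\<in>V. of_bool (f x = v)) = (\<Sum>v\<in>V. if v = f x then 1 else (0::real))"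
      by (intro sum.cong) auto
    thus "(\<Sum>v\<in>V. of_bool (f x = v)) = (1::real)" using fx assms by simp
  qed
  finally show ?thesis using assms by (simp add: mean_const)
qed

lemma entropy_le_ln_card:
  fixes p :: "'a \<Rightarrow> real"
  assumes "finite V" "V \<noteq> {}" "\<And>v. v \<in> V \<Longrightarrow> 0 \<le> p v" "(\<Sum>v\<in>V. p v) = 1"
  shows "(\<Sum>v\<in>V. p v * ln (1 / p v)) \<le> ln (card V)"
proof -
  have c: "real (card V) > 0" using assms by (simp add: card_gt_0_iff)
  have "p v * ln (1 / p v) \<le> p v * ln (card V) + (1 / card V - p v)" if "v \<in> V" for v
  proof (cases "p v = 0")
    case False
    hence pv: "p v > 0" using assms(3)[OF that] by simp
    have "ln (1 / p v) - ln (card V) = ln (1 / (card V * p v))"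
      using pv c by (simp add: ln_div ln_mult)
    also have "\<dots> \<le> 1 / (card V * p v) - 1"
      using pv c by (intro ln_le_minus_one) auto
    finally have "p v * (ln (1 / p v) - ln (card V)) \<le> p v * (1 / (card V * p v) - 1)"
      using pv by (intro mult_left_mono) auto
    also have "\<dots> = 1 / card V - p v" using pv c by (simp add: field_simps)
    finally show ?thesis by (simp add: algebra_simps)
  qed (use c in auto)
  hence "(\<Sum>v\<in>V. p v * ln (1 / p v)) \<le> (\<Sum>v\<in>V. p v * ln (card V) + (1 / card V - p v))"
    by (rule sum_mono)
  also have "\<dots> = ln (card V)"
    using assms c by (simp add: sum.distrib sum_subtractf sum_distrib_right[symmetric])
  finally show ?thesis .
qed

text \<open>On the fibre \<open>A v\<close> of a value \<open>v\<close>, the relative difference of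
  the two forced laws is the bias of bit \<open>e\<close>. Each term is thus at most
  \<open>2 * P v\<close> times a squared bias, the level-one inequality sums these over
  \<open>e\<close> to \<open>4 * P v * ln (1 / P v)\<close>, and the sum over \<open>v\<close> is
  four times an entropy.\<close>

lemma sum_hellinger_flip_le:
  fixes S :: "'a set" and f :: "'a set \<Rightarrow> 'b"
  assumes "finite S" "finite V" "f ` Pow S \<subseteq> V"
  shows "(\<Sum>e\<in>S. \<Sum>v\<in>V. (sqrt (prob_eq (Pow S) (\<lambda>U. f (U - {e})) v)
            - sqrt (prob_eq (Pow S) (\<lambda>U. f (insert e U)) v))\<^sup>2) \<le> 4 * ln (card V)"
proof -
  define P where "P v = prob_eq (Pow S) f v" for v
  define P0 where "P0 e v = prob_eq (Pow S) (\<lambda>U. f (U - {e})) v" for e v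
  define P1 where "P1 e v = prob_eq (Pow S) (\<lambda>U. f (insert e U)) v" for e v
  define A where "A v = {U \<in> Pow S. f U = v}" for v
  have nn: "0 \<le> P v" "0 \<le> P0 e v" "0 \<le> P1 e v" for e v
    by (simp_all add: P_def P0_def P1_def prob_eq_nonneg)
  have half: "P v = (P0 e v + P1 e v) / 2" if "e \<in> S" for e v
    unfolding P_def P0_def P1_def prob_eq_def by (rule mean_Pow_split[OF assms(1) that])
  have finA: "finite (A v)" for v using assms(1) by (simp add: A_def)
  have PA: "P v = card (A v) / 2 ^ card S" for v
  proof -
    have "(\<Sum>U\<in>Pow S. of_bool (f U = v)) = real (card (A v))"
      using assms(1) unfolding A_def by (simp add: of_bool_def sum.If_cases Int_def)
    thus ?thesis using assms(1) by (simp add: P_def prob_eq_def mean_def card_Pow)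
  qed
  have diff: "(P0 e v - P1 e v) / 2 = P v * mean (A v) (sgn_at e)" if "e \<in> S" for e v
  proof -
    have "mean (Pow S) (\<lambda>U. of_bool (f U = v) * sgn_at e U) = (P0 e v - P1 e v) / 2"
    proof -
      have "mean (Pow S) (\<lambda>U. of_bool (f (U - {e}) = v) * sgn_at e (U - {e})) = P0 e v"
        unfolding P0_def prob_eq_def by (rule mean_cong) (simp add: sgn_at_def)
      moreover have "mean (Pow S) (\<lambda>U. of_bool (f (insert e U) = v) * sgn_at e (insert e U)) =
          mean (Pow S) (\<lambda>U. (- 1) * of_bool (f (insert e U) = v))"
        by (rule mean_cong) (simp add: sgn_at_def)
      moreover have "\<dots> = - P1 e v" unfolding P1_def prob_eq_def mean_cmult by simp
      ultimately show ?thesis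
        using mean_Pow_split[OF assms(1) that, of "\<lambda>U. of_bool (f U = v) * sgn_at e U"] by simp
    qed
    moreover have "mean (Pow S) (\<lambda>U. of_bool (f U = v) * sgn_at e U) = P v * mean (A v) (sgn_at e)"
    proof -
      have "(\<Sum>U\<in>Pow S. of_bool (f U = v) * sgn_at e U) = (\<Sum>U\<in>A v. sgn_at e U)"
        using assms(1) unfolding A_def
        by (simp add: of_bool_def sum.inter_filter[symmetric] if_distrib[of "\<lambda>x. x * _"] cong: if_cong)
      thus ?thesis using assms(1) finA[of v]
        by (cases "A v = {}") (auto simp: mean_def PA card_Pow card_gt_0_iff)
    qed
    ultimately show ?thesis by simp
  qed
  have h: "(sqrt (P0 e v) - sqrt (P1 e v))\<^sup>2 \<le> 2 * P v * (mean (A v) (sgn_at e))\<^sup>2" if "e \<in> S" for e v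
  proof (cases "P v = 0")
    case True
    hence "P0 e v = 0 \<and> P1 e v = 0" using half[OF that, of v] nn(2,3)[of e v]
      by (simp add: add_nonneg_eq_0_iff)
    thus ?thesis using nn by simp
  next
    case False
    hence p: "P v > 0" using nn(1)[of v] by simp
    have "(sqrt (P0 e v) - sqrt (P1 e v))\<^sup>2 * (2 * P v) \<le> (P0 e v - P1 e v)\<^sup>2"
      using sqrt_diff_square_le[of "P0 e v" "P1 e v"] nn half[OF that, of v] by (simp add: field_simps)
    also have "\<dots> = (2 * (P v * mean (A v) (sgn_at e)))\<^sup>2"
      using diff[OF that, of v] by (simp add: field_simps)
    finally have "(sqrt (P0 e v) - sqrt (P1 e v))\<^sup>2 * (2 * P v)
       \<le> (2 * P v * (mean (A v) (sgn_at e))\<^sup>2) * (2 * P v)"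
      by (simp add: power2_eq_square algebra_simps)
    thus ?thesis using p by simp
  qed
  have ne: "V \<noteq> {}" using assms(3) by auto
  have "(\<Sum>e\<in>S. \<Sum>v\<in>V. (sqrt (P0 e v) - sqrt (P1 e v))\<^sup>2)
      \<le> (\<Sum>e\<in>S. \<Sum>v\<in>V. 2 * P v * (mean (A v) (sgn_at e))\<^sup>2)"
    by (intro sum_mono h)
  also have "\<dots> = (\<Sum>v\<in>V. 2 * P v * (\<Sum>e\<in>S. (mean (A v) (sgn_at e))\<^sup>2))"
    by (subst sum.swap) (simp add: sum_distrib_left)
  also have "\<dots> \<le> (\<Sum>v\<in>V. 4 * (P v * ln (1 / P v)))"
  proof (rule sum_mono)
    fix v
    show "2 * P v * (\<Sum>e\<in>S. (mean (A v) (sgn_at e))\<^sup>2) \<le> 4 * (P v * ln (1 / P v))"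
    proof (cases "A v = {}")
      case False
      have "2 * P v * (\<Sum>e\<in>S. (mean (A v) (sgn_at e))\<^sup>2) \<le> 2 * P v * (2 * ln (2 ^ card S / card (A v)))"
        using nn(1)[of v] False assms(1)
        by (intro mult_left_mono level_one_inequality) (auto simp: A_def)
      thus ?thesis by (simp add: PA)
    qed (simp add: PA)
  qed
  also have "\<dots> = 4 * (\<Sum>v\<in>V. P v * ln (1 / P v))" by (simp add: sum_distrib_left)
  also have "\<dots> \<le> 4 * ln (card V)"
    using assms ne nn by (intro mult_left_mono entropy_le_ln_card) (auto simp: P_def intro: sum_prob_eq)
  finally show ?thesis by (simp add: P0_def P1_def)
qed

section \<open>Hellinger distance and Jayram's partition argument\<close>

text \<open>The squared Hellinger distance without the customary factor 1/2, so it equals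
  \<open>2 - 2 *\<close> affinity for probability distributions.\<close>

definition hell :: "'v set \<Rightarrow> ('v \<Rightarrow> real) \<Rightarrow> ('v \<Rightarrow> real) \<Rightarrow> real" where
  "hell V p q = (\<Sum>v\<in>V. (sqrt (p v) - sqrt (q v))\<^sup>2)"

lemma hell_nonneg: "0 \<le> hell V p q"
  unfolding hell_def by (intro sum_nonneg) auto

lemma hell_commute: "hell V p q = hell V q p"
  unfolding hell_def by (simp add: power2_commute)

lemma hell_eq:
  assumes "\<And>v. v \<in> V \<Longrightarrow> 0 \<le> p v" "\<And>v. v \<in> V \<Longrightarrow> 0 \<le> q v"
    "(\<Sum>v\<in>V. p v) = 1" "(\<Sum>v\<in>V. q v) = 1"
  shows "hell V p q = 2 - 2 * (\<Sum>v\<in>V. sqrt (p v * q v))"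
proof -
  have "hell V p q = (\<Sum>v\<in>V. p v + q v - 2 * sqrt (p v * q v))"
    unfolding hell_def using assms(1,2)
    by (intro sum.cong) (auto simp: power2_diff real_sqrt_mult)
  thus ?thesis using assms(3,4) by (simp add: sum.distrib sum_subtractf sum_distrib_left)
qed

lemma hell_triangle2: "hell V p r \<le> 2 * hell V p q + 2 * hell V q r"
proof -
  have "(a - c)\<^sup>2 \<le> 2 * (a - b)\<^sup>2 + 2 * (b - c)\<^sup>2" for a b c :: real
    using sum_squares_ge_zero[of "a - b - (b - c)" 0] by (simp add: power2_eq_square algebra_simps)
  thus ?thesis unfolding hell_def sum_distrib_left sum.distrib[symmetric] by (intro sum_mono)
qed

text \<open>Equality holds when \<open>c\<close> is the mean; any other centre only adds the square
  that is dropped here. It is used with the all-zero planting as centre.\<close>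

lemma sum_pairwise_square_le:
  fixes v :: "'t \<Rightarrow> real"
  assumes "finite I"
  shows "(\<Sum>a\<in>I. \<Sum>b\<in>I. (v a - v b)\<^sup>2) \<le> 2 * real (card I) * (\<Sum>a\<in>I. (v a - c)\<^sup>2)"
proof -
  define u where "u a = v a - c" for a
  have "(\<Sum>a\<in>I. \<Sum>b\<in>I. (v a - v b)\<^sup>2) = (\<Sum>a\<in>I. \<Sum>b\<in>I. (u a)\<^sup>2 + (u b)\<^sup>2 - 2 * (u a * u b))"
    by (intro sum.cong refl) (simp add: u_def power2_eq_square algebra_simps)
  also have "\<dots> = 2 * real (card I) * (\<Sum>a\<in>I. (u a)\<^sup>2) - 2 * (\<Sum>a\<in>I. u a)\<^sup>2"
    by (simp add: sum.distrib sum_subtractf power2_eq_square flip: sum_distrib_left sum_distrib_right)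
  finally show ?thesis by (simp add: u_def)
qed

text \<open>Symmetric difference is the addition of the cube as a vector space over two elements. A
  nonempty \<open>s\<close> thus gives an involution without fixed points, i.e. a perfect matching
  of the cube.\<close>

definition sdiff :: "'a set \<Rightarrow> 'a set \<Rightarrow> 'a set" where
  "sdiff a s = (a - s) \<union> (s - a)"

lemma sdiff_invol [simp]: "sdiff (sdiff a s) s = a" "sdiff a (sdiff a s) = s"
  unfolding sdiff_def by auto

text \<open>The infinite product is about 0.289. The bound 1/4 alone is not inductive; the extra
  summand \<open>1 / 2 ^ (r + 2)\<close> pays for the next factor.\<close>

lemma partition_factor_ge: "1/4 \<le> (\<Prod>i<r. 1 - 1 / 2 ^ Suc i :: real)"
proof -
  have "1/4 + 1 / 2 ^ (r + 2) \<le> (\<Prod>i<Suc r. 1 - 1 / 2 ^ Suc i :: real)" for r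
  proof (induction r)
    case (Suc r)
    define q :: real where "q = 1 / 2 ^ (r + 2)"
    have q: "0 < q" "q \<le> 1/4" by (auto simp: q_def field_simps)
    have "1/4 + 1 / 2 ^ (Suc r + 2) = 1/4 + q / 2" by (simp add: q_def)
    also have "\<dots> \<le> (1/4 + q) * (1 - q)"
    proof -
      have "q * q \<le> q * (1/4)" using q by (intro mult_left_mono) auto
      thus ?thesis by (simp add: field_simps)
    qed
    also have "\<dots> \<le> (\<Prod>i<Suc r. 1 - 1 / 2 ^ Suc i) * (1 - q)"
    proof (rule mult_right_mono)
      show "1/4 + q \<le> (\<Prod>i<Suc r. 1 - 1 / 2 ^ Suc i)" using Suc.IH by (simp add: q_def)
    qed (use q in auto)
    also have "\<dots> = (\<Prod>i<Suc (Suc r). 1 - 1 / 2 ^ Suc i)" by (simp add: q_def)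
    finally show ?case .
  qed simp
  note bound = this
  show ?thesis
  proof (cases r)
    case (Suc q)
    have "(1/4 :: real) \<le> 1/4 + 1 / 2 ^ (q + 2)" by simp
    also note bound[of q]
    finally show ?thesis by (simp only: Suc)
  qed simp
qed

text \<open>Merging the parts along a perfect matching \<open>T \<leftrightarrow> sdiff T s\<close> of the index cube loses only a
  factor \<open>1 - 1/N\<close> for the best \<open>s\<close>; this is Jayram's partition argument.\<close>

lemma partition_aux:
  fixes f :: "'a set \<Rightarrow> real"
  assumes pair: "\<And>(Q :: nat set) A. finite Q \<Longrightarrow> disjoint_family_on A (Pow Q) \<Longrightarrow>
      (\<Sum>a\<in>Pow Q. \<Sum>b\<in>Pow Q - {a}. f (A a \<union> A b)) \<le> 2 * 2 ^ card Q * (\<Sum>a\<in>Pow Q. f (A a))"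
  shows "finite (Q :: nat set) \<Longrightarrow> card Q = r \<Longrightarrow> disjoint_family_on A (Pow Q) \<Longrightarrow>
      (\<Prod>i<r. 1 - 1 / 2 ^ Suc i) * f (\<Union>a\<in>Pow Q. A a) \<le> (\<Sum>a\<in>Pow Q. f (A a))"
proof (induction r arbitrary: Q A)
  case 0
  thus ?case by simp
next
  case (Suc r)
  note fin = \<open>finite Q\<close> and disj = \<open>disjoint_family_on A (Pow Q)\<close>
  define N :: real where "N = 2 ^ Suc r"
  define g where "g a b = f (A a \<union> A b)" for a b
  define \<Sigma> where "\<Sigma> = (\<Sum>a\<in>Pow Q. f (A a))"
  have N: "N \<ge> 2" by (simp add: N_def)
  \<comment> \<open>The matchings given by the nonempty \<open>s\<close> together contain every
    ordered pair of distinct indices exactly once, so some \<open>s\<close> does no worse than the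
    average.\<close>
  have "(\<Sum>s\<in>Pow Q - {{}}. \<Sum>a\<in>Pow Q. g a (sdiff a s)) = (\<Sum>a\<in>Pow Q. \<Sum>s\<in>Pow Q - {{}}. g a (sdiff a s))"
    by (rule sum.swap)
  also have "\<dots> = (\<Sum>a\<in>Pow Q. \<Sum>b\<in>Pow Q - {a}. g a b)"
  proof (rule sum.cong[OF refl])
    fix a assume a: "a \<in> Pow Q"
    show "(\<Sum>s\<in>Pow Q - {{}}. g a (sdiff a s)) = (\<Sum>b\<in>Pow Q - {a}. g a b)"
      using a by (intro sum.reindex_bij_witness[of _ "sdiff a" "sdiff a"]) (auto simp: sdiff_def)
  qed
  also have "\<dots> \<le> 2 * N * \<Sigma>"
    using pair[OF fin disj] Suc.prems(2) by (simp add: g_def N_def \<Sigma>_def)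
  finally have tot: "(\<Sum>s\<in>Pow Q - {{}}. \<Sum>a\<in>Pow Q. g a (sdiff a s)) \<le> 2 * N * \<Sigma>" .
  have cardP: "real (card (Pow Q - {{}})) = N - 1"
    using fin Suc.prems(2) by (simp add: card_Diff_singleton card_Pow N_def of_nat_diff)
  have "\<exists>s\<in>Pow Q - {{}}. (N - 1) * (\<Sum>a\<in>Pow Q. g a (sdiff a s)) \<le> 2 * N * \<Sigma>"
  proof (rule ccontr)
    assume notex: "\<not> ?thesis"
    have *: "2 * N * \<Sigma> / (N - 1) < (\<Sum>a\<in>Pow Q. g a (sdiff a s))" if "s \<in> Pow Q - {{}}" for s
    proof -
      have "2 * N * \<Sigma> < (N - 1) * (\<Sum>a\<in>Pow Q. g a (sdiff a s))"
        using notex that by (meson not_le)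
      thus ?thesis using N by (subst pos_divide_less_eq) (auto simp: mult.commute)
    qed
    have ne: "Pow Q - {{}} \<noteq> {}" using Suc.prems(2) by auto
    have "(\<Sum>s\<in>Pow Q - {{}}. 2 * N * \<Sigma> / (N - 1)) < (\<Sum>s\<in>Pow Q - {{}}. \<Sum>a\<in>Pow Q. g a (sdiff a s))"
      using * fin ne by (intro sum_strict_mono) auto
    moreover have "(\<Sum>s\<in>Pow Q - {{}}. 2 * N * \<Sigma> / (N - 1)) = 2 * N * \<Sigma>"
      using cardP N by simp
    ultimately show False using tot by linarith
  qed
  then obtain s where s: "s \<in> Pow Q - {{}}" "(N - 1) * (\<Sum>a\<in>Pow Q. g a (sdiff a s)) \<le> 2 * N * \<Sigma>"
    by blast
  \<comment> \<open>As \<open>e \<in> s\<close>, exactly one of \<open>a\<close> and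
    \<open>sdiff a s\<close> contains \<open>e\<close>; the sets avoiding \<open>e\<close> therefore
    represent the matched pairs, and they again form a cube, of dimension one less.\<close>
  obtain e where e: "e \<in> s" "e \<in> Q" using s(1) by auto
  define A' where "A' a = A a \<union> A (sdiff a s)" for a
  have sQ: "s \<subseteq> Q" using s(1) by auto
  have "(\<Sum>a\<in>Pow Q. g a (sdiff a s)) = (\<Sum>a\<in>Pow (Q - {e}). g a (sdiff a s)) + (\<Sum>a\<in>Pow (Q - {e}). g (insert e a) (sdiff (insert e a) s))"
    unfolding sum_Pow_split[OF fin e(2)] by (rule sum.distrib)
  also have "(\<Sum>a\<in>Pow (Q - {e}). g (insert e a) (sdiff (insert e a) s)) = (\<Sum>a\<in>Pow (Q - {e}). g a (sdiff a s))"
  proof (rule sum.reindex_bij_witness[of _ "\<lambda>a. sdiff a s - {e}" "\<lambda>a. sdiff (insert e a) s"])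
    fix a assume "a \<in> Pow (Q - {e})"
    hence a: "a \<subseteq> Q" "e \<notin> a" by auto
    show "sdiff (sdiff (insert e a) s) s - {e} = a" using a e by simp
    show "sdiff (insert e a) s \<in> Pow (Q - {e})" using a e sQ by (auto simp: sdiff_def)
    have "insert e (sdiff a s - {e}) = sdiff a s" using a e by (auto simp: sdiff_def)
    thus "sdiff (insert e (sdiff a s - {e})) s = a" by simp
    show "sdiff a s - {e} \<in> Pow (Q - {e})" using a sQ by (auto simp: sdiff_def)
    show "g (sdiff (insert e a) s) (sdiff (sdiff (insert e a) s) s) = g (insert e a) (sdiff (insert e a) s)"
      by (simp add: g_def Un_commute)
  qed
  finally have half: "(\<Sum>a\<in>Pow Q. g a (sdiff a s)) = 2 * (\<Sum>a\<in>Pow (Q - {e}). f (A' a))"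
    by (simp add: g_def A'_def)
  have disj': "disjoint_family_on A' (Pow (Q - {e}))"
    unfolding disjoint_family_on_def
  proof (intro ballI impI)
    fix a b assume ab: "a \<in> Pow (Q - {e})" "b \<in> Pow (Q - {e})" "a \<noteq> b"
    have mem: "a \<in> Pow Q" "b \<in> Pow Q" "sdiff a s \<in> Pow Q" "sdiff b s \<in> Pow Q"
      using ab sQ by (auto simp: sdiff_def)
    have ne: "a \<noteq> sdiff b s" "b \<noteq> sdiff a s" using ab e by (auto simp: sdiff_def)
    have "sdiff a s \<noteq> sdiff b s" using ab(3) by (metis sdiff_invol(1))
    thus "A' a \<inter> A' b = {}"
      using disj mem ne ab(3) unfolding disjoint_family_on_def A'_def by blast
  qed
  have un: "(\<Union>a\<in>Pow (Q - {e}). A' a) = (\<Union>a\<in>Pow Q. A a)"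
  proof (intro equalityI subsetI)
    fix z assume "z \<in> (\<Union>a\<in>Pow (Q - {e}). A' a)"
    then obtain a where a: "a \<subseteq> Q - {e}" "z \<in> A a \<or> z \<in> A (sdiff a s)" by (auto simp: A'_def)
    moreover have "a \<in> Pow Q" "sdiff a s \<in> Pow Q" using a(1) sQ by (auto simp: sdiff_def)
    ultimately show "z \<in> (\<Union>a\<in>Pow Q. A a)" by blast
  next
    fix z assume "z \<in> (\<Union>a\<in>Pow Q. A a)"
    then obtain a where a: "a \<subseteq> Q" "z \<in> A a" by auto
    show "z \<in> (\<Union>a\<in>Pow (Q - {e}). A' a)"
    proof (cases "e \<in> a")
      case True
      hence "sdiff a s \<in> Pow (Q - {e})" using a e sQ by (auto simp: sdiff_def)
      moreover have "z \<in> A' (sdiff a s)" using a by (simp add: A'_def)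
      ultimately show ?thesis by blast
    qed (use a in \<open>auto simp: A'_def\<close>)
  qed
  have "(\<Prod>i<Suc r. 1 - 1 / 2 ^ Suc i) * f (\<Union>a\<in>Pow Q. A a) =
      (1 - 1 / N) * ((\<Prod>i<r. 1 - 1 / 2 ^ Suc i) * f (\<Union>a\<in>Pow (Q - {e}). A' a))"
    unfolding un by (simp add: N_def)
  also have "\<dots> \<le> (1 - 1 / N) * (\<Sum>a\<in>Pow (Q - {e}). f (A' a))"
    using N fin e Suc.prems(2) disj' by (intro mult_left_mono Suc.IH) auto
  also have "\<dots> \<le> \<Sigma>"
    using s(2) N unfolding half by (simp add: field_simps)
  finally show ?case by (simp add: \<Sigma>_def)
qed

text \<open>The rectangle property in probabilistic form: \<open>P S\<close> is the transcript law
  when exactly the sites in \<open>S\<close> hold a 1 in one chosen cell, and each site contributes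
  a factor that depends only on its own bit.\<close>

locale site_product =
  fixes V :: "'v set" and I :: "nat set" and c :: "'v \<Rightarrow> real" and \<phi> :: "'v \<Rightarrow> nat \<Rightarrow> bool \<Rightarrow> real"
    and P :: "nat set \<Rightarrow> 'v \<Rightarrow> real"
  assumes finV: "finite V" and finI: "finite I"
    and c_nonneg: "\<And>v. v \<in> V \<Longrightarrow> 0 \<le> c v" and \<phi>_nonneg: "\<And>v i b. v \<in> V \<Longrightarrow> 0 \<le> \<phi> v i b"
    and P_eq: "\<And>S v. v \<in> V \<Longrightarrow> P S v = c v * (\<Prod>i\<in>I. \<phi> v i (i \<in> S))"
    and mass: "\<And>S. (\<Sum>v\<in>V. P S v) = 1"
begin

lemma P_nonneg: "v \<in> V \<Longrightarrow> 0 \<le> P S v"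
  unfolding P_eq by (intro mult_nonneg_nonneg prod_nonneg) (auto simp: c_nonneg \<phi>_nonneg)

text \<open>For disjoint \<open>A\<close> and \<open>B\<close> each site contributes the same two
  factors to \<open>P A v * P B v\<close> as to \<open>P {} v * P (A \<union> B) v\<close>. The
  products agree pointwise, hence so do the affinities.\<close>

lemma cut_and_paste:
  assumes "A \<inter> B = {}"
  shows "hell V (P A) (P B) = hell V (P {}) (P (A \<union> B))"
proof -
  have "P A v * P B v = P {} v * P (A \<union> B) v" if "v \<in> V" for v
  proof -
    have "(\<Prod>i\<in>I. \<phi> v i (i \<in> A)) * (\<Prod>i\<in>I. \<phi> v i (i \<in> B)) =
        (\<Prod>i\<in>I. \<phi> v i (i \<in> {})) * (\<Prod>i\<in>I. \<phi> v i (i \<in> A \<union> B))"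
      unfolding prod.distrib[symmetric]
    proof (intro prod.cong refl)
      fix i
      show "\<phi> v i (i \<in> A) * \<phi> v i (i \<in> B) = \<phi> v i (i \<in> {}) * \<phi> v i (i \<in> A \<union> B)"
        using assms by (cases "i \<in> A"; cases "i \<in> B") auto
    qed
    thus ?thesis using that by (simp add: P_eq algebra_simps)
  qed
  thus ?thesis by (simp add: hell_eq P_nonneg mass)
qed

text \<open>Cut-and-paste turns the distance from \<open>P {}\<close> to a merged part into the
  distance between the two parts. Square roots of densities are vectors in a Euclidean space, so the
  pairwise distances are controlled by the distances to the common point
  \<open>P {}\<close>.\<close>

lemma partition_pair:
  assumes "finite (Q :: nat set)" "disjoint_family_on A (Pow Q)"
  shows "(\<Sum>a\<in>Pow Q. \<Sum>b\<in>Pow Q - {a}. hell V (P {}) (P (A a \<union> A b)))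
     \<le> 2 * 2 ^ card Q * (\<Sum>a\<in>Pow Q. hell V (P {}) (P (A a)))"
proof -
  have "(\<Sum>a\<in>Pow Q. \<Sum>b\<in>Pow Q - {a}. hell V (P {}) (P (A a \<union> A b))) =
      (\<Sum>a\<in>Pow Q. \<Sum>b\<in>Pow Q - {a}. hell V (P (A a)) (P (A b)))"
    using assms(2) unfolding disjoint_family_on_def
    by (intro sum.cong refl cut_and_paste[symmetric]) auto
  also have "\<dots> \<le> (\<Sum>a\<in>Pow Q. \<Sum>b\<in>Pow Q. hell V (P (A a)) (P (A b)))"
    using assms(1) by (intro sum_mono sum_mono2) (auto simp: hell_nonneg)
  also have "\<dots> = (\<Sum>v\<in>V. \<Sum>a\<in>Pow Q. \<Sum>b\<in>Pow Q. (sqrt (P (A a) v) - sqrt (P (A b) v))\<^sup>2)"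
    unfolding hell_def by (subst (2) sum.swap) (subst sum.swap, rule refl)
  also have "\<dots> \<le> (\<Sum>v\<in>V. 2 * real (card (Pow Q)) * (\<Sum>a\<in>Pow Q. (sqrt (P (A a) v) - sqrt (P {} v))\<^sup>2))"
    using assms(1) by (intro sum_mono sum_pairwise_square_le) auto
  also have "\<dots> = 2 * 2 ^ card Q * (\<Sum>v\<in>V. \<Sum>a\<in>Pow Q. (sqrt (P (A a) v) - sqrt (P {} v))\<^sup>2)"
    using assms(1) by (simp add: card_Pow sum_distrib_left)
  also have "(\<Sum>v\<in>V. \<Sum>a\<in>Pow Q. (sqrt (P (A a) v) - sqrt (P {} v))\<^sup>2) = (\<Sum>a\<in>Pow Q. hell V (P {}) (P (A a)))"
    unfolding hell_def by (subst sum.swap) (simp add: power2_commute)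
  finally show ?thesis .
qed

text \<open>The parts are the singletons, indexed by a cube; this is where the size has to be a
  power of two. The 4 is the inverse of the bound on the merging losses.\<close>

lemma partition_lemma:
  assumes "finite S" "card S = 2 ^ r"
  shows "hell V (P {}) (P S) \<le> 4 * (\<Sum>i\<in>S. hell V (P {}) (P {i}))"
proof -
  have "card (Pow {..<r}) = card S" using assms(2) by (simp add: card_Pow)
  then obtain h where h: "bij_betw h (Pow {..<r}) S"
    using finite_same_card_bij[of "Pow {..<r}" S] assms(1) by auto
  define A where "A a = {h a}" for a
  have un: "(\<Union>a\<in>Pow {..<r}. A a) = S" using h by (auto simp: A_def bij_betw_def)
  have disj: "disjoint_family_on A (Pow {..<r})"
    using h unfolding disjoint_family_on_def A_def bij_betw_def inj_on_def by auto
  have "(\<Prod>i<r. 1 - 1 / 2 ^ Suc i) * hell V (P {}) (P S) \<le> (\<Sum>a\<in>Pow {..<r}. hell V (P {}) (P (A a)))"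
    using partition_aux[of "\<lambda>S. hell V (P {}) (P S)" "{..<r}" r A, OF partition_pair] disj by (simp add: un)
  also have "\<dots> = (\<Sum>i\<in>S. hell V (P {}) (P {i}))"
    unfolding A_def by (rule sum.reindex_bij_betw[OF h])
  finally have "(\<Prod>i<r. 1 - 1 / 2 ^ Suc i) * hell V (P {}) (P S) \<le> (\<Sum>i\<in>S. hell V (P {}) (P {i}))" .
  moreover have "1/4 * hell V (P {}) (P S) \<le> (\<Prod>i<r. 1 - 1 / 2 ^ Suc i) * hell V (P {}) (P S)"
    by (intro mult_right_mono partition_factor_ge hell_nonneg)
  ultimately show ?thesis by linarith
qed

end

section \<open>Correlated pairs of bit vectors\<close>

text \<open>Joint convexity, by Cauchy-Schwarz for the affinity. The weights need not sum to
  1.\<close>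

lemma hellinger_convex:
  fixes c f g :: "'a \<Rightarrow> real"
  assumes "\<And>x. x \<in> X \<Longrightarrow> 0 \<le> c x" "\<And>x. x \<in> X \<Longrightarrow> 0 \<le> f x" "\<And>x. x \<in> X \<Longrightarrow> 0 \<le> g x"
  shows "(sqrt (\<Sum>x\<in>X. c x * f x) - sqrt (\<Sum>x\<in>X. c x * g x))\<^sup>2
     \<le> (\<Sum>x\<in>X. c x * (sqrt (f x) - sqrt (g x))\<^sup>2)"
proof -
  define F where "F = (\<Sum>x\<in>X. c x * f x)"
  define G where "G = (\<Sum>x\<in>X. c x * g x)"
  have nn: "0 \<le> F" "0 \<le> G" unfolding F_def G_def using assms by (auto intro!: sum_nonneg)
  have "(\<Sum>x\<in>X. sqrt (c x * f x) * sqrt (c x * g x))\<^sup>2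
      \<le> (\<Sum>x\<in>X. (sqrt (c x * f x))\<^sup>2) * (\<Sum>x\<in>X. (sqrt (c x * g x))\<^sup>2)"
    by (rule Cauchy_Schwarz_ineq_sum)
  also have "\<dots> = F * G"
    unfolding F_def G_def using assms by (simp cong: sum.cong)
  finally have "(\<Sum>x\<in>X. sqrt (c x * f x) * sqrt (c x * g x)) \<le> sqrt F * sqrt G"
    by (metis real_le_rsqrt real_sqrt_mult)
  moreover have "(\<Sum>x\<in>X. sqrt (c x * f x) * sqrt (c x * g x)) = (\<Sum>x\<in>X. c x * (sqrt (f x) * sqrt (g x)))"
    using assms by (intro sum.cong) (auto simp: real_sqrt_mult)
  ultimately have cs: "(\<Sum>x\<in>X. c x * (sqrt (f x) * sqrt (g x))) \<le> sqrt F * sqrt G" by simp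
  have "(\<Sum>x\<in>X. c x * (sqrt (f x) - sqrt (g x))\<^sup>2)
      = (\<Sum>x\<in>X. c x * f x + c x * g x - 2 * (c x * (sqrt (f x) * sqrt (g x))))"
    using assms by (intro sum.cong) (auto simp: power2_diff algebra_simps)
  also have "\<dots> = F + G - 2 * (\<Sum>x\<in>X. c x * (sqrt (f x) * sqrt (g x)))"
    by (simp add: F_def G_def sum.distrib sum_subtractf sum_distrib_left)
  also have "\<dots> \<ge> F + G - 2 * (sqrt F * sqrt G)" using cs by simp
  also have "F + G - 2 * (sqrt F * sqrt G) = (sqrt F - sqrt G)\<^sup>2"
    using nn by (simp add: power2_diff)
  finally show ?thesis by (simp add: F_def G_def)
qed

text \<open>The joint law of two fair bits with correlation \<open>r\<close>.\<close>

definition kern :: "real \<Rightarrow> bool \<Rightarrow> bool \<Rightarrow> real" where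
  "kern r u w = (if u = w then 1 + r else 1 - r) / 4"

lemma kern_commute: "kern r u w = kern r w u"
  by (auto simp: kern_def)

text \<open>The term linear in \<open>r\<close> cancels after summation over the transcripts.\<close>

lemma one_bit_bound:
  fixes a b :: "bool \<Rightarrow> real" and r :: real
  assumes r: "0 \<le> r" "r \<le> 1/2" and a: "\<And>u. 0 \<le> a u" and b: "\<And>u. 0 \<le> b u"
  defines "Bu \<equiv> \<lambda>u. 2 * (\<Sum>w\<in>UNIV. kern r u w * b w)"
    and "Aw \<equiv> \<lambda>w. 2 * (\<Sum>u\<in>UNIV. kern r u w * a u)"
    and "N \<equiv> (\<Sum>u\<in>UNIV. \<Sum>w\<in>UNIV. kern r u w * a u * b w)"
  shows "(\<Sum>u\<in>UNIV. \<Sum>w\<in>UNIV. kern r u w * a u * b w * ln (Bu u * Aw w / N))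
     \<le> r * (1 + r\<^sup>2) * ((a True - a False) * (b True - b False) / 4)
       + 2 * r\<^sup>2 * ((sqrt (a False) - sqrt (a True))\<^sup>2 * ((b False + b True) / 2)
                 + (a False + a True) / 2 * (sqrt (b False) - sqrt (b True))\<^sup>2)"
proof -
  \<comment> \<open>Fourier coordinates of \<open>a\<close> and \<open>b\<close>. The kernel is
    diagonal in them, so that for instance \<open>N = am * bm + r * (ad * bd)\<close>.\<close>
  define am where "am = (a False + a True) / 2"
  define bm where "bm = (b False + b True) / 2"
  define ad where "ad = (a False - a True) / 2"
  define bd where "bd = (b False - b True) / 2"
  have ab: "a False = am + ad" "a True = am - ad" "b False = bm + bd" "b True = bm - bd"
    by (simp_all add: am_def ad_def bm_def bd_def field_simps)
  have le: "\<bar>ad\<bar> \<le> am" "\<bar>bd\<bar> \<le> bm"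
    using a[of True] a[of False] b[of True] b[of False] ab by linarith+
  hence nn: "0 \<le> am" "0 \<le> bm" by linarith+
  have K: "kern r u u = (1 + r) / 4" "kern r True False = (1 - r) / 4" "kern r False True = (1 - r) / 4" for u
    by (simp_all add: kern_def)
  have N: "N = am * bm + r * (ad * bd)"
    unfolding N_def by (simp add: UNIV_bool K ab field_simps)
  have Bu: "Bu False = bm + r * bd" "Bu True = bm - r * bd"
    unfolding Bu_def by (simp_all add: UNIV_bool K ab field_simps)
  have Aw: "Aw False = am + r * ad" "Aw True = am - r * ad"
    unfolding Aw_def by (simp_all add: UNIV_bool K ab field_simps)
  have hel: "ad\<^sup>2 / am \<le> (sqrt (a False) - sqrt (a True))\<^sup>2" if "am > 0"
  proof -
    have "ad\<^sup>2 = (sqrt (a False) - sqrt (a True))\<^sup>2 * (sqrt (a False) + sqrt (a True))\<^sup>2 / 4"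
      unfolding power_mult_distrib[symmetric] using a
      by (simp add: ad_def square_diff_square_factored[symmetric] power_divide algebra_simps)
    also have "\<dots> \<le> (sqrt (a False) - sqrt (a True))\<^sup>2 * (4 * am) / 4"
    proof -
      have "(sqrt (a False) + sqrt (a True))\<^sup>2 \<le> 2 * (a False + a True)"
        using sum_squares_bound[of "sqrt (a False)" "sqrt (a True)"] a by (simp add: power2_sum)
      thus ?thesis by (intro divide_right_mono mult_left_mono) (auto simp: am_def)
    qed
    finally show ?thesis using that by (simp add: field_simps)
  qed
  have hel': "bd\<^sup>2 / bm \<le> (sqrt (b False) - sqrt (b True))\<^sup>2" if "bm > 0"
  proof -
    have "bd\<^sup>2 = (sqrt (b False) - sqrt (b True))\<^sup>2 * (sqrt (b False) + sqrt (b True))\<^sup>2 / 4"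
      unfolding power_mult_distrib[symmetric] using b
      by (simp add: bd_def square_diff_square_factored[symmetric] power_divide algebra_simps)
    also have "\<dots> \<le> (sqrt (b False) - sqrt (b True))\<^sup>2 * (4 * bm) / 4"
    proof -
      have "(sqrt (b False) + sqrt (b True))\<^sup>2 \<le> 2 * (b False + b True)"
        using sum_squares_bound[of "sqrt (b False)" "sqrt (b True)"] b by (simp add: power2_sum)
      thus ?thesis by (intro divide_right_mono mult_left_mono) (auto simp: bm_def)
    qed
    finally show ?thesis using that by (simp add: field_simps)
  qed
  show ?thesis
  proof (cases "am * bm = 0")
    case True
    hence "(a False = 0 \<and> a True = 0) \<or> (b False = 0 \<and> b True = 0)"
      using le unfolding ab by auto
    thus ?thesis using a b by (auto simp: UNIV_bool)
  next
    case False
    hence pos: "am > 0" "bm > 0" using nn by auto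
    \<comment> \<open>The restriction \<open>r \<le> 1/2\<close> enters here: it keeps
      \<open>N\<close> comparable to \<open>am * bm\<close> even when \<open>ad\<close> and
      \<open>bd\<close> are as large as possible.\<close>
    have "\<bar>ad * bd\<bar> \<le> am * bm" unfolding abs_mult using le by (intro mult_mono) auto
    hence "r * \<bar>ad * bd\<bar> \<le> 1/2 * (am * bm)" using r by (intro mult_mono) auto
    hence "\<bar>r * (ad * bd)\<bar> \<le> am * bm / 2" using r by (simp add: abs_mult)
    hence Nge: "N \<ge> am * bm / 2" unfolding N by linarith
    hence Npos: "N > 0" using pos by (smt (verit) mult_pos_pos half_gt_zero)
    have "(\<Sum>u\<in>UNIV. \<Sum>w\<in>UNIV. kern r u w * a u * b w * ln (Bu u * Aw w / N))
        \<le> (\<Sum>u\<in>UNIV. \<Sum>w\<in>UNIV. kern r u w * a u * b w * (Bu u * Aw w / N - 1))"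
    proof (intro sum_mono mult_left_mono)
      fix u w
      have "\<bar>r * bd\<bar> < bm" "\<bar>r * ad\<bar> < am"
        using r le pos mult_right_mono[of r "1/2" "\<bar>bd\<bar>"] mult_right_mono[of r "1/2" "\<bar>ad\<bar>"]
        by (auto simp: abs_mult)
      hence "Bu u > 0" "Aw w > 0" by (cases u; cases w; simp add: Bu Aw; linarith)+
      thus "ln (Bu u * Aw w / N) \<le> Bu u * Aw w / N - 1"
        using Npos by (intro ln_le_minus_one) auto
      show "0 \<le> kern r u w * a u * b w" using r a b by (auto simp: kern_def)
    qed
    also have "\<dots> = (\<Sum>u\<in>UNIV. \<Sum>w\<in>UNIV. kern r u w * a u * b w * (Bu u * Aw w)) / N - N"
      unfolding N_def[symmetric]
      by (simp add: N_def UNIV_bool add_divide_distrib algebra_simps)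
    also have "(\<Sum>u\<in>UNIV. \<Sum>w\<in>UNIV. kern r u w * a u * b w * (Bu u * Aw w))
        = N\<^sup>2 + r * (1 + r\<^sup>2) * (ad * bd) * (N - r * (ad * bd)) + r\<^sup>2 * (ad\<^sup>2 * bm\<^sup>2 + am\<^sup>2 * bd\<^sup>2)"
      unfolding N by (simp add: UNIV_bool K ab Bu Aw power2_eq_square field_simps)
    also have "\<dots> / N - N = r * (1 + r\<^sup>2) * (ad * bd) - r\<^sup>2 * (1 + r\<^sup>2) * (ad * bd)\<^sup>2 / N
        + r\<^sup>2 * (ad\<^sup>2 * bm\<^sup>2 + am\<^sup>2 * bd\<^sup>2) / N"
      using Npos by (simp add: field_simps power2_eq_square)
    also have "\<dots> \<le> r * (1 + r\<^sup>2) * (ad * bd) + r\<^sup>2 * (ad\<^sup>2 * bm\<^sup>2 + am\<^sup>2 * bd\<^sup>2) / N"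
      using Npos by (simp add: divide_nonneg_pos)
    also have "r\<^sup>2 * (ad\<^sup>2 * bm\<^sup>2 + am\<^sup>2 * bd\<^sup>2) / N \<le> r\<^sup>2 * (ad\<^sup>2 * bm\<^sup>2 + am\<^sup>2 * bd\<^sup>2) / (am * bm / 2)"
      using Nge pos by (intro divide_left_mono) (auto intro!: mult_pos_pos Npos)
    also have "\<dots> = 2 * r\<^sup>2 * (ad\<^sup>2 / am * bm + am * (bd\<^sup>2 / bm))"
      using pos by (simp add: field_simps power2_eq_square)
    also have "\<dots> \<le> 2 * r\<^sup>2 * ((sqrt (a False) - sqrt (a True))\<^sup>2 * bm + am * (sqrt (b False) - sqrt (b True))\<^sup>2)"
      using pos hel hel' by (intro mult_left_mono add_mono mult_right_mono) auto
    finally show ?thesis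
      by (simp add: am_def bm_def ad_def bd_def field_simps)
  qed
qed

section \<open>Chain rule for correlated bit vectors\<close>

definition ins :: "'a \<Rightarrow> bool \<Rightarrow> 'a set \<Rightarrow> 'a set" where
  "ins j u x = (if u then insert j x else x)"

lemma ins_simps [simp]: "ins j True x = insert j x" "ins j False x = x"
  by (simp_all add: ins_def)

lemma sum_Pow_ins:
  fixes f :: "'a set \<Rightarrow> real"
  assumes "finite J" "j \<notin> J"
  shows "(\<Sum>x\<in>Pow (insert j J). f x) = (\<Sum>x\<in>Pow J. \<Sum>u\<in>UNIV. f (ins j u x))"
  unfolding sum_Pow_insert[OF assms] by (simp add: UNIV_bool)

text \<open>Sets \<open>x, y \<subseteq> J\<close> encode bit vectors; bits \<open>j\<close> of the two have correlation \<open>\<rho> j\<close> and are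
  uniform. For the transcript distribution \<open>\<alpha> x * \<beta> y\<close>, \<open>infl\<close> is the integrand of
  \<open>I(x; \<Pi>) + I(y; \<Pi>) - I(x, y; \<Pi>) = I(x; y) - I(x; y | \<Pi>)\<close> for a single transcript.\<close>

context
  fixes \<rho> :: "'j \<Rightarrow> real"
  assumes \<rho>: "\<And>j. 0 \<le> \<rho> j" "\<And>j. \<rho> j \<le> 1/2"
begin

definition wt :: "'j set \<Rightarrow> 'j set \<Rightarrow> 'j set \<Rightarrow> real" where
  "wt J x y = (\<Prod>j\<in>J. kern (\<rho> j) (j \<in> x) (j \<in> y))"

text \<open>The noise operator: the conditional expectation of \<open>f\<close> at the second vector
  given that the first one is \<open>x\<close>. The power of 2 is the inverse of the uniform
  marginal weight of \<open>x\<close>.\<close>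

definition noise :: "'j set \<Rightarrow> ('j set \<Rightarrow> real) \<Rightarrow> 'j set \<Rightarrow> real" where
  "noise J f x = (\<Sum>y\<in>Pow J. 2 ^ card J * wt J x y * f y)"

definition corr :: "'j set \<Rightarrow> ('j set \<Rightarrow> real) \<Rightarrow> ('j set \<Rightarrow> real) \<Rightarrow> real" where
  "corr J \<alpha> \<beta> = (\<Sum>x\<in>Pow J. \<Sum>y\<in>Pow J. wt J x y * \<alpha> x * \<beta> y)"

definition infl :: "'j set \<Rightarrow> ('j set \<Rightarrow> real) \<Rightarrow> ('j set \<Rightarrow> real) \<Rightarrow> real" where
  "infl J \<alpha> \<beta> = (\<Sum>x\<in>Pow J. \<Sum>y\<in>Pow J. wt J x y * \<alpha> x * \<beta> y *
      ln (noise J \<beta> x * noise J \<alpha> y / corr J \<alpha> \<beta>))"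

text \<open>The two bits \<open>j\<close> span a square of four planted pairs. Summed over
  transcripts, this is half the sum of the squared Hellinger distances along the four edges of the
  square, averaged over the other coordinates.\<close>

definition flips :: "'j set \<Rightarrow> 'j \<Rightarrow> ('j set \<Rightarrow> real) \<Rightarrow> ('j set \<Rightarrow> real) \<Rightarrow> real" where
  "flips J j \<alpha> \<beta> = (\<Sum>x\<in>Pow (J - {j}). \<Sum>y\<in>Pow (J - {j}). wt (J - {j}) x y *
      ((sqrt (\<alpha> x) - sqrt (\<alpha> (insert j x)))\<^sup>2 * ((\<beta> y + \<beta> (insert j y)) / 2)
       + (\<alpha> x + \<alpha> (insert j x)) / 2 * (sqrt (\<beta> y) - sqrt (\<beta> (insert j y)))\<^sup>2))"

lemma kern_pos: "0 < kern (\<rho> j) u w"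
  using \<rho>[of j] by (auto simp: kern_def)

lemma wt_pos: "0 < wt J x y"
  unfolding wt_def by (intro prod_pos) (auto simp: kern_pos)

lemma wt_commute: "wt J x y = wt J y x"
  unfolding wt_def by (intro prod.cong refl kern_commute)

lemma wt_ins:
  assumes "finite J" "j \<notin> J" "x \<subseteq> J" "y \<subseteq> J"
  shows "wt (insert j J) (ins j u x) (ins j w y) = kern (\<rho> j) u w * wt J x y"
proof -
  have "j \<notin> x" "j \<notin> y" using assms by auto
  moreover have "wt J (ins j u x) (ins j w y) = wt J x y"
    unfolding wt_def
  proof (intro prod.cong refl)
    fix i assume "i \<in> J"
    hence "i \<noteq> j" using assms by auto
    thus "kern (\<rho> i) (i \<in> ins j u x) (i \<in> ins j w y) = kern (\<rho> i) (i \<in> x) (i \<in> y)"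
      by (simp add: ins_def)
  qed
  ultimately show ?thesis using assms by (simp add: wt_def ins_def)
qed

lemma sum_wt:
  assumes "finite J" "x \<subseteq> J"
  shows "(\<Sum>y\<in>Pow J. wt J x y) = 1 / 2 ^ card J"
  using assms
proof (induction J arbitrary: x rule: finite_induct)
  case (insert j J)
  define x' u where "x' = x - {j}" and "u = (j \<in> x)"
  have x: "x = ins j u x'" "x' \<subseteq> J" using insert by (auto simp: x'_def u_def ins_def)
  have "(\<Sum>y\<in>Pow (insert j J). wt (insert j J) x y)
      = (\<Sum>y\<in>Pow J. \<Sum>w\<in>UNIV. kern (\<rho> j) u w * wt J x' y)"
    unfolding sum_Pow_ins[OF insert.hyps] using insert.hyps x
    by (intro sum.cong refl) (simp add: wt_ins)
  also have "\<dots> = (\<Sum>y\<in>Pow J. 1/2 * wt J x' y)"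
    by (intro sum.cong refl) (cases u; simp add: UNIV_bool kern_def field_simps)
  also have "\<dots> = 1/2 * (1 / 2 ^ card J)"
    unfolding sum_distrib_left[symmetric] insert.IH[OF x(2)] ..
  finally show ?case using insert.hyps by simp
qed (simp add: wt_def)

lemma noise_nonneg: "(\<And>y. 0 \<le> f y) \<Longrightarrow> 0 \<le> noise J f x"
  unfolding noise_def using wt_pos[of J] by (intro sum_nonneg) (simp add: less_imp_le)

lemma noise_pos:
  assumes "finite J" "\<And>y. 0 \<le> f y" "y \<subseteq> J" "f y > 0"
  shows "noise J f x > 0"
  unfolding noise_def using assms wt_pos[of J x]
  by (intro sum_pos2[of "Pow J" y]) (auto simp: less_imp_le)

lemma corr_nonneg: "(\<And>x. 0 \<le> \<alpha> x) \<Longrightarrow> (\<And>y. 0 \<le> \<beta> y) \<Longrightarrow> 0 \<le> corr J \<alpha> \<beta>"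
  unfolding corr_def using wt_pos[of J] by (intro sum_nonneg) (simp add: less_imp_le)

lemma corr_pos:
  assumes "finite J" "\<And>x. 0 \<le> \<alpha> x" "\<And>y. 0 \<le> \<beta> y" "x \<subseteq> J" "\<alpha> x > 0" "y \<subseteq> J" "\<beta> y > 0"
  shows "corr J \<alpha> \<beta> > 0"
  unfolding corr_def using assms wt_pos[of J]
  by (intro sum_pos2[of "Pow J" x] sum_pos2[of "Pow J" y] sum_nonneg) (auto simp: less_imp_le)

lemma sum_wt_left: "(\<Sum>x\<in>Pow J. wt J x y * f x) = noise J f y / 2 ^ card J"
  unfolding noise_def by (simp add: sum_divide_distrib wt_commute[of J y])

lemma sum_wt_right: "(\<Sum>y\<in>Pow J. wt J x y * f y) = noise J f x / 2 ^ card J"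
  unfolding noise_def by (simp add: sum_divide_distrib)

lemma noise_ins:
  assumes "finite J" "j \<notin> J" "x \<subseteq> J"
  shows "noise (insert j J) f (ins j u x) =
     noise J (\<lambda>y. 2 * (\<Sum>w\<in>UNIV. kern (\<rho> j) u w * f (ins j w y))) x"
  unfolding noise_def sum_Pow_ins[OF assms(1,2)] using assms
  by (intro sum.cong refl) (simp add: wt_ins sum_distrib_left mult_ac)

text \<open>One step of the chain rule: block \<open>j\<close> is split off, conditioning on its first bit in the
  remaining blocks and on the second bits of the other blocks in block \<open>j\<close>. The discarded term is
  a conditional mutual information, hence nonnegative.\<close>

lemma infl_insert:
  assumes J: "finite J" "j \<notin> J" and \<alpha>: "\<And>x. 0 \<le> \<alpha> x" and \<beta>: "\<And>x. 0 \<le> \<beta> x"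
  defines "Bu \<equiv> \<lambda>u y. 2 * (\<Sum>w\<in>UNIV. kern (\<rho> j) u w * \<beta> (ins j w y))"
    and "A \<equiv> \<lambda>u y. noise J (\<lambda>x. \<alpha> (ins j u x)) y"
  defines "Aw \<equiv> \<lambda>w y. 2 * (\<Sum>u\<in>UNIV. kern (\<rho> j) u w * A u y)"
    and "N \<equiv> \<lambda>y. \<Sum>u\<in>UNIV. \<Sum>w\<in>UNIV. kern (\<rho> j) u w * A u y * \<beta> (ins j w y)"
  shows "infl (insert j J) \<alpha> \<beta> \<le> (\<Sum>u\<in>UNIV. infl J (\<lambda>x. \<alpha> (ins j u x)) (Bu u)) / 2
     + (\<Sum>y\<in>Pow J. \<Sum>u\<in>UNIV. \<Sum>w\<in>UNIV.
          kern (\<rho> j) u w * A u y * \<beta> (ins j w y) * ln (Bu u y * Aw w y / N y)) / 2 ^ card J"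
proof -
  define a where "a u x = \<alpha> (ins j u x)" for u x
  define b where "b w y = \<beta> (ins j w y)" for w y
  define K where "K u w = kern (\<rho> j) u w" for u w
  define T where "T = corr (insert j J) \<alpha> \<beta>"
  define Tu where "Tu u = corr J (a u) (Bu u)" for u
  define m where "m x y u w = K u w * wt J x y * a u x * b w y" for x y u w
  define q where "q u y = Tu u * N y / (T * (A u y * Bu u y))" for u y
  have ann: "0 \<le> a u x" and bnn: "0 \<le> b u x" for u x by (simp_all add: a_def b_def \<alpha> \<beta>)
  have Kpos: "0 < K u w" for u w by (simp add: K_def kern_pos)
  have Bnn: "0 \<le> Bu u y" for u y
    unfolding Bu_def using Kpos bnn by (auto intro!: sum_nonneg simp: K_def b_def less_imp_le)
  have Ann: "0 \<le> A u y" for u y unfolding A_def using \<alpha> by (intro noise_nonneg) auto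
  have Nnn: "0 \<le> N y" for y
    unfolding N_def using Kpos Ann bnn by (auto intro!: sum_nonneg simp: K_def b_def less_imp_le)
  have Tunn: "0 \<le> Tu u" for u unfolding Tu_def by (intro corr_nonneg ann Bnn)
  have Tnn: "0 \<le> T" unfolding T_def by (intro corr_nonneg \<alpha> \<beta>)
  have mnn: "0 \<le> m x y u w" for x y u w
    unfolding m_def using Kpos[of u w] wt_pos[of J x y] ann bnn by (simp add: less_imp_le)
  have Bu_b: "Bu u y = 2 * (\<Sum>w\<in>UNIV. K u w * b w y)" for u y by (simp add: Bu_def K_def b_def)
  have Aw_A: "Aw w y = 2 * (\<Sum>u\<in>UNIV. K u w * A u y)" for w y by (simp add: Aw_def K_def)
  have N_b: "N y = (\<Sum>u\<in>UNIV. \<Sum>w\<in>UNIV. K u w * A u y * b w y)" for y by (simp add: N_def K_def b_def)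
  have A_a: "A u y = noise J (a u) y" for u y by (simp add: A_def a_def[abs_def])
  have nzb: "noise (insert j J) \<beta> (ins j u x) = noise J (Bu u) x" if "x \<subseteq> J" for u x
    using noise_ins[OF J that, of \<beta> u] by (simp add: Bu_def[abs_def])
  have nza: "noise (insert j J) \<alpha> (ins j w y) = Aw w y" if "y \<subseteq> J" for w y
  proof -
    have "noise (insert j J) \<alpha> (ins j w y) = noise J (\<lambda>x. 2 * (\<Sum>u\<in>UNIV. K w u * a u x)) y"
      using noise_ins[OF J that, of \<alpha> w] by (simp add: K_def a_def)
    also have "\<dots> = Aw w y"
      unfolding Aw_A A_a noise_def
      by (simp add: UNIV_bool sum_distrib_left sum.distrib algebra_simps K_def kern_commute)
    finally show ?thesis .
  qed
  have Bu2: "(\<Sum>w\<in>UNIV. K u w * b w y) = Bu u y / 2" for u y by (simp add: Bu_b)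
  have sumx: "(\<Sum>x\<in>Pow J. m x y u w) = K u w * A u y * b w y / 2 ^ card J" for y u w
  proof -
    have "(\<Sum>x\<in>Pow J. m x y u w) = K u w * b w y * (\<Sum>x\<in>Pow J. wt J x y * a u x)"
      by (simp add: m_def sum_distrib_left mult_ac)
    thus ?thesis by (simp add: sum_wt_left A_a)
  qed
  have sumw: "(\<Sum>w\<in>UNIV. m x y u w) = wt J x y * a u x * Bu u y / 2" for x y u
  proof -
    have "(\<Sum>w\<in>UNIV. m x y u w) = wt J x y * a u x * (\<Sum>w\<in>UNIV. K u w * b w y)"
      by (simp add: m_def sum_distrib_left mult_ac)
    thus ?thesis by (simp add: Bu2)
  qed
  have swap4: "(\<Sum>x\<in>Pow J. \<Sum>u\<in>UNIV. \<Sum>y\<in>Pow J. \<Sum>w\<in>UNIV. f x y u w) =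
      (\<Sum>y\<in>Pow J. \<Sum>u\<in>UNIV. \<Sum>w\<in>UNIV. \<Sum>x\<in>Pow J. f x y u w)"
    for f :: "'j set \<Rightarrow> 'j set \<Rightarrow> bool \<Rightarrow> bool \<Rightarrow> real"
  proof -
    have "(\<Sum>x\<in>Pow J. \<Sum>u\<in>UNIV. \<Sum>y\<in>Pow J. \<Sum>w\<in>UNIV. f x y u w) =
        (\<Sum>x\<in>Pow J. \<Sum>y\<in>Pow J. \<Sum>u\<in>UNIV. \<Sum>w\<in>UNIV. f x y u w)"
      by (rule sum.cong[OF refl], rule sum.swap)
    also have "\<dots> = (\<Sum>y\<in>Pow J. \<Sum>x\<in>Pow J. \<Sum>u\<in>UNIV. \<Sum>w\<in>UNIV. f x y u w)"
      by (rule sum.swap)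
    also have "\<dots> = (\<Sum>y\<in>Pow J. \<Sum>u\<in>UNIV. \<Sum>x\<in>Pow J. \<Sum>w\<in>UNIV. f x y u w)"
      by (rule sum.cong[OF refl], rule sum.swap)
    also have "\<dots> = (\<Sum>y\<in>Pow J. \<Sum>u\<in>UNIV. \<Sum>w\<in>UNIV. \<Sum>x\<in>Pow J. f x y u w)"
      by (rule sum.cong[OF refl], rule sum.cong[OF refl], rule sum.swap)
    finally show ?thesis .
  qed
  have T_m: "T = (\<Sum>x\<in>Pow J. \<Sum>u\<in>UNIV. \<Sum>y\<in>Pow J. \<Sum>w\<in>UNIV. m x y u w)"
    unfolding T_def corr_def sum_Pow_ins[OF J]
    by (intro sum.cong refl) (use J in \<open>simp add: wt_ins m_def a_def b_def K_def mult_ac\<close>)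
  have T_N: "T = (\<Sum>y\<in>Pow J. N y) / 2 ^ card J"
    unfolding T_m swap4 sumx N_b by (simp add: sum_divide_distrib)
  have T_Tu: "T = (\<Sum>u\<in>UNIV. Tu u) / 2"
  proof -
    have "T = (\<Sum>x\<in>Pow J. \<Sum>u\<in>UNIV. \<Sum>y\<in>Pow J. wt J x y * a u x * Bu u y / 2)"
      unfolding T_m sumw ..
    also have "\<dots> = (\<Sum>u\<in>UNIV. Tu u) / 2"
      unfolding Tu_def corr_def by (simp add: UNIV_bool sum.distrib add_divide_distrib flip: sum_divide_distrib)
    finally show ?thesis .
  qed
  have ln_split: "m x y u w * ln (noise J (Bu u) x * Aw w y / T) \<le>
      m x y u w * ln (noise J (Bu u) x * A u y / Tu u) + m x y u w * ln (Bu u y * Aw w y / N y)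
      + (m x y u w * q u y - m x y u w)" if "x \<subseteq> J" "y \<subseteq> J" for x y u w
  \<comment> \<open>Degenerate quotients inside the logarithms occur only where \<open>m\<close>
    vanishes, and there all terms are 0.\<close>
  proof (cases "m x y u w = 0")
    case False
    hence pos: "a u x > 0" "b w y > 0"
      using ann[of u x] bnn[of w y] by (auto simp: m_def less_le)
    have "K u w * b w y \<le> (\<Sum>w\<in>UNIV. K u w * b w y)"
      using Kpos bnn by (intro member_le_sum) (auto simp: less_imp_le)
    hence B: "Bu u y > 0" unfolding Bu_b using pos Kpos[of u w] by (smt (verit) mult_pos_pos)
    have Ap: "A u y > 0" unfolding A_a by (rule noise_pos[where y = x]) (use J ann that pos in auto)
    have "K u w * A u y \<le> (\<Sum>u\<in>UNIV. K u w * A u y)"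
      using Kpos Ann by (intro member_le_sum[of u UNIV "\<lambda>u. K u w * A u y"]) (auto simp: less_imp_le)
    hence Awp: "Aw w y > 0" unfolding Aw_A using Ap Kpos[of u w] by (smt (verit) mult_pos_pos)
    have "K u w * A u y * b w y \<le> (\<Sum>w\<in>UNIV. K u w * A u y * b w y)"
      using Kpos Ann bnn by (intro member_le_sum[of w UNIV "\<lambda>w. K u w * A u y * b w y"]) (auto simp: less_imp_le)
    also have "\<dots> \<le> N y" unfolding N_b
      using Kpos Ann bnn
      by (intro member_le_sum[of u UNIV "\<lambda>u. \<Sum>w\<in>UNIV. K u w * A u y * b w y"] sum_nonneg) (auto simp: less_imp_le)
    finally have Np: "N y > 0" using Ap pos Kpos[of u w] by (smt (verit) mult_pos_pos)
    have Tup: "Tu u > 0" unfolding Tu_def by (rule corr_pos[where x = x and y = y]) (use J ann Bnn that pos B in auto)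
    hence Tp: "T > 0" unfolding T_Tu using Tunn by (cases u) (auto simp: UNIV_bool add_pos_nonneg add_nonneg_pos)
    have nB: "noise J (Bu u) x > 0" by (rule noise_pos[where y = y]) (use J Bnn that B in auto)
    have "ln (noise J (Bu u) x * Aw w y / T) =
       ln (noise J (Bu u) x * A u y / Tu u) + ln (Bu u y * Aw w y / N y) + ln (q u y)"
      unfolding q_def using nB Awp Tp Ap Tup B Np by (simp add: ln_mult ln_div)
    also have "ln (q u y) \<le> q u y - 1"
      unfolding q_def using Tp Ap Tup B Np by (intro ln_le_minus_one) auto
    finally have "ln (noise J (Bu u) x * Aw w y / T) \<le>
       ln (noise J (Bu u) x * A u y / Tu u) + ln (Bu u y * Aw w y / N y) + (q u y - 1)" by simp
    from mult_left_mono[OF this mnn[of x y u w]] show ?thesis by (simp add: algebra_simps)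
  qed simp
  have gibbs: "(\<Sum>x\<in>Pow J. \<Sum>u\<in>UNIV. \<Sum>y\<in>Pow J. \<Sum>w\<in>UNIV. m x y u w * q u y - m x y u w) \<le> 0"
  proof -
    have "(\<Sum>x\<in>Pow J. \<Sum>u\<in>UNIV. \<Sum>y\<in>Pow J. \<Sum>w\<in>UNIV. m x y u w * q u y)
       = (\<Sum>y\<in>Pow J. \<Sum>u\<in>UNIV. A u y * Bu u y * q u y / 2 / 2 ^ card J)"
    proof -
      have "(\<Sum>w\<in>UNIV. \<Sum>x\<in>Pow J. m x y u w * q u y) = A u y * Bu u y * q u y / 2 / 2 ^ card J" for y u
      proof -
        have "(\<Sum>w\<in>UNIV. \<Sum>x\<in>Pow J. m x y u w * q u y) = A u y * q u y / 2 ^ card J * (\<Sum>w\<in>UNIV. K u w * b w y)"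
          unfolding sum_distrib_right[symmetric] sumx by (simp add: sum_distrib_left sum_distrib_right sum_divide_distrib mult_ac)
        thus ?thesis unfolding Bu2 by (simp add: mult_ac)
      qed
      thus ?thesis unfolding swap4 by simp
    qed
    also have "\<dots> \<le> (\<Sum>y\<in>Pow J. \<Sum>u\<in>UNIV. Tu u * N y / T / 2 / 2 ^ card J)"
    proof (intro sum_mono divide_right_mono)
      fix y u
      show "A u y * Bu u y * q u y \<le> Tu u * N y / T"
        unfolding q_def using Tunn Nnn Tnn by (auto simp: field_simps divide_nonneg_nonneg)
    qed auto
    also have "\<dots> = (\<Sum>u\<in>UNIV. Tu u) / 2 * ((\<Sum>y\<in>Pow J. N y) / 2 ^ card J) / T"
      by (simp add: sum_distrib_left sum_distrib_right sum_divide_distrib mult_ac)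
    also have "\<dots> = T * T / T" unfolding T_Tu[symmetric] T_N[symmetric] ..
    also have "\<dots> \<le> T" using Tnn by simp
    finally show ?thesis using T_m by (simp add: sum_subtractf)
  qed
  have "infl (insert j J) \<alpha> \<beta> = (\<Sum>x\<in>Pow J. \<Sum>u\<in>UNIV. \<Sum>y\<in>Pow J. \<Sum>w\<in>UNIV.
      m x y u w * ln (noise J (Bu u) x * Aw w y / T))"
    unfolding infl_def sum_Pow_ins[OF J]
    by (intro sum.cong refl) (use J in \<open>simp add: nzb nza wt_ins m_def T_def a_def b_def K_def mult_ac\<close>)
  also have "\<dots> \<le> (\<Sum>x\<in>Pow J. \<Sum>u\<in>UNIV. \<Sum>y\<in>Pow J. \<Sum>w\<in>UNIV.
      m x y u w * ln (noise J (Bu u) x * A u y / Tu u) + m x y u w * ln (Bu u y * Aw w y / N y)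
      + (m x y u w * q u y - m x y u w))"
    by (intro sum_mono ln_split) auto
  also have "\<dots> = (\<Sum>x\<in>Pow J. \<Sum>u\<in>UNIV. \<Sum>y\<in>Pow J. \<Sum>w\<in>UNIV. m x y u w * ln (noise J (Bu u) x * A u y / Tu u))
      + (\<Sum>x\<in>Pow J. \<Sum>u\<in>UNIV. \<Sum>y\<in>Pow J. \<Sum>w\<in>UNIV. m x y u w * ln (Bu u y * Aw w y / N y))
      + (\<Sum>x\<in>Pow J. \<Sum>u\<in>UNIV. \<Sum>y\<in>Pow J. \<Sum>w\<in>UNIV. m x y u w * q u y - m x y u w)"
    by (simp only: sum.distrib)
  also have "(\<Sum>x\<in>Pow J. \<Sum>u\<in>UNIV. \<Sum>y\<in>Pow J. \<Sum>w\<in>UNIV. m x y u w * ln (noise J (Bu u) x * A u y / Tu u))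
      = (\<Sum>u\<in>UNIV. infl J (a u) (Bu u)) / 2"
    unfolding sum_distrib_right[symmetric] sumw infl_def A_a Tu_def
    by (simp add: UNIV_bool sum.distrib add_divide_distrib flip: sum_divide_distrib)
  also have "(\<Sum>x\<in>Pow J. \<Sum>u\<in>UNIV. \<Sum>y\<in>Pow J. \<Sum>w\<in>UNIV. m x y u w * ln (Bu u y * Aw w y / N y))
      = (\<Sum>y\<in>Pow J. \<Sum>u\<in>UNIV. \<Sum>w\<in>UNIV. K u w * A u y * b w y * ln (Bu u y * Aw w y / N y)) / 2 ^ card J"
    unfolding swap4 sum_distrib_right[symmetric] sumx by (simp add: sum_divide_distrib)
  finally show ?thesis using gibbs unfolding a_def b_def K_def by simp
qed

text \<open>Needed to feed the induction hypothesis back into the full problem: the chain rule fixes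
  the first bit of block \<open>j\<close> and averages the second under the kernel. Fixing
  \<open>u\<close> and then averaging over it changes nothing, and averaging over \<open>w\<close>
  only decreases the distances by convexity.\<close>

lemma flips_ins_mean_le:
  assumes J: "finite J" "j \<notin> J" "i \<in> J" and \<alpha>: "\<And>x. 0 \<le> \<alpha> x" and \<beta>: "\<And>x. 0 \<le> \<beta> x"
  shows "(\<Sum>u\<in>UNIV. flips J i (\<lambda>x. \<alpha> (ins j u x)) (\<lambda>y. 2 * (\<Sum>w\<in>UNIV. kern (\<rho> j) u w * \<beta> (ins j w y)))) / 2
     \<le> flips (insert j J) i \<alpha> \<beta>"
proof -
  define K where "K u w = kern (\<rho> j) u w" for u w
  define L where "L = J - {i}"
  have L: "finite L" "j \<notin> L" "insert j J - {i} = insert j L" using J by (auto simp: L_def)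
  have comm: "insert i (ins j u x) = ins j u (insert i x)" for u x by (auto simp: ins_def)
  define a where "a u x = \<alpha> (ins j u x)" for u x
  define b where "b w y = \<beta> (ins j w y)" for w y
  define B where "B u y = 2 * (\<Sum>w\<in>UNIV. K u w * b w y)" for u y
  define da where "da u x = (sqrt (a u x) - sqrt (a u (insert i x)))\<^sup>2" for u x
  define ma where "ma u x = (a u x + a u (insert i x)) / 2" for u x
  define db where "db u x = (sqrt (b u x) - sqrt (b u (insert i x)))\<^sup>2" for u x
  define mb where "mb u x = (b u x + b u (insert i x)) / 2" for u x
  have Kpos: "0 < K u w" for u w by (simp add: K_def kern_pos)
  have ab: "0 \<le> a u x" "0 \<le> b u x" for u x by (simp_all add: a_def b_def \<alpha> \<beta>)
  have conv: "(sqrt (B u y) - sqrt (B u (insert i y)))\<^sup>2 \<le> 2 * (\<Sum>w\<in>UNIV. K u w * db w y)" for u y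
  proof -
    have "(sqrt (\<Sum>w\<in>UNIV. (2 * K u w) * b w y) - sqrt (\<Sum>w\<in>UNIV. (2 * K u w) * b w (insert i y)))\<^sup>2
        \<le> (\<Sum>w\<in>UNIV. (2 * K u w) * (sqrt (b w y) - sqrt (b w (insert i y)))\<^sup>2)"
      using ab Kpos by (intro hellinger_convex) (auto simp: less_imp_le)
    thus ?thesis by (simp add: B_def db_def sum_distrib_left mult_ac)
  qed
  have "(\<Sum>u\<in>UNIV. flips J i (a u) (B u)) / 2 = (\<Sum>u\<in>UNIV. \<Sum>x\<in>Pow L. \<Sum>y\<in>Pow L. wt L x y *
     ((da u x * (\<Sum>w\<in>UNIV. K u w * mb w y)) + ma u x * ((sqrt (B u y) - sqrt (B u (insert i y)))\<^sup>2 / 2)))"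
    unfolding flips_def L_def[symmetric] sum_divide_distrib
    by (intro sum.cong refl) (simp add: da_def ma_def mb_def B_def UNIV_bool field_simps)
  also have "\<dots> \<le> (\<Sum>u\<in>UNIV. \<Sum>x\<in>Pow L. \<Sum>y\<in>Pow L. wt L x y *
     ((da u x * (\<Sum>w\<in>UNIV. K u w * mb w y)) + ma u x * (\<Sum>w\<in>UNIV. K u w * db w y)))"
  proof (intro sum_mono mult_left_mono add_left_mono)
    fix u x y
    show "(sqrt (B u y) - sqrt (B u (insert i y)))\<^sup>2 / 2 \<le> (\<Sum>w\<in>UNIV. K u w * db w y)"
      using conv[of u y] by simp
    show "0 \<le> ma u x" using ab by (simp add: ma_def)
    show "0 \<le> wt L x y" using wt_pos by (simp add: less_imp_le)
  qed
  also have "\<dots> = (\<Sum>x\<in>Pow L. \<Sum>u\<in>UNIV. \<Sum>y\<in>Pow L. \<Sum>w\<in>UNIV. K u w * wt L x y * (da u x * mb w y + ma u x * db w y))"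
    by (subst sum.swap) (intro sum.cong refl, simp add: UNIV_bool algebra_simps)
  also have "\<dots> = flips (insert j J) i \<alpha> \<beta>"
    unfolding flips_def L(3) sum_Pow_ins[OF L(1,2)]
    by (intro sum.cong refl)
       (use L in \<open>simp add: wt_ins comm K_def da_def ma_def db_def mb_def a_def b_def\<close>)
  finally show ?thesis by (simp add: a_def[abs_def] B_def[abs_def] b_def K_def)
qed

text \<open>Each split-off block costs what \<open>one_bit_bound\<close> says. The normalisation is
  required for all pairs \<open>x\<close>, \<open>y\<close> rather than on average, because the
  linear term cancels only by combining all four values of the two bits.\<close>

lemma infl_le:
  fixes \<alpha> \<beta> :: "'v \<Rightarrow> 'j set \<Rightarrow> real"
  assumes "finite J" "\<And>v x. v \<in> V \<Longrightarrow> 0 \<le> \<alpha> v x" "\<And>v x. v \<in> V \<Longrightarrow> 0 \<le> \<beta> v x"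
    "\<And>x y. x \<subseteq> J \<Longrightarrow> y \<subseteq> J \<Longrightarrow> (\<Sum>v\<in>V. \<alpha> v x * \<beta> v y) = 1"
  shows "(\<Sum>v\<in>V. infl J (\<alpha> v) (\<beta> v)) \<le> (\<Sum>j\<in>J. 2 * (\<rho> j)\<^sup>2 * (\<Sum>v\<in>V. flips J j (\<alpha> v) (\<beta> v)))"
  using assms
proof (induction J arbitrary: \<alpha> \<beta> rule: finite_induct)
  case empty
  have "infl {} (\<alpha> v) (\<beta> v) \<le> 0" if "v \<in> V" for v
    using empty(1,2)[OF that, of "{}"] by (auto simp: infl_def wt_def noise_def corr_def mult.commute)
  thus ?case by (simp add: sum_nonpos)
next
  case (insert j J)
  note J = insert.hyps and nna = insert.prems(1) and nnb = insert.prems(2) and norm = insert.prems(3)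
  define K where "K u w = kern (\<rho> j) u w" for u w
  define Bu where "Bu v u y = 2 * (\<Sum>w\<in>UNIV. K u w * \<beta> v (ins j w y))" for v u y
  define A where "A v u y = noise J (\<lambda>x. \<alpha> v (ins j u x)) y" for v u y
  define \<Delta> where "\<Delta> v = (\<Sum>y\<in>Pow J. \<Sum>u\<in>UNIV. \<Sum>w\<in>UNIV. K u w * A v u y * \<beta> v (ins j w y) *
      ln (Bu v u y * (2 * (\<Sum>u\<in>UNIV. K u w * A v u y)) / (\<Sum>u\<in>UNIV. \<Sum>w\<in>UNIV. K u w * A v u y * \<beta> v (ins j w y))))" for v
  have Kpos: "0 < K u w" for u w by (simp add: K_def kern_pos)
  have insJ: "ins j u x \<subseteq> insert j J" if "x \<subseteq> J" for u x using that by (auto simp: ins_def)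
  have Ann: "0 \<le> A v u y" if "v \<in> V" for v u y unfolding A_def using nna[OF that] by (intro noise_nonneg)
  have step: "infl (insert j J) (\<alpha> v) (\<beta> v) \<le> (\<Sum>u\<in>UNIV. infl J (\<lambda>x. \<alpha> v (ins j u x)) (Bu v u)) / 2 + \<Delta> v / 2 ^ card J"
    if "v \<in> V" for v
    using infl_insert[OF J nna nnb, OF that that] by (simp add: Bu_def[abs_def] A_def \<Delta>_def K_def)
  have IH: "(\<Sum>v\<in>V. infl J (\<lambda>x. \<alpha> v (ins j u x)) (Bu v u))
      \<le> (\<Sum>i\<in>J. 2 * (\<rho> i)\<^sup>2 * (\<Sum>v\<in>V. flips J i (\<lambda>x. \<alpha> v (ins j u x)) (Bu v u)))" for u
  proof (rule insert.IH)
    show "0 \<le> \<alpha> v (ins j u x)" if "v \<in> V" for v x using nna[OF that] .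
    show "0 \<le> Bu v u x" if "v \<in> V" for v x
      unfolding Bu_def using Kpos nnb[OF that] by (auto intro!: sum_nonneg simp: less_imp_le)
    \<comment> \<open>Normalisation survives the conditioning, since each row of the kernel sums to
      1/2 and \<open>Bu\<close> carries the factor 2.\<close>
    show "(\<Sum>v\<in>V. \<alpha> v (ins j u x) * Bu v u y) = 1" if "x \<subseteq> J" "y \<subseteq> J" for x y
    proof -
      have "(\<Sum>v\<in>V. \<alpha> v (ins j u x) * Bu v u y) =
         (\<Sum>w\<in>UNIV. 2 * K u w * (\<Sum>v\<in>V. \<alpha> v (ins j u x) * \<beta> v (ins j w y)))"
        unfolding Bu_def by (simp add: UNIV_bool sum_distrib_left algebra_simps sum.distrib)
      also have "\<dots> = (\<Sum>w\<in>UNIV. 2 * K u w)" by (simp add: norm insJ that)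
      also have "\<dots> = 1" by (cases u) (simp_all add: UNIV_bool K_def kern_def field_simps)
      finally show ?thesis .
    qed
  qed
  have "(\<Sum>v\<in>V. infl (insert j J) (\<alpha> v) (\<beta> v)) \<le>
      (\<Sum>v\<in>V. (\<Sum>u\<in>UNIV. infl J (\<lambda>x. \<alpha> v (ins j u x)) (Bu v u)) / 2 + \<Delta> v / 2 ^ card J)"
    by (intro sum_mono step)
  also have "\<dots> = (\<Sum>u\<in>UNIV. \<Sum>v\<in>V. infl J (\<lambda>x. \<alpha> v (ins j u x)) (Bu v u)) / 2 + (\<Sum>v\<in>V. \<Delta> v) / 2 ^ card J"
    by (simp add: sum.distrib UNIV_bool add_divide_distrib flip: sum_divide_distrib)
  also have "(\<Sum>u\<in>UNIV. \<Sum>v\<in>V. infl J (\<lambda>x. \<alpha> v (ins j u x)) (Bu v u)) / 2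
      \<le> (\<Sum>u\<in>UNIV. \<Sum>i\<in>J. 2 * (\<rho> i)\<^sup>2 * (\<Sum>v\<in>V. flips J i (\<lambda>x. \<alpha> v (ins j u x)) (Bu v u))) / 2"
    by (intro divide_right_mono sum_mono IH) auto
  also have "\<dots> = (\<Sum>i\<in>J. 2 * (\<rho> i)\<^sup>2 * (\<Sum>v\<in>V. (\<Sum>u\<in>UNIV. flips J i (\<lambda>x. \<alpha> v (ins j u x)) (Bu v u)) / 2))"
    by (simp add: UNIV_bool sum.distrib sum_divide_distrib[symmetric] sum_distrib_left algebra_simps add_divide_distrib)
  also have "\<dots> \<le> (\<Sum>i\<in>J. 2 * (\<rho> i)\<^sup>2 * (\<Sum>v\<in>V. flips (insert j J) i (\<alpha> v) (\<beta> v)))"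
  proof (intro sum_mono mult_left_mono)
    fix i v assume "i \<in> J" "v \<in> V"
    thus "(\<Sum>u\<in>UNIV. flips J i (\<lambda>x. \<alpha> v (ins j u x)) (Bu v u)) / 2 \<le> flips (insert j J) i (\<alpha> v) (\<beta> v)"
      using flips_ins_mean_le[OF J, of i "\<alpha> v" "\<beta> v"] nna nnb by (simp add: Bu_def[abs_def] K_def)
  qed auto
  also have "(\<Sum>v\<in>V. \<Delta> v) / 2 ^ card J \<le> 2 * (\<rho> j)\<^sup>2 * (\<Sum>v\<in>V. flips (insert j J) j (\<alpha> v) (\<beta> v))"
  proof -
    define h where "h v y = (sqrt (A v False y) - sqrt (A v True y))\<^sup>2 * ((\<beta> v y + \<beta> v (insert j y)) / 2)
        + (A v False y + A v True y) / 2 * (sqrt (\<beta> v y) - sqrt (\<beta> v (insert j y)))\<^sup>2" for v y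
    have "(\<Sum>v\<in>V. \<Delta> v) \<le> (\<Sum>v\<in>V. \<Sum>y\<in>Pow J. \<rho> j * (1 + (\<rho> j)\<^sup>2) *
        ((A v True y - A v False y) * (\<beta> v (insert j y) - \<beta> v y) / 4) + 2 * (\<rho> j)\<^sup>2 * h v y)"
    proof (intro sum_mono)
      fix v assume v: "v \<in> V"
      show "\<Delta> v \<le> (\<Sum>y\<in>Pow J. \<rho> j * (1 + (\<rho> j)\<^sup>2) *
        ((A v True y - A v False y) * (\<beta> v (insert j y) - \<beta> v y) / 4) + 2 * (\<rho> j)\<^sup>2 * h v y)"
        unfolding \<Delta>_def
      proof (rule sum_mono)
        fix y
        show "(\<Sum>u\<in>UNIV. \<Sum>w\<in>UNIV. K u w * A v u y * \<beta> v (ins j w y) *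
            ln (Bu v u y * (2 * (\<Sum>u\<in>UNIV. K u w * A v u y)) / (\<Sum>u\<in>UNIV. \<Sum>w\<in>UNIV. K u w * A v u y * \<beta> v (ins j w y))))
          \<le> \<rho> j * (1 + (\<rho> j)\<^sup>2) * ((A v True y - A v False y) * (\<beta> v (insert j y) - \<beta> v y) / 4) + 2 * (\<rho> j)\<^sup>2 * h v y"
          using one_bit_bound[of "\<rho> j" "\<lambda>u. A v u y" "\<lambda>w. \<beta> v (ins j w y)"] \<rho>[of j] Ann[OF v] nnb[OF v]
          by (simp add: h_def K_def Bu_def)
      qed
    qed
    also have "\<dots> = \<rho> j * (1 + (\<rho> j)\<^sup>2) / 4 *
        (\<Sum>y\<in>Pow J. \<Sum>v\<in>V. (A v True y - A v False y) * (\<beta> v (insert j y) - \<beta> v y))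
        + 2 * (\<rho> j)\<^sup>2 * (\<Sum>v\<in>V. \<Sum>y\<in>Pow J. h v y)"
      by (subst (2) sum.swap) (simp add: sum.distrib sum_distrib_left)
    \<comment> \<open>All four products sum to 1 over the transcripts, so they cancel as 1 - 1 - 1 +
      1. From here on the bound is quadratic in \<rho>.\<close>
    also have "(\<Sum>y\<in>Pow J. \<Sum>v\<in>V. (A v True y - A v False y) * (\<beta> v (insert j y) - \<beta> v y)) = 0"
    proof (rule sum.neutral, rule ballI)
      fix y assume y: "y \<in> Pow J"
      have one: "(\<Sum>v\<in>V. A v u y * \<beta> v (ins j w y)) = 1" for u w
      proof -
        have "(\<Sum>v\<in>V. A v u y * \<beta> v (ins j w y)) =
          (\<Sum>x\<in>Pow J. 2 ^ card J * wt J y x * (\<Sum>v\<in>V. \<alpha> v (ins j u x) * \<beta> v (ins j w y)))"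
          unfolding A_def noise_def sum_distrib_right sum_distrib_left
          by (subst sum.swap) (simp add: mult_ac)
        also have "\<dots> = (\<Sum>x\<in>Pow J. 2 ^ card J * wt J y x)" using y by (simp add: norm insJ)
        also have "\<dots> = 1" using y J by (simp add: sum_distrib_left[symmetric] sum_wt)
        finally show ?thesis .
      qed
      show "(\<Sum>v\<in>V. (A v True y - A v False y) * (\<beta> v (insert j y) - \<beta> v y)) = 0"
        using one[of True True] one[of True False] one[of False True] one[of False False]
        by (simp add: left_diff_distrib right_diff_distrib sum_subtractf)
    qed
    finally have "(\<Sum>v\<in>V. \<Delta> v) / 2 ^ card J \<le> 2 * (\<rho> j)\<^sup>2 * (\<Sum>v\<in>V. (\<Sum>y\<in>Pow J. h v y) / 2 ^ card J)"
      by (simp add: divide_right_mono flip: sum_divide_distrib)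
    also have "\<dots> \<le> 2 * (\<rho> j)\<^sup>2 * (\<Sum>v\<in>V. flips (insert j J) j (\<alpha> v) (\<beta> v))"
    proof (intro mult_left_mono sum_mono)
      fix v assume v: "v \<in> V"
      define d where "d x = (sqrt (\<alpha> v x) - sqrt (\<alpha> v (insert j x)))\<^sup>2" for x
      have conv: "(sqrt (A v False y) - sqrt (A v True y))\<^sup>2 \<le> noise J d y" for y
        using hellinger_convex[of "Pow J" "\<lambda>x. 2 ^ card J * wt J y x" "\<alpha> v" "\<lambda>x. \<alpha> v (insert j x)"]
          nna[OF v] wt_pos[of J y] by (simp add: A_def noise_def d_def less_imp_le)
      have "(\<Sum>y\<in>Pow J. h v y) / 2 ^ card J \<le> (\<Sum>y\<in>Pow J. noise J d y * ((\<beta> v y + \<beta> v (insert j y)) / 2)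
         + (A v False y + A v True y) / 2 * (sqrt (\<beta> v y) - sqrt (\<beta> v (insert j y)))\<^sup>2) / 2 ^ card J"
        unfolding h_def using conv nnb[OF v]
        by (intro divide_right_mono sum_mono add_mono mult_right_mono) auto
      also have "\<dots> = (\<Sum>y\<in>Pow J. \<Sum>x\<in>Pow J. wt J y x * (d x * ((\<beta> v y + \<beta> v (insert j y)) / 2)
         + (\<alpha> v x + \<alpha> v (insert j x)) / 2 * (sqrt (\<beta> v y) - sqrt (\<beta> v (insert j y)))\<^sup>2))"
      proof (subst sum_divide_distrib, intro sum.cong refl)
        fix y
        define p1 where "p1 = (\<beta> v y + \<beta> v (insert j y)) / 2"
        define p2 where "p2 = (sqrt (\<beta> v y) - sqrt (\<beta> v (insert j y)))\<^sup>2"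
        have "(\<Sum>x\<in>Pow J. wt J y x * (d x * p1 + (\<alpha> v x + \<alpha> v (insert j x)) / 2 * p2)) =
           (\<Sum>x\<in>Pow J. wt J y x * d x) * p1 +
           ((\<Sum>x\<in>Pow J. wt J y x * \<alpha> v x) + (\<Sum>x\<in>Pow J. wt J y x * \<alpha> v (insert j x))) / 2 * p2"
          by (simp add: sum_distrib_left sum_divide_distrib algebra_simps sum.distrib add_divide_distrib)
        also have "\<dots> = (noise J d y * p1 + (A v False y + A v True y) / 2 * p2) / 2 ^ card J"
          unfolding sum_wt_right A_def by (simp add: field_simps)
        finally show "(noise J d y * p1 + (A v False y + A v True y) / 2 * p2) / 2 ^ card J
          = (\<Sum>x\<in>Pow J. wt J y x * (d x * p1 + (\<alpha> v x + \<alpha> v (insert j x)) / 2 * p2))" ..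
      qed
      also have "\<dots> = flips (insert j J) j (\<alpha> v) (\<beta> v)"
        unfolding flips_def d_def using J by (subst sum.swap) (simp add: wt_commute[of J])
      finally show "(\<Sum>y\<in>Pow J. h v y) / 2 ^ card J \<le> flips (insert j J) j (\<alpha> v) (\<beta> v)" .
    qed auto
    finally show ?thesis .
  qed
  finally show ?case using J by (simp add: add.commute)
qed

text \<open>Given the transcript, independent pairs stay independent, so \<open>I(x; y | \<Pi>)\<close> is at most the
  conditional divergence from the independent case.\<close>

lemma divergence_le_infl:
  assumes J: "finite J" and \<alpha>: "\<And>x. 0 \<le> \<alpha> x" and \<beta>: "\<And>x. 0 \<le> \<beta> x"
  shows "corr J \<alpha> \<beta> * ln (corr J \<alpha> \<beta> / (mean (Pow J) \<alpha> * mean (Pow J) \<beta>)) \<le> infl J \<alpha> \<beta>"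
proof -
  define T where "T = corr J \<alpha> \<beta>"
  define Ea where "Ea = mean (Pow J) \<alpha>"
  define Eb where "Eb = mean (Pow J) \<beta>"
  have T: "T = (\<Sum>x\<in>Pow J. \<Sum>y\<in>Pow J. wt J x y * \<alpha> x * \<beta> y)" by (simp add: T_def corr_def)
  have Ea: "Ea = (\<Sum>x\<in>Pow J. \<alpha> x) / 2 ^ card J" and Eb: "Eb = (\<Sum>x\<in>Pow J. \<beta> x) / 2 ^ card J"
    using J by (simp_all add: Ea_def Eb_def mean_def card_Pow)
  have Tnn: "0 \<le> T" "0 \<le> Ea" "0 \<le> Eb"
    using corr_nonneg \<alpha> \<beta> by (auto simp: T_def Ea_def Eb_def intro!: mean_nonneg)
  define m where "m x y = wt J x y * \<alpha> x * \<beta> y" for x y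
  have mnn: "0 \<le> m x y" for x y unfolding m_def using wt_pos[of J x y] \<alpha> \<beta> by (simp add: less_imp_le)
  have Tm: "T = (\<Sum>x\<in>Pow J. \<Sum>y\<in>Pow J. m x y)" by (simp add: T m_def)
  have infl_m: "infl J \<alpha> \<beta> = (\<Sum>x\<in>Pow J. \<Sum>y\<in>Pow J. m x y * ln (noise J \<beta> x * noise J \<alpha> y / T))"
    by (simp add: infl_def m_def T_def)
  \<comment> \<open>Given the transcript, the density of \<open>x\<close> for independent pairs
    relative to that for correlated pairs; \<open>q2\<close> is the same for \<open>y\<close>.
    Against \<open>m\<close> both integrate to at most the total mass \<open>T\<close>.\<close>
  define q1 where "q1 x = T / (noise J \<beta> x * Ea)" for x
  define q2 where "q2 y = T / (noise J \<alpha> y * Eb)" for y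
  have pt: "m x y * ln (T / (Ea * Eb)) \<le> m x y * ln (noise J \<beta> x * noise J \<alpha> y / T)
      + (m x y * q1 x - m x y) + (m x y * q2 y - m x y)" if xy: "x \<in> Pow J" "y \<in> Pow J" for x y
  proof (cases "m x y = 0")
    case False
    hence pos: "\<alpha> x > 0" "\<beta> y > 0" using \<alpha>[of x] \<beta>[of y] by (auto simp: m_def less_le)
    have p: "noise J \<beta> x > 0" "noise J \<alpha> y > 0"
      using noise_pos[of J \<beta> y x] noise_pos[of J \<alpha> x y] J \<alpha> \<beta> pos xy by auto
    have Tp: "T > 0" unfolding T_def using corr_pos[of J \<alpha> \<beta> x y] J \<alpha> \<beta> pos xy by auto
    have "(\<Sum>x\<in>Pow J. \<alpha> x) > 0" "(\<Sum>x\<in>Pow J. \<beta> x) > 0"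
      using J \<alpha> \<beta> pos xy by (auto intro: sum_pos2[of "Pow J" x] sum_pos2[of "Pow J" y])
    hence Ep: "Ea > 0" "Eb > 0" by (simp_all add: Ea Eb)
    have "ln (T / (Ea * Eb)) = ln (noise J \<beta> x * noise J \<alpha> y / T) + ln (q1 x) + ln (q2 y)"
      unfolding q1_def q2_def using p Tp Ep by (simp add: ln_mult ln_div)
    moreover have "ln (q1 x) \<le> q1 x - 1" "ln (q2 y) \<le> q2 y - 1"
      unfolding q1_def q2_def using p Tp Ep by (auto intro!: ln_le_minus_one)
    ultimately have "ln (T / (Ea * Eb)) \<le> ln (noise J \<beta> x * noise J \<alpha> y / T) + (q1 x - 1) + (q2 y - 1)"
      by linarith
    from mult_left_mono[OF this mnn[of x y]] show ?thesis by (simp add: algebra_simps)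
  qed simp
  have g1: "(\<Sum>x\<in>Pow J. \<Sum>y\<in>Pow J. m x y * q1 x) \<le> T"
  proof -
    have "(\<Sum>y\<in>Pow J. m x y * q1 x) \<le> \<alpha> x / 2 ^ card J * (T / Ea)" if "x \<in> Pow J" for x
    proof -
      have "(\<Sum>y\<in>Pow J. m x y * q1 x) = \<alpha> x * q1 x * (\<Sum>y\<in>Pow J. wt J x y * \<beta> y)"
        by (simp add: m_def sum_distrib_left mult_ac)
      also have "\<dots> = \<alpha> x / 2 ^ card J * (noise J \<beta> x * q1 x)" by (simp add: sum_wt_right)
      also have "\<dots> \<le> \<alpha> x / 2 ^ card J * (T / Ea)"
        using \<alpha> Tnn by (intro mult_left_mono) (auto simp: q1_def)
      finally show ?thesis .
    qed
    hence "(\<Sum>x\<in>Pow J. \<Sum>y\<in>Pow J. m x y * q1 x) \<le> (\<Sum>x\<in>Pow J. \<alpha> x / 2 ^ card J * (T / Ea))"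
      by (rule sum_mono)
    also have "\<dots> = Ea * (T / Ea)" unfolding Ea sum_distrib_right[symmetric] sum_divide_distrib[symmetric] ..
    also have "\<dots> \<le> T" using Tnn by simp
    finally show ?thesis .
  qed
  have g2: "(\<Sum>x\<in>Pow J. \<Sum>y\<in>Pow J. m x y * q2 y) \<le> T"
  proof -
    have "(\<Sum>x\<in>Pow J. m x y * q2 y) \<le> \<beta> y / 2 ^ card J * (T / Eb)" if "y \<in> Pow J" for y
    proof -
      have "(\<Sum>x\<in>Pow J. m x y * q2 y) = \<beta> y * q2 y * (\<Sum>x\<in>Pow J. wt J x y * \<alpha> x)"
        by (simp add: m_def sum_distrib_left mult_ac)
      also have "\<dots> = \<beta> y / 2 ^ card J * (noise J \<alpha> y * q2 y)" by (simp add: sum_wt_left)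
      also have "\<dots> \<le> \<beta> y / 2 ^ card J * (T / Eb)"
        using \<beta> Tnn by (intro mult_left_mono) (auto simp: q2_def)
      finally show ?thesis .
    qed
    hence "(\<Sum>y\<in>Pow J. \<Sum>x\<in>Pow J. m x y * q2 y) \<le> (\<Sum>x\<in>Pow J. \<beta> x / 2 ^ card J * (T / Eb))"
      by (rule sum_mono)
    also have "\<dots> = Eb * (T / Eb)" unfolding Eb sum_distrib_right[symmetric] sum_divide_distrib[symmetric] ..
    also have "\<dots> \<le> T" using Tnn by simp
    finally show ?thesis by (subst sum.swap)
  qed
  have "T * ln (T / (Ea * Eb)) = (\<Sum>x\<in>Pow J. \<Sum>y\<in>Pow J. m x y * ln (T / (Ea * Eb)))"
    by (simp add: T m_def sum_distrib_right)
  also have "\<dots> \<le> (\<Sum>x\<in>Pow J. \<Sum>y\<in>Pow J. m x y * ln (noise J \<beta> x * noise J \<alpha> y / T)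
      + (m x y * q1 x - m x y) + (m x y * q2 y - m x y))"
    by (intro sum_mono pt)
  also have "\<dots> = infl J \<alpha> \<beta> + ((\<Sum>x\<in>Pow J. \<Sum>y\<in>Pow J. m x y * q1 x) - T)
      + ((\<Sum>x\<in>Pow J. \<Sum>y\<in>Pow J. m x y * q2 y) - T)"
    unfolding infl_m by (simp only: sum.distrib sum_subtractf flip: Tm)
  also have "\<dots> \<le> infl J \<alpha> \<beta>" using g1 g2 by linarith
  finally show ?thesis by (simp add: T_def Ea_def Eb_def)
qed

text \<open>The affinity is at least 1 minus half the divergence, by \<open>ln x \<le> x - 1\<close>
  at the square root of the density ratio; this halves the factor 2 of
  \<open>infl_le\<close>.\<close>

lemma affinity_ge:
  fixes \<alpha> \<beta> :: "'v \<Rightarrow> 'j set \<Rightarrow> real"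
  assumes J: "finite J" and nn: "\<And>v x. v \<in> V \<Longrightarrow> 0 \<le> \<alpha> v x" "\<And>v x. v \<in> V \<Longrightarrow> 0 \<le> \<beta> v x"
    and norm: "\<And>x y. x \<subseteq> J \<Longrightarrow> y \<subseteq> J \<Longrightarrow> (\<Sum>v\<in>V. \<alpha> v x * \<beta> v y) = 1"
  shows "1 - (\<Sum>j\<in>J. (\<rho> j)\<^sup>2 * (\<Sum>v\<in>V. flips J j (\<alpha> v) (\<beta> v)))
     \<le> (\<Sum>v\<in>V. sqrt (corr J (\<alpha> v) (\<beta> v) * (mean (Pow J) (\<alpha> v) * mean (Pow J) (\<beta> v))))"
proof -
  define P where "P v = corr J (\<alpha> v) (\<beta> v)" for v
  define Q where "Q v = mean (Pow J) (\<alpha> v) * mean (Pow J) (\<beta> v)" for v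
  have mass: "(\<Sum>v\<in>V. P v) = 1"
  proof -
    have "(\<Sum>v\<in>V. P v) = (\<Sum>x\<in>Pow J. \<Sum>v\<in>V. \<Sum>y\<in>Pow J. wt J x y * (\<alpha> v x * \<beta> v y))"
      unfolding P_def corr_def by (subst sum.swap) (simp add: mult_ac)
    also have "\<dots> = (\<Sum>x\<in>Pow J. \<Sum>y\<in>Pow J. wt J x y * (\<Sum>v\<in>V. \<alpha> v x * \<beta> v y))"
      by (intro sum.cong refl, subst sum.swap) (simp add: sum_distrib_left)
    also have "\<dots> = (\<Sum>x\<in>Pow J. \<Sum>y\<in>Pow J. wt J x y)" by (simp add: norm)
    also have "\<dots> = 1" using J by (simp add: sum_wt card_Pow)
    finally show ?thesis .
  qed
  have Q: "0 < Q v" if "v \<in> V" "P v > 0" for v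
  proof (rule ccontr)
    assume "\<not> 0 < Q v"
    moreover have m: "0 \<le> mean (Pow J) (\<alpha> v)" "0 \<le> mean (Pow J) (\<beta> v)" using nn that by (auto intro!: mean_nonneg)
    ultimately have "mean (Pow J) (\<alpha> v) = 0 \<or> mean (Pow J) (\<beta> v) = 0"
      by (auto simp: Q_def not_less mult_le_0_iff)
    hence "(\<forall>x\<in>Pow J. \<alpha> v x = 0) \<or> (\<forall>x\<in>Pow J. \<beta> v x = 0)"
      using J nn that by (auto simp: mean_def sum_nonneg_eq_0_iff)
    hence "P v = 0" by (auto simp: P_def corr_def)
    thus False using that by simp
  qed
  have pt: "P v - P v * ln (P v / Q v) / 2 \<le> sqrt (P v * Q v)" if "v \<in> V" for v
  proof (cases "P v = 0")
    case False
    hence p: "P v > 0" using corr_nonneg[of "\<alpha> v" "\<beta> v" J] nn that by (auto simp: P_def less_le)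
    note q = Q[OF that p]
    have "- ln (P v / Q v) / 2 = ln (sqrt (Q v / P v))"
      using p q by (simp add: ln_sqrt ln_div)
    also have "\<dots> \<le> sqrt (Q v / P v) - 1" using p q by (intro ln_le_minus_one) auto
    finally have "P v * (1 - ln (P v / Q v) / 2) \<le> P v * sqrt (Q v / P v)"
      using p by (intro mult_left_mono) auto
    also have "P v * sqrt (Q v / P v) = sqrt (P v * Q v)"
      using p by (simp add: real_sqrt_divide real_sqrt_mult field_simps)
    finally show ?thesis by (simp add: algebra_simps)
  qed simp
  have "(\<Sum>v\<in>V. P v * ln (P v / Q v)) \<le> (\<Sum>v\<in>V. infl J (\<alpha> v) (\<beta> v))"
    unfolding P_def Q_def by (intro sum_mono divergence_le_infl J nn)
  also have "\<dots> \<le> (\<Sum>j\<in>J. 2 * (\<rho> j)\<^sup>2 * (\<Sum>v\<in>V. flips J j (\<alpha> v) (\<beta> v)))"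
    by (rule infl_le) (use J nn norm in auto)
  finally have D: "(\<Sum>v\<in>V. P v * ln (P v / Q v)) / 2 \<le> (\<Sum>j\<in>J. (\<rho> j)\<^sup>2 * (\<Sum>v\<in>V. flips J j (\<alpha> v) (\<beta> v)))"
    by (simp add: mult.assoc flip: sum_distrib_left)
  have "1 - (\<Sum>v\<in>V. P v * ln (P v / Q v)) / 2 = (\<Sum>v\<in>V. P v - P v * ln (P v / Q v) / 2)"
    by (simp add: sum_subtractf mass sum_divide_distrib)
  also have "\<dots> \<le> (\<Sum>v\<in>V. sqrt (P v * Q v))" by (intro sum_mono pt)
  finally show ?thesis using D by (simp add: P_def Q_def)
qed

end

section \<open>Transcripts and configurations\<close>

lemma mean_Pow_insert:
  assumes "finite S" "e \<notin> S"
  shows "mean (Pow (insert e S)) f = (mean (Pow S) f + mean (Pow S) (\<lambda>U. f (insert e U))) / 2"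
  using assms by (simp add: mean_def sum_Pow_insert sum.distrib card_Pow add_divide_distrib)

lemma mean_Pow_indep:
  assumes "finite S" "\<And>U. g U = g (U \<inter> A)" "\<And>U. h U = h (U - A)"
  shows "mean (Pow S) (\<lambda>U. g U * h U) = mean (Pow S) g * mean (Pow S) h"
  using assms
proof (induction S arbitrary: g h rule: finite_induct)
  case empty
  show ?case by (simp add: mean_def)
next
  case (insert e S)
  note IH = insert.IH and gA = insert.prems(1) and hA = insert.prems(2)
  show ?case
  proof (cases "e \<in> A")
    case True
    have h: "h (insert e U) = h U" for U
      using hA[of "insert e U"] hA[of U] True by simp
    have g': "g (insert e U) = g (insert e (U \<inter> A))" for U
      by (subst gA) (use True in \<open>simp add: Int_insert_left\<close>)
    have "mean (Pow S) (\<lambda>U. g (insert e U) * h U) = mean (Pow S) (\<lambda>U. g (insert e U)) * mean (Pow S) h"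
    proof (rule IH)
      show "g (insert e U) = g (insert e (U \<inter> A))" for U by (rule g')
      show "h U = h (U - A)" for U by (rule hA)
    qed
    thus ?thesis using IH[where g = g and h = h, OF gA hA] insert.hyps by (simp add: mean_Pow_insert h algebra_simps)
  next
    case False
    have g: "g (insert e U) = g U" for U
      using gA[of "insert e U"] gA[of U] False by simp
    have h': "h (insert e U) = h (insert e (U - A))" for U
      by (subst hA) (use False in \<open>simp add: insert_Diff_if\<close>)
    have "mean (Pow S) (\<lambda>U. g U * h (insert e U)) = mean (Pow S) g * mean (Pow S) (\<lambda>U. h (insert e U))"
    proof (rule IH)
      show "g U = g (U \<inter> A)" for U by (rule gA)
      show "h (insert e U) = h (insert e (U - A))" for U by (rule h')
    qed
    thus ?thesis using IH[where g = g and h = h, OF gA hA] insert.hyps by (simp add: mean_Pow_insert g algebra_simps)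
  qed
qed

lemma mean_Pow_prod:
  assumes "finite S" "finite I" "\<And>i U. i \<in> I \<Longrightarrow> g i U = g i (U \<inter> A i)" "disjoint_family_on A I"
  shows "mean (Pow S) (\<lambda>U. \<Prod>i\<in>I. g i U) = (\<Prod>i\<in>I. mean (Pow S) (g i))"
  using assms(2-)
proof (induction I rule: finite_induct)
  case empty
  show ?case using assms(1) mean_const[of "Pow S" 1] by auto
next
  case (insert j I)
  have "mean (Pow S) (\<lambda>U. g j U * (\<Prod>i\<in>I. g i U)) = mean (Pow S) (g j) * mean (Pow S) (\<lambda>U. \<Prod>i\<in>I. g i U)"
  proof (rule mean_Pow_indep[OF assms(1)])
    show "g j U = g j (U \<inter> A j)" for U by (rule insert.prems(1)) simp
    show "(\<Prod>i\<in>I. g i U) = (\<Prod>i\<in>I. g i (U - A j))" for U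
    proof (rule prod.cong[OF refl])
      fix i assume i: "i \<in> I"
      have "A i \<inter> A j = {}"
        using insert.prems(2) i insert.hyps unfolding disjoint_family_on_def by auto
      hence "U \<inter> A i = (U - A j) \<inter> A i" by auto
      thus "g i U = g i (U - A j)" using insert.prems(1)[of i U] insert.prems(1)[of i "U - A j"] i by simp
    qed
  qed
  moreover have "mean (Pow S) (\<lambda>U. \<Prod>i\<in>I. g i U) = (\<Prod>i\<in>I. mean (Pow S) (g i))"
  proof (rule insert.IH)
    show "g i U = g i (U \<inter> A i)" if "i \<in> I" for i U by (rule insert.prems(1)) (use that in simp)
    show "disjoint_family_on A I" using insert.prems(2) by (auto simp: disjoint_family_on_def)
  qed
  ultimately show ?case using insert.hyps by simp
qed

text \<open>Exchanging the old and the new entry at \<open>j\<close> is an involution. Bounds that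
  average over a single entry with the others fixed are turned into global averages this
  way.\<close>

lemma sum_PiE_dflt_resample:
  fixes f :: "('a \<Rightarrow> 'b) \<Rightarrow> real"
  assumes "finite A" "finite S" "j \<in> A"
  shows "(\<Sum>r\<in>PiE_dflt A d (\<lambda>_. S). \<Sum>q\<in>S. f (r(j := q))) = real (card S) * (\<Sum>r\<in>PiE_dflt A d (\<lambda>_. S). f r)"
proof -
  let ?R = "PiE_dflt A d (\<lambda>_. S)"
  have "(\<Sum>r\<in>?R. \<Sum>q\<in>S. f (r(j := q))) = (\<Sum>(r, q)\<in>?R \<times> S. f (r(j := q)))"
    by (rule sum.cartesian_product)
  also have "\<dots> = (\<Sum>(r, q)\<in>?R \<times> S. f r)"
    using assms
    by (intro sum.reindex_bij_witness[of _ "\<lambda>(r, q). (r(j := q), r j)" "\<lambda>(r, q). (r(j := q), r j)"])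
       (auto simp: PiE_dflt_def)
  also have "\<dots> = (\<Sum>r\<in>?R. \<Sum>q\<in>S. f r)"
    by (rule sum.cartesian_product[symmetric])
  finally show ?thesis by (simp add: sum_distrib_left)
qed

section \<open>Transcripts and combinatorial rectangles\<close>

primrec trace :: "protocol \<Rightarrow> input \<Rightarrow> bool list" where
  "trace (Output w) x = []"
| "trace (Write i f t0 t1) x = f (x i) # (if f (x i) then trace t1 x else trace t0 x)"

primrec out_of :: "protocol \<Rightarrow> bool list \<Rightarrow> real" where
  "out_of (Output w) v = w"
| "out_of (Write i f t0 t1) v = (if hd v then out_of t1 (tl v) else out_of t0 (tl v))"

text \<open>Side \<open>i\<close> of the rectangle of inputs with transcript \<open>v\<close>:
  \<open>v\<close> is a complete path, and the bits that site \<open>i\<close> writes along it are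
  the ones its own input dictates. The other inputs do not occur, because the path is read off
  \<open>v\<close>.\<close>

primrec agrees :: "protocol \<Rightarrow> bool list \<Rightarrow> nat \<Rightarrow> local_input \<Rightarrow> bool" where
  "agrees (Output w) v i y = (v = [])"
| "agrees (Write s f t0 t1) v i y =
     (v \<noteq> [] \<and> (i = s \<longrightarrow> f y = hd v) \<and> (if hd v then agrees t1 (tl v) i y else agrees t0 (tl v) i y))"

lemma result_eq_out_of: "result t x = out_of t (trace t x)"
  by (induction t) auto

text \<open>That \<open>v\<close> is a complete path is checked by every site, so at least one site
  is needed to express it.\<close>

lemma trace_eq_iff:
  assumes "writers t \<subseteq> I" "I \<noteq> {}"
  shows "trace t x = v \<longleftrightarrow> (\<forall>i\<in>I. agrees t v i (x i))"
  using assms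
proof (induction t arbitrary: v)
  case (Output w)
  thus ?case by auto
next
  case (Write s f t0 t1)
  show ?case
  proof (cases v)
    case (Cons b v')
    show ?thesis using Write.IH(1)[of v'] Write.IH(2)[of v'] Write.prems
      by (cases b) (auto simp: Cons)
  qed (use Write.prems in auto)
qed

text \<open>Branches that no input in \<open>X\<close> reaches may be deeper than \<open>C\<close>,
  so the depth of the tree gives no bound. The induction splits \<open>X\<close> by the bit written
  at the root.\<close>

lemma card_traces:
  assumes "\<forall>x\<in>X. bits_written t x \<le> C"
  shows "finite (trace t ` X) \<and> card (trace t ` X) \<le> 2 ^ C"
  using assms
proof (induction t arbitrary: X C)
  case (Output w)
  have "trace (Output w) ` X \<subseteq> {[]}" by auto
  hence "finite (trace (Output w) ` X)" "card (trace (Output w) ` X) \<le> card {[] :: bool list}"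
    using finite_subset by (blast, intro card_mono) auto
  moreover have "(1 :: nat) \<le> 2 ^ C" by simp
  ultimately show ?case using order_trans[of _ "1 :: nat" "2 ^ C"] by simp
next
  case (Write i f t0 t1)
  show ?case
  proof (cases "X = {}")
    case False
    then obtain C' where C: "C = Suc C'" using Write.prems by (cases C) auto
    define X0 X1 where "X0 = {x\<in>X. \<not> f (x i)}" and "X1 = {x\<in>X. f (x i)}"
    have im: "trace (Write i f t0 t1) ` X = Cons False ` trace t0 ` X0 \<union> Cons True ` trace t1 ` X1"
      unfolding X0_def X1_def image_image by (auto simp: image_iff split: if_splits)
    have 0: "finite (trace t0 ` X0) \<and> card (trace t0 ` X0) \<le> 2 ^ C'"
      using Write.prems by (intro Write.IH) (auto simp: X0_def C)
    have 1: "finite (trace t1 ` X1) \<and> card (trace t1 ` X1) \<le> 2 ^ C'"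
      using Write.prems by (intro Write.IH) (auto simp: X1_def C)
    have "card (trace (Write i f t0 t1) ` X) \<le> card (Cons False ` trace t0 ` X0) + card (Cons True ` trace t1 ` X1)"
      unfolding im by (rule card_Un_le)
    also have "\<dots> \<le> card (trace t0 ` X0) + card (trace t1 ` X1)"
      using 0 1 by (intro add_mono card_image_le) auto
    also have "\<dots> \<le> 2 ^ C" using 0 1 by (simp add: C)
    finally show ?thesis using 0 1 unfolding im by simp
  qed simp
qed

text \<open>In a cell \<open>Det S\<close> exactly the sites in \<open>S\<close> hold a 1; in a cell \<open>Rnd i\<close> site \<open>i\<close> holds a fair bit
  and all other sites hold 0.\<close>

datatype cell = Det "nat set" | Rnd nat

type_synonym config = "nat \<Rightarrow> nat \<Rightarrow> cell"

definition upd :: "config \<Rightarrow> nat \<Rightarrow> nat \<Rightarrow> cell \<Rightarrow> config" where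
  "upd \<kappa> b l c = \<kappa>(b := (\<kappa> b)(l := c))"

lemma upd_apply: "upd \<kappa> b l c b' l' = (if b' = b \<and> l' = l then c else \<kappa> b' l')"
  by (simp add: upd_def)

text \<open>The part \<open>(M, m, D, \<tau>, z)\<close> of the randomness of a block that is given away in the analysis: the
  special coordinate, a further coordinate, the owners of the coordinates, and whether the bit at \<open>m\<close>
  is pinned (\<open>\<tau>\<close>), in which case it is pinned to \<open>z\<close>. In an active block it is pinned to 0.\<close>

type_synonym pub = "nat \<times> nat \<times> (nat \<Rightarrow> nat) \<times> bool \<times> bool"

definition active :: "pub \<Rightarrow> bool" where
  "active q = (case q of (M, m, D, \<tau>, z) \<Rightarrow> \<tau> \<and> \<not> z \<and> M \<noteq> m)"

section \<open>Transcript distributions of configurations\<close>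

locale board =
  fixes k B n C :: nat and t :: protocol
  assumes writers: "writers t \<subseteq> {..<k}" and k_pow: "\<exists>m. k = 2 ^ Suc m"
    and bits: "\<And>x. x \<in> inputs k B n \<Longrightarrow> bits_written t x \<le> C"
begin

text \<open>\<open>U\<close> supplies a bit for every cell, including the deterministic ones, which
  ignore it. All configurations thereby share one sample space.\<close>

definition inp :: "config \<Rightarrow> (nat \<times> nat) set \<Rightarrow> input" where
  "inp \<kappa> U i b l \<longleftrightarrow> i < k \<and> b < B \<and> l < n \<and>
     (case \<kappa> b l of Det S \<Rightarrow> i \<in> S | Rnd j \<Rightarrow> i = j \<and> (b, l) \<in> U)"

abbreviation "cells \<equiv> {..<B} \<times> {..<n}"

definition "TR = trace t ` inputs k B n"

definition Pr :: "config \<Rightarrow> bool list \<Rightarrow> real" where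
  "Pr \<kappa> v = prob_eq (Pow cells) (\<lambda>U. trace t (inp \<kappa> U)) v"

definition site :: "config \<Rightarrow> bool list \<Rightarrow> nat \<Rightarrow> real" where
  "site \<kappa> v i = mean (Pow cells) (\<lambda>U. of_bool (agrees t v i (inp \<kappa> U i)))"

lemma k_pos: "0 < k" using k_pow by auto

lemma inp_in: "inp \<kappa> U \<in> inputs k B n"
  by (auto simp: inp_def inputs_def)

lemma finite_TR: "finite TR" and card_TR: "card TR \<le> 2 ^ C"
  using card_traces[of "inputs k B n" t C] bits by (auto simp: TR_def)

lemma trace_in_TR: "trace t (inp \<kappa> U) \<in> TR"
  unfolding TR_def using inp_in by auto

lemma Pr_nonneg: "0 \<le> Pr \<kappa> v"
  unfolding Pr_def by (rule prob_eq_nonneg)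

lemma site_nonneg: "0 \<le> site \<kappa> v i"
  unfolding site_def by (rule mean_nonneg) auto

lemma Pr_mass: "(\<Sum>v\<in>TR. Pr \<kappa> v) = 1"
  unfolding Pr_def using finite_TR trace_in_TR by (intro sum_prob_eq) auto

text \<open>A random cell has a single owner, so the inputs of different sites depend on disjoint
  sets of coin flips, and the expectation of the product of rectangle indicators factors.\<close>

lemma Pr_eq_prod: "Pr \<kappa> v = (\<Prod>i<k. site \<kappa> v i)"
proof -
  have "Pr \<kappa> v = mean (Pow cells) (\<lambda>U. \<Prod>i<k. of_bool (agrees t v i (inp \<kappa> U i)))"
    unfolding Pr_def prob_eq_def
  proof (rule mean_cong)
    fix U
    have "trace t (inp \<kappa> U) = v \<longleftrightarrow> (\<forall>i<k. agrees t v i (inp \<kappa> U i))"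
      using trace_eq_iff[OF writers, of "inp \<kappa> U" v] k_pos by auto
    thus "of_bool (trace t (inp \<kappa> U) = v) = (\<Prod>i<k. of_bool (agrees t v i (inp \<kappa> U i)) :: real)"
      by (auto simp: prod_zero_iff)
  qed
  also have "\<dots> = (\<Prod>i<k. site \<kappa> v i)"
    unfolding site_def
  proof (rule mean_Pow_prod[where A = "\<lambda>i. {(b, l). \<kappa> b l = Rnd i}"])
    fix i U
    have "inp \<kappa> U i = inp \<kappa> (U \<inter> {(b, l). \<kappa> b l = Rnd i}) i"
      by (intro ext) (auto simp: inp_def split: cell.splits)
    thus "of_bool (agrees t v i (inp \<kappa> U i)) =
       (of_bool (agrees t v i (inp \<kappa> (U \<inter> {(b, l). \<kappa> b l = Rnd i}) i)) :: real)" by simp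
  qed (auto simp: disjoint_family_on_def)
  finally show ?thesis .
qed

lemma site_cong: "(\<And>U. inp \<kappa> U i = inp \<kappa>' U i) \<Longrightarrow> site \<kappa> v i = site \<kappa>' v i"
  by (simp add: site_def)

lemma site_product_cell:
  "site_product TR {..<k} (\<lambda>_. 1) (\<lambda>v i u. site (upd \<kappa> b l (Det (if u then {i} else {}))) v i)
     (\<lambda>S. Pr (upd \<kappa> b l (Det S)))"
proof
  fix S v
  have "site (upd \<kappa> b l (Det S)) v i = site (upd \<kappa> b l (Det (if i \<in> S then {i} else {}))) v i" for i
    by (rule site_cong) (auto simp: inp_def upd_apply fun_eq_iff)
  thus "Pr (upd \<kappa> b l (Det S)) v = 1 * (\<Prod>i<k. site (upd \<kappa> b l (Det (if i \<in> S then {i} else {}))) v i)"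
    by (simp add: Pr_eq_prod)
qed (auto simp: finite_TR site_nonneg Pr_mass)

definition tog :: "config \<Rightarrow> nat \<Rightarrow> nat \<Rightarrow> nat \<Rightarrow> real" where
  "tog \<kappa> b l i = hell TR (Pr (upd \<kappa> b l (Det {}))) (Pr (upd \<kappa> b l (Det {i})))"

definition block_info :: "nat \<Rightarrow> config \<Rightarrow> real" where
  "block_info b \<kappa> = (\<Sum>l<n. case \<kappa> b l of Det S \<Rightarrow> 0 | Rnd i \<Rightarrow> tog \<kappa> b l i)"

lemma tog_nonneg: "0 \<le> tog \<kappa> b l i"
  unfolding tog_def by (rule hell_nonneg)

lemma block_info_nonneg: "0 \<le> block_info b \<kappa>"
  unfolding block_info_def by (intro sum_nonneg) (auto simp: tog_nonneg split: cell.splits)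

text \<open>Forcing the bit of a random cell with owner \<open>i\<close> gives the configurations
  with \<open>Det {}\<close> and \<open>Det {i}\<close> in that cell. The sum is therefore one over
  flips of independent fair bits, at one fixed configuration, and at most \<open>2 ^ C\<close>
  transcripts occur.\<close>

lemma sum_block_info_le: "(\<Sum>b<B. block_info b \<kappa>) \<le> 4 * real C * ln 2"
proof -
  have "(\<Sum>b<B. block_info b \<kappa>) = (\<Sum>(b, l)\<in>cells. case \<kappa> b l of Det S \<Rightarrow> 0 | Rnd i \<Rightarrow> tog \<kappa> b l i)"
    unfolding block_info_def by (rule sum.cartesian_product)
  also have "\<dots> \<le> (\<Sum>e\<in>cells. \<Sum>v\<in>TR. (sqrt (prob_eq (Pow cells) (\<lambda>U. trace t (inp \<kappa> (U - {e}))) v)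
            - sqrt (prob_eq (Pow cells) (\<lambda>U. trace t (inp \<kappa> (insert e U))) v))\<^sup>2)"
  proof (intro sum_mono, clarify)
    fix b l
    show "(case \<kappa> b l of Det S \<Rightarrow> 0 | Rnd i \<Rightarrow> tog \<kappa> b l i) \<le>
       (\<Sum>v\<in>TR. (sqrt (prob_eq (Pow cells) (\<lambda>U. trace t (inp \<kappa> (U - {(b, l)}))) v)
            - sqrt (prob_eq (Pow cells) (\<lambda>U. trace t (inp \<kappa> (insert (b, l) U))) v))\<^sup>2)"
    proof (cases "\<kappa> b l")
      case (Rnd i)
      have "inp (upd \<kappa> b l (Det {})) U = inp \<kappa> (U - {(b, l)})" for U
        by (intro ext) (auto simp: inp_def upd_apply Rnd split: cell.splits)
      moreover have "inp (upd \<kappa> b l (Det {i})) U = inp \<kappa> (insert (b, l) U)" for U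
        by (intro ext) (auto simp: inp_def upd_apply Rnd split: cell.splits)
      ultimately show ?thesis by (simp add: Rnd tog_def hell_def Pr_def)
    qed (auto intro: sum_nonneg)
  qed
  also have "\<dots> \<le> 4 * ln (card TR)"
    using finite_TR trace_in_TR by (intro sum_hellinger_flip_le) auto
  also have "\<dots> \<le> 4 * ln (2 ^ C)"
  proof -
    have "card TR > 0" using finite_TR trace_in_TR by (auto simp: card_gt_0_iff)
    moreover have "real (card TR) \<le> 2 ^ C" using card_TR by (simp flip: of_nat_le_iff)
    ultimately show ?thesis by simp
  qed
  also have "\<dots> = 4 * real C * ln 2" by (simp add: ln_realpow)
  finally show ?thesis .
qed

definition pat :: "bool \<Rightarrow> bool \<Rightarrow> nat set" where
  "pat u w = (if u then {..<k div 2} else {}) \<union> (if w then {k div 2..<k} else {})"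

definition conf :: "(nat \<Rightarrow> pub) \<Rightarrow> nat set \<Rightarrow> nat set \<Rightarrow> config" where
  "conf r x y b l = (case r b of (M, m, D, \<tau>, z) \<Rightarrow>
     if l = M then Det (pat (b \<in> x) (b \<in> y))
     else if \<tau> \<and> l = m then Det (if z then {D l} else {}) else Rnd (D l))"

definition spec :: "(nat \<Rightarrow> pub) \<Rightarrow> nat \<Rightarrow> nat" where "spec r b = fst (r b)"

lemma conf_ins:
  "j \<notin> x \<Longrightarrow> j \<notin> y \<Longrightarrow> conf r (ins j u x) (ins j w y) = upd (conf r x y) j (spec r j) (Det (pat u w))"
proof (intro ext)
  fix b l assume "j \<notin> x" "j \<notin> y"
  thus "conf r (ins j u x) (ins j w y) b l = upd (conf r x y) j (spec r j) (Det (pat u w)) b l"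
    by (cases "b = j") (auto simp: conf_def upd_apply ins_def spec_def split: prod.splits)
qed

definition togs :: "(nat \<Rightarrow> pub) \<Rightarrow> nat set \<Rightarrow> nat set \<Rightarrow> nat \<Rightarrow> real" where
  "togs r x y j = (\<Sum>i<k. tog (conf r x y) j (spec r j) i)"

lemma half_k: "k div 2 \<le> k" "\<exists>m. k div 2 = 2 ^ m" "\<exists>m. k - k div 2 = 2 ^ m"
  using k_pow by auto

text \<open>The partition argument applies to each half, whose size is again a power of two. The
  distance from zeros to all ones equals the distance between the two half patterns by
  cut-and-paste; the other edges follow by the triangle inequality with its factor 2.\<close>

lemma hell_planted_le:
  fixes r x y j
  defines "P \<equiv> \<lambda>S. Pr (upd (conf r x y) j (spec r j) (Det S))"
  defines "h10 \<equiv> hell TR (P {}) (P (pat True False))"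
    and "h01 \<equiv> hell TR (P {}) (P (pat False True))"
  shows "h10 + h01 \<le> 4 * togs r x y j"
    and "hell TR (P (pat False True)) (P (pat True True)) \<le> 4 * h10 + 6 * h01"
    and "hell TR (P (pat True False)) (P (pat True True)) \<le> 6 * h10 + 4 * h01"
    and "hell TR (P {}) (P (pat True True)) \<le> 2 * h10 + 2 * h01"
proof -
  interpret sp: site_product TR "{..<k}" "\<lambda>_. 1"
    "\<lambda>v i u. site (upd (conf r x y) j (spec r j) (Det (if u then {i} else {}))) v i" P
    unfolding P_def by (rule site_product_cell)
  obtain m1 m2 where m: "k div 2 = 2 ^ m1" "k - k div 2 = 2 ^ m2" using half_k by auto
  have "h10 \<le> 4 * (\<Sum>i<k div 2. hell TR (P {}) (P {i}))"
    unfolding h10_def pat_def using sp.partition_lemma[of "{..<k div 2}" m1] m by simp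
  moreover have "h01 \<le> 4 * (\<Sum>i\<in>{k div 2..<k}. hell TR (P {}) (P {i}))"
    unfolding h01_def pat_def using sp.partition_lemma[of "{k div 2..<k}" m2] m by simp
  moreover have "togs r x y j = (\<Sum>i<k div 2. hell TR (P {}) (P {i})) + (\<Sum>i\<in>{k div 2..<k}. hell TR (P {}) (P {i}))"
  proof -
    have "{..<k} = {..<k div 2} \<union> {k div 2..<k}" using half_k by auto
    moreover have "{..<k div 2} \<inter> {k div 2..<k} = {}" by auto
    ultimately show ?thesis unfolding togs_def tog_def P_def by (simp add: sum.union_disjoint)
  qed
  ultimately show "h10 + h01 \<le> 4 * togs r x y j" by simp
  have "pat True False \<inter> pat False True = {}" "pat True False \<union> pat False True = pat True True"
    by (auto simp: pat_def)
  hence cp: "hell TR (P {}) (P (pat True True)) = hell TR (P (pat True False)) (P (pat False True))"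
    using sp.cut_and_paste by metis
  show 11: "hell TR (P {}) (P (pat True True)) \<le> 2 * h10 + 2 * h01"
    unfolding cp h10_def h01_def using hell_triangle2[of TR "P (pat True False)" "P (pat False True)" "P {}"]
    by (simp add: hell_commute)
  show "hell TR (P (pat False True)) (P (pat True True)) \<le> 4 * h10 + 6 * h01"
    using hell_triangle2[of TR "P (pat False True)" "P (pat True True)" "P {}"] 11
    by (simp add: h01_def hell_commute)
  show "hell TR (P (pat True False)) (P (pat True True)) \<le> 6 * h10 + 4 * h01"
    using hell_triangle2[of TR "P (pat True False)" "P (pat True True)" "P {}"] 11
    by (simp add: h10_def hell_commute)
qed

end

section \<open>Planted and ordinary coordinates\<close>

lemma sum_swap3:
  "(\<Sum>x\<in>X. \<Sum>y\<in>Y. \<Sum>m\<in>Z. f x y m) = (\<Sum>m\<in>Z. \<Sum>x\<in>X. \<Sum>y\<in>Y. f x y m)"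
proof -
  have "(\<Sum>x\<in>X. \<Sum>y\<in>Y. \<Sum>m\<in>Z. f x y m) = (\<Sum>x\<in>X. \<Sum>m\<in>Z. \<Sum>y\<in>Y. f x y m)"
    by (rule sum.cong[OF refl], rule sum.swap)
  also have "\<dots> = (\<Sum>m\<in>Z. \<Sum>x\<in>X. \<Sum>y\<in>Y. f x y m)" by (rule sum.swap)
  finally show ?thesis .
qed

context board
begin

definition "DD = PiE_dflt {..<n} (0::nat) (\<lambda>_. {..<k})"

definition Pub :: "pub set" where "Pub = {..<n} \<times> {..<n} \<times> DD \<times> UNIV \<times> UNIV"

definition Act :: "pub set" where "Act = {q \<in> Pub. active q}"

definition pub0 :: pub where "pub0 = (0, 0, \<lambda>_. 0, False, False)"

lemma finite_DD: "finite DD" and DD_nonempty: "DD \<noteq> {}"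
  using k_pos by (auto simp: DD_def)

lemma finite_Pub: "finite Pub" by (simp add: Pub_def finite_DD)

lemma finite_Act: "finite Act" by (simp add: Act_def finite_Pub)

lemma sum_Pub:
  fixes f :: "pub \<Rightarrow> real"
  shows "(\<Sum>q\<in>Pub. f q) = (\<Sum>M<n. \<Sum>m<n. \<Sum>D\<in>DD. \<Sum>\<tau>\<in>UNIV. \<Sum>z\<in>UNIV. f (M, m, D, \<tau>, z))"
  by (simp only: Pub_def sum.cartesian_product')

lemma sum_Act:
  fixes f :: "pub \<Rightarrow> real"
  shows "(\<Sum>q\<in>Act. f q) = (\<Sum>M<n. \<Sum>m<n. \<Sum>D\<in>DD. of_bool (M \<noteq> m) * f (M, m, D, True, False))"
proof -
  have "(\<Sum>q\<in>Act. f q) = (\<Sum>q\<in>Pub. of_bool (active q) * f q)"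
    unfolding Act_def using finite_Pub by (simp add: sum.inter_filter of_bool_def if_distrib[of "\<lambda>c. c * _"] cong: if_cong)
  also have "\<dots> = (\<Sum>M<n. \<Sum>m<n. \<Sum>D\<in>DD. \<Sum>\<tau>\<in>UNIV. \<Sum>z\<in>UNIV. of_bool (active (M, m, D, \<tau>, z)) * f (M, m, D, \<tau>, z))"
    by (rule sum_Pub)
  also have "\<dots> = (\<Sum>M<n. \<Sum>m<n. \<Sum>D\<in>DD. of_bool (M \<noteq> m) * f (M, m, D, True, False))"
    by (simp add: UNIV_bool active_def del: sum_of_bool_mult_eq sum_mult_of_bool_eq)
  finally show ?thesis .
qed

lemma card_Act: "real (card Act) = real n * (real n - 1) * card DD"
proof -
  have "real (card Act) = (\<Sum>M<n. \<Sum>m<n. \<Sum>D\<in>DD. of_bool (M \<noteq> m) * 1)"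
    using sum_Act[of "\<lambda>_. 1"] by simp
  also have "\<dots> = (\<Sum>M<n. \<Sum>m<n. (of_bool (M \<noteq> m) :: real)) * card DD"
    by (simp add: sum_distrib_left sum_distrib_right mult.commute del: sum_of_bool_eq sum_of_bool_mult_eq sum_mult_of_bool_eq)
  also have "(\<Sum>M<n. \<Sum>m<n. (of_bool (M \<noteq> m) :: real)) = (\<Sum>M<n. real n - 1)"
  proof (rule sum.cong[OF refl])
    fix M assume "M \<in> {..<n}"
    hence "(\<Sum>m<n. of_bool (M = m)) = (1::real)" by (simp add: of_bool_def)
    moreover have "(\<Sum>m<n. of_bool (M \<noteq> m)) = (\<Sum>m<n. 1 - of_bool (M = m) :: real)"
      by (intro sum.cong) auto
    ultimately show "(\<Sum>m<n. of_bool (M \<noteq> m)) = real n - 1" by (simp add: sum_subtractf)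
  qed
  finally show ?thesis by simp
qed

text \<open>The swap: a planted coordinate \<open>M\<close> next to a pinned zero coordinate \<open>m\<close> carries the same
  input as a block planted with zeros at \<open>m\<close> in which \<open>M\<close> is an ordinary coordinate.\<close>

lemma upd_conf_swap:
  assumes "M \<noteq> m" "j \<notin> x" "j \<notin> y"
  shows "upd (conf (r(j := (M, m, D, True, False))) x y) j M c
       = upd (conf (r(j := (m, m', D(M := i), False, z))) x y) j M c"
  using assms by (intro ext) (auto simp: upd_apply conf_def pat_def)

text \<open>After the swap, toggling site \<open>i\<close> at the planted coordinate
  \<open>M\<close> is toggling an ordinary coordinate owned by \<open>i\<close>. The sum over
  \<open>i\<close> resamples the owner of \<open>M\<close>, whence the factor \<open>k\<close>, and
  the sum over \<open>M\<close> becomes \<open>block_info\<close>. The values \<open>m'\<close> and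
  \<open>z\<close> are arbitrary since an unpinned block ignores them.\<close>

lemma sum_togs_Act_le:
  assumes "j \<notin> x" "j \<notin> y"
  shows "(\<Sum>q\<in>Act. togs (r(j := q)) x y j)
     \<le> real k * (\<Sum>m<n. \<Sum>D\<in>DD. block_info j (conf (r(j := (m, m', D, False, z))) x y))"
proof -
  define g where "g M m D = tog (conf (r(j := (m, m', D, False, z))) x y) j M (D M)" for M m D
  have "(\<Sum>q\<in>Act. togs (r(j := q)) x y j) = (\<Sum>M<n. \<Sum>m<n. of_bool (M \<noteq> m) * (\<Sum>D\<in>DD. \<Sum>i<k. g M m (D(M := i))))"
    unfolding sum_Act sum_distrib_left
  proof (intro sum.cong refl)
    fix M m D
    show "of_bool (M \<noteq> m) * togs (r(j := (M, m, D, True, False))) x y j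
        = (\<Sum>i<k. of_bool (M \<noteq> m) * g M m (D(M := i)))"
      using upd_conf_swap[OF _ assms, of M m r D _ m' _ z]
      by (cases "M = m") (simp_all add: togs_def g_def tog_def spec_def)
  qed
  also have "\<dots> = (\<Sum>M<n. \<Sum>m<n. of_bool (M \<noteq> m) * (real k * (\<Sum>D\<in>DD. g M m D)))"
    unfolding DD_def by (intro sum.cong refl arg_cong2[where f = "(*)"]) (subst sum_PiE_dflt_resample, auto)
  also have "\<dots> = real k * (\<Sum>M<n. \<Sum>m<n. \<Sum>D\<in>DD. of_bool (M \<noteq> m) * g M m D)"
    by (simp add: sum_distrib_left mult_ac)
  also have "(\<Sum>M<n. \<Sum>m<n. \<Sum>D\<in>DD. of_bool (M \<noteq> m) * g M m D)
      = (\<Sum>m<n. \<Sum>D\<in>DD. \<Sum>M<n. of_bool (M \<noteq> m) * g M m D)"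
    by (subst sum.swap, intro sum.cong refl, rule sum.swap)
  also have "\<dots> = (\<Sum>m<n. \<Sum>D\<in>DD. block_info j (conf (r(j := (m, m', D, False, z))) x y))"
    unfolding block_info_def g_def by (intro sum.cong refl) (auto simp: conf_def)
  finally show ?thesis by (rule eq_refl)
qed

text \<open>Only active blocks are correlated, because the swap can be performed only there.\<close>

definition rhof :: "real \<Rightarrow> (nat \<Rightarrow> pub) \<Rightarrow> nat \<Rightarrow> real" where
  "rhof \<rho> r j = (if active (r j) then \<rho> else 0)"

definition RR :: "(nat \<Rightarrow> pub) set" where "RR = PiE_dflt {..<B} pub0 (\<lambda>_. Pub)"

lemma finite_RR: "finite RR" by (simp add: RR_def finite_PiE_dflt finite_Pub)

text \<open>The swap lands in unpinned blocks with planted zeros, a part of the full average of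
  \<open>block_info\<close>. Planted zeros have weight 1/4, which costs a factor 4; summing over the
  free \<open>m'\<close> and \<open>z\<close> divides by \<open>2 * n\<close>. This gives
  \<open>2 * k / n\<close>, to be multiplied by the total \<open>4 * C * ln 2\<close> for each fixed
  configuration.\<close>

lemma sum_active_togs_le:
  assumes \<rho>: "0 \<le> \<rho>" "\<rho> \<le> 1/2" and n: "n > 0"
  shows "(\<Sum>r\<in>RR. \<Sum>j<B. of_bool (active (r j)) * (\<Sum>x\<in>Pow ({..<B} - {j}). \<Sum>y\<in>Pow ({..<B} - {j}).
       wt (rhof \<rho> r) ({..<B} - {j}) x y * togs r x y j))
     \<le> 8 * real k * real C * ln 2 / real n * real (card RR)"
proof -
  define J where "J = {..<B}"
  define G where "G j r = of_bool (active (r j)) * (\<Sum>x\<in>Pow (J - {j}). \<Sum>y\<in>Pow (J - {j}).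
       wt (rhof \<rho> r) (J - {j}) x y * togs r x y j)" for j r
  define H where "H j r = (\<Sum>x\<in>Pow J. \<Sum>y\<in>Pow J. wt (rhof \<rho> r) J x y * block_info j (conf r x y))" for j r
  have r01: "0 \<le> rhof \<rho> r j" "rhof \<rho> r j \<le> 1/2" for r j using \<rho> by (auto simp: rhof_def)
  note wpos = wt_pos[of "rhof \<rho> r" for r, OF r01]
  have Pubpos: "real (card Pub) > 0"
    using n DD_nonempty finite_Pub by (auto simp: card_gt_0_iff Pub_def)
  have key: "(\<Sum>q\<in>Pub. G j (r(j := q))) \<le> 2 * real k / real n * (\<Sum>q\<in>Pub. H j (r(j := q)))"
    if j: "j \<in> J" for j r
  proof -
    define w where "w x y = wt (rhof \<rho> r) (J - {j}) x y" for x y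
    have w_eq: "wt (rhof \<rho> (r(j := q))) (J - {j}) x y = w x y" for q x y
      unfolding w_def wt_def[OF r01] by (intro prod.cong) (auto simp: rhof_def)
    have wnn: "0 \<le> w x y" for x y unfolding w_def using wpos by (simp add: less_imp_le)
    have 1: "(\<Sum>q\<in>Pub. G j (r(j := q))) = (\<Sum>x\<in>Pow (J - {j}). \<Sum>y\<in>Pow (J - {j}). w x y * (\<Sum>q\<in>Act. togs (r(j := q)) x y j))"
    proof -
      have "(\<Sum>q\<in>Pub. G j (r(j := q))) = (\<Sum>q\<in>Act. \<Sum>x\<in>Pow (J - {j}). \<Sum>y\<in>Pow (J - {j}). w x y * togs (r(j := q)) x y j)"
        unfolding Act_def G_def using finite_Pub
        by (simp add: sum.inter_filter w_eq of_bool_def if_distrib[of "\<lambda>c. c * _"] cong: if_cong)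
      also have "\<dots> = (\<Sum>x\<in>Pow (J - {j}). \<Sum>y\<in>Pow (J - {j}). \<Sum>q\<in>Act. w x y * togs (r(j := q)) x y j)"
        by (subst sum.swap, intro sum.cong refl, rule sum.swap)
      finally show ?thesis by (simp add: sum_distrib_left)
    qed
    have 2: "(\<Sum>q\<in>Pub. G j (r(j := q))) \<le> real k * (\<Sum>m<n. \<Sum>D\<in>DD. 4 * H j (r(j := (m, m', D, False, z))))" for m' z
    proof -
      have "(\<Sum>q\<in>Pub. G j (r(j := q))) \<le> (\<Sum>x\<in>Pow (J - {j}). \<Sum>y\<in>Pow (J - {j}). w x y *
          (real k * (\<Sum>m<n. \<Sum>D\<in>DD. block_info j (conf (r(j := (m, m', D, False, z))) x y))))"
        unfolding 1 using wnn by (intro sum_mono mult_left_mono sum_togs_Act_le) auto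
      also have "\<dots> = real k * (\<Sum>x\<in>Pow (J - {j}). \<Sum>y\<in>Pow (J - {j}). \<Sum>m<n. \<Sum>D\<in>DD.
          w x y * block_info j (conf (r(j := (m, m', D, False, z))) x y))"
        by (simp add: sum_distrib_left mult_ac)
      finally have a: "(\<Sum>q\<in>Pub. G j (r(j := q))) \<le> \<dots>" .
      have "(\<Sum>x\<in>Pow (J - {j}). \<Sum>y\<in>Pow (J - {j}). \<Sum>m<n. \<Sum>D\<in>DD.
            w x y * block_info j (conf (r(j := (m, m', D, False, z))) x y))
         = (\<Sum>m<n. \<Sum>D\<in>DD. \<Sum>x\<in>Pow (J - {j}). \<Sum>y\<in>Pow (J - {j}).
            w x y * block_info j (conf (r(j := (m, m', D, False, z))) x y))"
        by (subst sum_swap3, rule sum.cong[OF refl], rule sum_swap3)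
      also have "\<dots> \<le> (\<Sum>m<n. \<Sum>D\<in>DD. 4 * H j (r(j := (m, m', D, False, z))))"
      proof (intro sum_mono)
        fix m D
        define r' where "r' = r(j := (m, m', D, False, z))"
        \<comment> \<open>In \<open>r'\<close> block \<open>j\<close> is not active, so its planted
          bits are independent and both vanish with weight exactly 1/4.\<close>
        have wJ: "wt (rhof \<rho> r') J x y = w x y / 4" if "x \<in> Pow (J - {j})" "y \<in> Pow (J - {j})" for x y
        proof -
          have "J = insert j (J - {j})" using j by auto
          hence "wt (rhof \<rho> r') J x y = kern (rhof \<rho> r' j) False False * wt (rhof \<rho> r') (J - {j}) x y"
            using wt_ins[of "rhof \<rho> r'", OF r01, of "J - {j}" j x y False False] that by (simp add: J_def)
          moreover have "rhof \<rho> r' j = 0" by (simp add: rhof_def r'_def active_def)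
          ultimately show ?thesis using w_eq[of "(m, m', D, False, z)" x y] by (simp add: kern_def r'_def)
        qed
        have "(\<Sum>x\<in>Pow (J - {j}). \<Sum>y\<in>Pow (J - {j}). w x y * block_info j (conf r' x y))
           = 4 * (\<Sum>x\<in>Pow (J - {j}). \<Sum>y\<in>Pow (J - {j}). wt (rhof \<rho> r') J x y * block_info j (conf r' x y))"
          by (simp add: sum_distrib_left wJ)
        also have "\<dots> \<le> 4 * (\<Sum>x\<in>Pow (J - {j}). \<Sum>y\<in>Pow J. wt (rhof \<rho> r') J x y * block_info j (conf r' x y))"
          using wpos block_info_nonneg
          by (intro mult_left_mono sum_mono sum_mono2) (auto simp: J_def less_imp_le)
        also have "\<dots> \<le> 4 * H j r'"
          unfolding H_def using wpos block_info_nonneg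
          by (intro mult_left_mono sum_mono2 sum_nonneg) (auto simp: J_def less_imp_le)
        finally show "(\<Sum>x\<in>Pow (J - {j}). \<Sum>y\<in>Pow (J - {j}). w x y * block_info j (conf r' x y)) \<le> 4 * H j r'" .
      qed
      finally show ?thesis by (intro order_trans[OF a] mult_left_mono) auto
    qed
    have Hnn: "0 \<le> H j r" for r
      unfolding H_def using wpos block_info_nonneg by (intro sum_nonneg) (auto simp: less_imp_le)
    have "2 * real n * (\<Sum>q\<in>Pub. G j (r(j := q))) = (\<Sum>m'<n. \<Sum>z\<in>(UNIV::bool set). (\<Sum>q\<in>Pub. G j (r(j := q))))"
      by simp
    also have "\<dots> \<le> (\<Sum>m'<n. \<Sum>z\<in>UNIV. real k * (\<Sum>m<n. \<Sum>D\<in>DD. 4 * H j (r(j := (m, m', D, False, z)))))"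
      by (intro sum_mono 2)
    also have "\<dots> = 4 * real k * (\<Sum>m'<n. \<Sum>z\<in>UNIV. \<Sum>m<n. \<Sum>D\<in>DD. H j (r(j := (m, m', D, False, z))))"
      by (simp add: sum_distrib_left mult_ac)
    finally have a: "2 * real n * (\<Sum>q\<in>Pub. G j (r(j := q))) \<le> \<dots>" .
    have "(\<Sum>m'<n. \<Sum>z\<in>UNIV. \<Sum>m<n. \<Sum>D\<in>DD. H j (r(j := (m, m', D, False, z))))
        = (\<Sum>m<n. \<Sum>m'<n. \<Sum>D\<in>DD. \<Sum>z\<in>UNIV. H j (r(j := (m, m', D, False, z))))"
      by (subst (2) sum.swap, subst sum.swap, intro sum.cong refl, subst (1) sum.swap, rule refl)
    also have "\<dots> \<le> (\<Sum>m<n. \<Sum>m'<n. \<Sum>D\<in>DD. \<Sum>\<tau>\<in>UNIV. \<Sum>z\<in>UNIV. H j (r(j := (m, m', D, \<tau>, z))))"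
      by (rule sum_mono, rule sum_mono, rule sum_mono) (simp add: UNIV_bool Hnn)
    also have "\<dots> = (\<Sum>q\<in>Pub. H j (r(j := q)))"
      by (rule sum_Pub[symmetric])
    finally have "2 * real n * (\<Sum>q\<in>Pub. G j (r(j := q))) \<le> 4 * real k * (\<Sum>q\<in>Pub. H j (r(j := q)))"
      by (intro order_trans[OF a] mult_left_mono) auto
    thus ?thesis using n by (simp add: field_simps)
  qed
  have Gj: "(\<Sum>r\<in>RR. G j r) \<le> 2 * real k / real n * (\<Sum>r\<in>RR. H j r)" if "j \<in> J" for j
  proof -
    have "real (card Pub) * (\<Sum>r\<in>RR. G j r) = (\<Sum>r\<in>RR. \<Sum>q\<in>Pub. G j (r(j := q)))"
      unfolding RR_def using that finite_Pub by (subst sum_PiE_dflt_resample) (auto simp: J_def)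
    also have "\<dots> \<le> (\<Sum>r\<in>RR. 2 * real k / real n * (\<Sum>q\<in>Pub. H j (r(j := q))))"
      by (intro sum_mono key that)
    also have "\<dots> = 2 * real k / real n * (\<Sum>r\<in>RR. \<Sum>q\<in>Pub. H j (r(j := q)))"
      by (simp add: sum_distrib_left)
    also have "(\<Sum>r\<in>RR. \<Sum>q\<in>Pub. H j (r(j := q))) = real (card Pub) * (\<Sum>r\<in>RR. H j r)"
      unfolding RR_def using that finite_Pub by (subst sum_PiE_dflt_resample) (auto simp: J_def)
    finally have "real (card Pub) * (\<Sum>r\<in>RR. G j r) \<le> real (card Pub) * (2 * real k / real n * (\<Sum>r\<in>RR. H j r))"
      by (simp add: mult_ac)
    thus ?thesis using Pubpos by (simp only: mult_le_cancel_left_pos)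
  qed
  have "(\<Sum>r\<in>RR. \<Sum>j\<in>J. G j r) = (\<Sum>j\<in>J. \<Sum>r\<in>RR. G j r)" by (rule sum.swap)
  also have "\<dots> \<le> (\<Sum>j\<in>J. 2 * real k / real n * (\<Sum>r\<in>RR. H j r))" by (intro sum_mono Gj)
  also have "\<dots> = 2 * real k / real n * (\<Sum>r\<in>RR. \<Sum>j\<in>J. H j r)"
    by (subst sum.swap) (simp add: sum_distrib_left)
  also have "\<dots> \<le> 2 * real k / real n * (\<Sum>r\<in>RR. 4 * real C * ln 2)"
  proof (intro mult_left_mono sum_mono)
    fix r
    have "(\<Sum>j\<in>J. H j r) = (\<Sum>x\<in>Pow J. \<Sum>y\<in>Pow J. wt (rhof \<rho> r) J x y * (\<Sum>j\<in>J. block_info j (conf r x y)))"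
      unfolding H_def sum_distrib_left by (subst sum.swap, intro sum.cong refl, rule sum.swap)
    also have "\<dots> \<le> (\<Sum>x\<in>Pow J. \<Sum>y\<in>Pow J. wt (rhof \<rho> r) J x y * (4 * real C * ln 2))"
      using wpos sum_block_info_le by (intro sum_mono mult_left_mono) (auto simp: J_def less_imp_le)
    also have "\<dots> = (\<Sum>x\<in>Pow J. 1 / 2 ^ card J * (4 * real C * ln 2))"
      unfolding sum_distrib_right[symmetric]
      by (intro arg_cong2[where f = "(*)"] sum.cong refl sum_wt[OF r01]) (auto simp: J_def)
    also have "\<dots> = 4 * real C * ln 2" by (simp add: J_def card_Pow)
    finally show "(\<Sum>j\<in>J. H j r) \<le> 4 * real C * ln 2" .
  qed auto
  also have "\<dots> = 8 * real k * real C * ln 2 / real n * real (card RR)" by simp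
  finally show ?thesis by (simp add: G_def J_def)
qed

section \<open>The two halves of the sites as two parties\<close>

definition alpha :: "(nat \<Rightarrow> pub) \<Rightarrow> bool list \<Rightarrow> nat set \<Rightarrow> real" where
  "alpha r v x = (\<Prod>i<k div 2. site (conf r x {}) v i)"

definition beta :: "(nat \<Rightarrow> pub) \<Rightarrow> bool list \<Rightarrow> nat set \<Rightarrow> real" where
  "beta r v y = (\<Prod>i\<in>{k div 2..<k}. site (conf r {} y) v i)"

text \<open>The first half of the sites sees only \<open>x\<close>, the second half only
  \<open>y\<close>. This is the two-party product form on which the chain rule rests.\<close>

lemma Pr_conf: "Pr (conf r x y) v = alpha r v x * beta r v y"
proof -
  have "site (conf r x y) v i = site (conf r x {}) v i" if "i < k div 2" for i
    using that by (intro site_cong ext) (auto simp: inp_def conf_def pat_def split: prod.splits)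
  moreover have "site (conf r x y) v i = site (conf r {} y) v i" if "i \<ge> k div 2" for i
    using that by (intro site_cong ext) (auto simp: inp_def conf_def pat_def split: prod.splits)
  moreover have "{..<k} = {..<k div 2} \<union> {k div 2..<k}" "{..<k div 2} \<inter> {k div 2..<k} = {}"
    using half_k by auto
  ultimately show ?thesis unfolding Pr_eq_prod alpha_def beta_def
    by (simp add: prod.union_disjoint)
qed

lemma alpha_nonneg: "0 \<le> alpha r v x" and beta_nonneg: "0 \<le> beta r v x"
  unfolding alpha_def beta_def by (auto intro!: prod_nonneg simp: site_nonneg)

text \<open>The four edges add up to at most \<open>11 * (h10 + h01)\<close>; halved, and with
  \<open>h10 + h01 \<le> 4 * togs\<close>, this gives 22.\<close>

lemma sum_flips_le:
  assumes \<rho>: "\<And>j. 0 \<le> \<rho> j" "\<And>j. \<rho> j \<le> 1/2"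
  shows "(\<Sum>v\<in>TR. flips \<rho> J j (alpha r v) (beta r v))
     \<le> 22 * (\<Sum>x\<in>Pow (J - {j}). \<Sum>y\<in>Pow (J - {j}). wt \<rho> (J - {j}) x y * togs r x y j)"
proof -
  let ?L = "Pow (J - {j})"
  define t where "t x y v = (sqrt (alpha r v x) - sqrt (alpha r v (insert j x)))\<^sup>2 * ((beta r v y + beta r v (insert j y)) / 2)
       + (alpha r v x + alpha r v (insert j x)) / 2 * (sqrt (beta r v y) - sqrt (beta r v (insert j y)))\<^sup>2" for x y v
  have "(\<Sum>v\<in>TR. flips \<rho> J j (alpha r v) (beta r v)) = (\<Sum>x\<in>?L. \<Sum>y\<in>?L. wt \<rho> (J - {j}) x y * (\<Sum>v\<in>TR. t x y v))"
    unfolding flips_def[OF \<rho>] t_def[symmetric] sum_distrib_left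
    by (subst sum.swap, intro sum.cong refl, rule sum.swap)
  also have "\<dots> \<le> (\<Sum>x\<in>?L. \<Sum>y\<in>?L. wt \<rho> (J - {j}) x y * (22 * togs r x y j))"
  proof (intro sum_mono mult_left_mono)
    fix x y assume xy: "x \<in> ?L" "y \<in> ?L"
    show "0 \<le> wt \<rho> (J - {j}) x y" using wt_pos[of \<rho>, OF \<rho>] by (simp add: less_imp_le)
    define P where "P S = Pr (upd (conf r x y) j (spec r j) (Det S))" for S
    have P: "P (pat u w) v = alpha r v (ins j u x) * beta r v (ins j w y)" for u w v
    proof -
      have "j \<notin> x" "j \<notin> y" using xy by auto
      thus ?thesis unfolding P_def by (simp flip: conf_ins add: Pr_conf)
    qed
    have split: "(sqrt a - sqrt a')\<^sup>2 * b = (sqrt (a * b) - sqrt (a' * b))\<^sup>2" if "0 \<le> b" for a a' b :: real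
      using that by (simp add: real_sqrt_mult left_diff_distrib[symmetric] power_mult_distrib)
    have pf: "pat False False = {}" by (simp add: pat_def)
    have tv: "t x y v = ((sqrt (P (pat False False) v) - sqrt (P (pat True False) v))\<^sup>2
        + (sqrt (P (pat False True) v) - sqrt (P (pat True True) v))\<^sup>2
        + (sqrt (P (pat False False) v) - sqrt (P (pat False True) v))\<^sup>2
        + (sqrt (P (pat True False) v) - sqrt (P (pat True True) v))\<^sup>2) / 2" for v
    proof -
      have 1: "(sqrt (P (pat False w) v) - sqrt (P (pat True w) v))\<^sup>2
          = (sqrt (alpha r v x) - sqrt (alpha r v (insert j x)))\<^sup>2 * beta r v (ins j w y)" for w
        unfolding P by (subst split) (simp_all add: beta_nonneg)
      have 2: "(sqrt (P (pat u False) v) - sqrt (P (pat u True) v))\<^sup>2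
          = alpha r v (ins j u x) * (sqrt (beta r v y) - sqrt (beta r v (insert j y)))\<^sup>2" for u
        unfolding P mult.commute[of "alpha r v (ins j u x)"] by (subst split) (simp_all add: alpha_nonneg)
      show ?thesis unfolding 1 2 t_def ins_simps by (simp add: distrib_left distrib_right add_divide_distrib)
    qed
    have "(\<Sum>v\<in>TR. t x y v) = (hell TR (P {}) (P (pat True False)) + hell TR (P (pat False True)) (P (pat True True))
        + hell TR (P {}) (P (pat False True)) + hell TR (P (pat True False)) (P (pat True True))) / 2"
      by (simp only: tv pf hell_def sum.distrib sum_divide_distrib[symmetric])
    also have "\<dots> \<le> 22 * togs r x y j"
    proof -
      note h = hell_planted_le[of r x y j, folded P_def]
      show ?thesis using h(1) h(2) h(3) by (simp add: field_simps)
    qed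
    finally show "(\<Sum>v\<in>TR. t x y v) \<le> 22 * togs r x y j" .
  qed
  finally show ?thesis by (simp add: sum_distrib_left mult_ac)
qed

definition Pcorr :: "real \<Rightarrow> (nat \<Rightarrow> pub) \<Rightarrow> bool list \<Rightarrow> real" where
  "Pcorr \<rho> r v = (\<Sum>x\<in>Pow {..<B}. \<Sum>y\<in>Pow {..<B}. wt (rhof \<rho> r) {..<B} x y * Pr (conf r x y) v)"

lemma Pcorr_nonneg: "0 \<le> \<rho> \<Longrightarrow> \<rho> \<le> 1/2 \<Longrightarrow> 0 \<le> Pcorr \<rho> r v"
  unfolding Pcorr_def using wt_pos[of "rhof \<rho> r"]
  by (intro sum_nonneg mult_nonneg_nonneg Pr_nonneg) (auto simp: rhof_def less_imp_le)

text \<open>\<open>176 = 22 * 8\<close>. For \<rho> of order \<open>1 / sqrt B\<close> the loss is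
  of order \<open>C * k / (n * B)\<close>, which is the quantity to be bounded below.\<close>

lemma mean_affinity_ge:
  assumes \<rho>: "0 \<le> \<rho>" "\<rho> \<le> 1/2" and n: "n > 0"
  shows "1 - \<rho>\<^sup>2 * 176 * real k * real C * ln 2 / real n
     \<le> mean RR (\<lambda>r. \<Sum>v\<in>TR. sqrt (Pcorr \<rho> r v * Pcorr 0 r v))"
proof -
  let ?J = "{..<B}"
  have r01: "0 \<le> rhof \<rho> r j" "rhof \<rho> r j \<le> 1/2" for r j using \<rho> by (auto simp: rhof_def)
  have z01: "0 \<le> rhof 0 r j" "rhof 0 r j \<le> 1/2" for r j by (auto simp: rhof_def)
  define G where "G r = (\<Sum>j<B. of_bool (active (r j)) * (\<Sum>x\<in>Pow (?J - {j}). \<Sum>y\<in>Pow (?J - {j}).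
       wt (rhof \<rho> r) (?J - {j}) x y * togs r x y j))" for r
  have one: "1 - \<rho>\<^sup>2 * (22 * G r) \<le> (\<Sum>v\<in>TR. sqrt (Pcorr \<rho> r v * Pcorr 0 r v))" for r
  proof -
    have P: "Pcorr \<rho> r v = corr (rhof \<rho> r) ?J (alpha r v) (beta r v)" for v
      unfolding Pcorr_def corr_def[OF r01] Pr_conf by (simp add: mult_ac)
    have w0: "wt (rhof 0 r) ?J x y = 1 / 2 ^ card ?J / 2 ^ card ?J" for x y
    proof -
      have K: "kern (rhof 0 r j) u w = 1/4" for j u w by (simp add: rhof_def kern_def)
      show ?thesis unfolding wt_def[OF z01] K by (simp add: power_divide flip: power_mult_distrib)
    qed
    have Q: "Pcorr 0 r v = mean (Pow ?J) (alpha r v) * mean (Pow ?J) (beta r v)" for v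
      unfolding Pcorr_def w0 Pr_conf mean_def
      by (simp add: card_Pow sum_product sum_divide_distrib)
    have "(\<Sum>j\<in>?J. (rhof \<rho> r j)\<^sup>2 * (\<Sum>v\<in>TR. flips (rhof \<rho> r) ?J j (alpha r v) (beta r v)))
        \<le> (\<Sum>j\<in>?J. (rhof \<rho> r j)\<^sup>2 * (22 * (\<Sum>x\<in>Pow (?J - {j}). \<Sum>y\<in>Pow (?J - {j}). wt (rhof \<rho> r) (?J - {j}) x y * togs r x y j)))"
      by (intro sum_mono mult_left_mono sum_flips_le r01) auto
    also have "\<dots> = \<rho>\<^sup>2 * (22 * G r)"
      unfolding G_def sum_distrib_left by (intro sum.cong refl) (simp add: rhof_def sum_distrib_left)
    finally have le: "(\<Sum>j\<in>?J. (rhof \<rho> r j)\<^sup>2 * (\<Sum>v\<in>TR. flips (rhof \<rho> r) ?J j (alpha r v) (beta r v)))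
        \<le> \<rho>\<^sup>2 * (22 * G r)" .
    have "1 - (\<Sum>j\<in>?J. (rhof \<rho> r j)\<^sup>2 * (\<Sum>v\<in>TR. flips (rhof \<rho> r) ?J j (alpha r v) (beta r v)))
        \<le> (\<Sum>v\<in>TR. sqrt (Pcorr \<rho> r v * Pcorr 0 r v))"
      unfolding P Q
    proof (rule affinity_ge[OF r01])
      show "(\<Sum>v\<in>TR. alpha r v x * beta r v y) = 1" for x y
        using Pr_mass[of "conf r x y"] by (simp only: Pr_conf)
    qed (auto simp: alpha_nonneg beta_nonneg)
    thus ?thesis using le by linarith
  qed
  have RR: "card RR > 0"
    using n DD_nonempty finite_RR by (auto simp: card_gt_0_iff RR_def Pub_def)
  have "(\<Sum>r\<in>RR. G r) \<le> 8 * real k * real C * ln 2 / real n * real (card RR)"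
    unfolding G_def using \<rho> n by (rule sum_active_togs_le)
  hence "mean RR G \<le> 8 * real k * real C * ln 2 / real n"
    using RR unfolding mean_def by (simp add: divide_le_eq)
  hence "\<rho>\<^sup>2 * 22 * mean RR G \<le> \<rho>\<^sup>2 * 22 * (8 * real k * real C * ln 2 / real n)"
    by (intro mult_left_mono) auto
  hence "1 - \<rho>\<^sup>2 * 176 * real k * real C * ln 2 / real n \<le> mean RR (\<lambda>r. 1 + (- \<rho>\<^sup>2 * 22) * G r)"
    unfolding mean_add mean_cmult using RR finite_RR by (subst mean_const) (auto simp: mult_ac)
  also have "\<dots> \<le> mean RR (\<lambda>r. \<Sum>v\<in>TR. sqrt (Pcorr \<rho> r v * Pcorr 0 r v))"
  proof (rule mean_mono)
    fix r show "1 + (- \<rho>\<^sup>2 * 22) * G r \<le> (\<Sum>v\<in>TR. sqrt (Pcorr \<rho> r v * Pcorr 0 r v))"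
      using one[of r] by (simp add: algebra_simps)
  qed
  finally show ?thesis .
qed

end

section \<open>The input distribution as a uniform distribution\<close>

lemma pmf_of_set_Times:
  assumes "finite A" "A \<noteq> {}" "finite B" "B \<noteq> {}"
  shows "pmf_of_set (A \<times> B) = pair_pmf (pmf_of_set A) (pmf_of_set B)"
proof (rule pmf_eqI)
  fix z
  show "pmf (pmf_of_set (A \<times> B)) z = pmf (pair_pmf (pmf_of_set A) (pmf_of_set B)) z"
    using assms by (cases z) (auto simp: pmf_pair card_cartesian_product indicator_def)
qed

lemma Pi_pmf_refresh:
  assumes "finite A" "m \<in> A"
  shows "do {z \<leftarrow> p m; V \<leftarrow> Pi_pmf A d p; g (V(m := z))} = bind_pmf (Pi_pmf A d p) g"
proof -
  have A: "A = insert m (A - {m})" using assms by auto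
  have P: "Pi_pmf A d p = do {y \<leftarrow> p m; f \<leftarrow> Pi_pmf (A - {m}) d p; return_pmf (f(m := y))}"
    by (subst A, subst Pi_pmf_insert') (use assms in auto)
  show ?thesis unfolding P by (simp add: bind_assoc_pmf bind_return_pmf)
qed

lemma sum_PiE_dflt_prod:
  fixes f :: "'a \<Rightarrow> 'b \<Rightarrow> real"
  assumes "finite A" "finite T"
  shows "(\<Sum>\<theta>\<in>PiE_dflt A d (\<lambda>_. T). \<Prod>b\<in>A. f b (\<theta> b)) = (\<Prod>b\<in>A. \<Sum>q\<in>T. f b q)"
proof -
  have "(\<Sum>\<theta>\<in>PiE_dflt A d (\<lambda>_. T). \<Prod>b\<in>A. f b (\<theta> b)) = (\<Sum>\<theta>\<in>PiE A (\<lambda>_. T). \<Prod>b\<in>A. f b (\<theta> b))"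
  proof (rule sum.reindex_bij_witness[of _ "\<lambda>h x. if x \<in> A then h x else d" "\<lambda>h. restrict h A"])
    fix h assume "h \<in> PiE_dflt A d (\<lambda>_. T)"
    thus "(\<lambda>x. if x \<in> A then restrict h A x else d) = h" "restrict h A \<in> PiE A (\<lambda>_. T)"
      by (auto simp: PiE_dflt_def fun_eq_iff)
  qed (auto simp: PiE_dflt_def PiE_def extensional_def fun_eq_iff cong: prod.cong)
  thus ?thesis using assms by (simp add: prod_sum_PiE)
qed

lemma product_weights_chebyshev:
  fixes w Y :: "'b \<Rightarrow> real" and A :: "'a set" and K s :: real
  assumes fin: "finite A" "finite T" and w: "\<And>q. q \<in> T \<Longrightarrow> 0 \<le> w q" "(\<Sum>q\<in>T. w q) = 1"
    and bound: "\<And>q. q \<in> T \<Longrightarrow> 0 \<le> Y q \<and> Y q \<le> K" and s: "s > 0"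
  defines "\<mu> \<equiv> \<Sum>q\<in>T. w q * Y q"
  shows "(\<Sum>\<theta>\<in>PiE_dflt A d (\<lambda>_. T). (\<Prod>b\<in>A. w (\<theta> b)) * of_bool (\<bar>(\<Sum>b\<in>A. Y (\<theta> b)) - real (card A) * \<mu>\<bar> \<ge> s))
     \<le> real (card A) * K\<^sup>2 / s\<^sup>2"
proof -
  let ?R = "PiE_dflt A d (\<lambda>_. T)"
  define Z where "Z q = Y q - \<mu>" for q
  have Z0: "(\<Sum>q\<in>T. w q * Z q) = 0"
    by (simp add: Z_def right_diff_distrib sum_subtractf \<mu>_def[symmetric] sum_distrib_right[symmetric] w)
  have wR: "0 \<le> (\<Prod>b\<in>A. w (\<theta> b))" if "\<theta> \<in> ?R" for \<theta>
    using that w by (intro prod_nonneg) (auto simp: PiE_dflt_def)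
  have cross: "(\<Sum>\<theta>\<in>?R. (\<Prod>b\<in>A. w (\<theta> b)) * (Z (\<theta> b) * Z (\<theta> c))) = (if b = c then \<Sum>q\<in>T. w q * (Z q)\<^sup>2 else 0)"
    if "b \<in> A" "c \<in> A" for b c
  proof (cases "b = c")
    case True
    have "(\<Sum>\<theta>\<in>?R. (\<Prod>b\<in>A. w (\<theta> b)) * (Z (\<theta> b) * Z (\<theta> c))) =
        (\<Sum>\<theta>\<in>?R. \<Prod>e\<in>A. w (\<theta> e) * (if e = b then (Z (\<theta> e))\<^sup>2 else 1))"
      using that fin True by (intro sum.cong refl) (simp add: prod.distrib prod.delta power2_eq_square)
    also have "\<dots> = (\<Prod>e\<in>A. \<Sum>q\<in>T. w q * (if e = b then (Z q)\<^sup>2 else 1))"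
      using fin by (rule sum_PiE_dflt_prod[where f = "\<lambda>e q. w q * (if e = b then (Z q)\<^sup>2 else 1)"])
    also have "\<dots> = (\<Prod>e\<in>A. if e = b then (\<Sum>q\<in>T. w q * (Z q)\<^sup>2) else 1)"
      by (intro prod.cong refl) (simp add: w)
    also have "\<dots> = (\<Sum>q\<in>T. w q * (Z q)\<^sup>2)" using that fin by (simp add: prod.delta)
    finally show ?thesis using True by simp
  next
    case False
    have "(\<Sum>\<theta>\<in>?R. (\<Prod>b\<in>A. w (\<theta> b)) * (Z (\<theta> b) * Z (\<theta> c))) =
        (\<Sum>\<theta>\<in>?R. \<Prod>e\<in>A. w (\<theta> e) * ((if e = b then Z (\<theta> e) else 1) * (if e = c then Z (\<theta> e) else 1)))"
      using that fin by (intro sum.cong refl) (simp add: prod.distrib prod.delta)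
    also have "\<dots> = (\<Prod>e\<in>A. \<Sum>q\<in>T. w q * ((if e = b then Z q else 1) * (if e = c then Z q else 1)))"
      using fin by (rule sum_PiE_dflt_prod[where f = "\<lambda>e q. w q * ((if e = b then Z q else 1) * (if e = c then Z q else 1))"])
    also have "\<dots> = 0"
      using that fin False by (intro prod_zero bexI[of _ b]) (auto simp: Z0)
    finally show ?thesis using False by simp
  qed
  have "(\<Sum>\<theta>\<in>?R. (\<Prod>b\<in>A. w (\<theta> b)) * of_bool (\<bar>(\<Sum>b\<in>A. Y (\<theta> b)) - real (card A) * \<mu>\<bar> \<ge> s))
      \<le> (\<Sum>\<theta>\<in>?R. (\<Prod>b\<in>A. w (\<theta> b)) * ((\<Sum>b\<in>A. Z (\<theta> b))\<^sup>2 / s\<^sup>2))"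
  proof (intro sum_mono mult_left_mono wR)
    fix \<theta>
    have "(\<Sum>b\<in>A. Y (\<theta> b)) - real (card A) * \<mu> = (\<Sum>b\<in>A. Z (\<theta> b))" by (simp add: Z_def sum_subtractf)
    moreover have "s\<^sup>2 \<le> (\<Sum>b\<in>A. Z (\<theta> b))\<^sup>2" if "\<bar>\<Sum>b\<in>A. Z (\<theta> b)\<bar> \<ge> s"
      using that s by (metis abs_ge_zero less_imp_le power2_abs power_mono)
    ultimately show "of_bool (\<bar>(\<Sum>b\<in>A. Y (\<theta> b)) - real (card A) * \<mu>\<bar> \<ge> s) \<le> (\<Sum>b\<in>A. Z (\<theta> b))\<^sup>2 / s\<^sup>2"
      using s by (simp add: le_divide_eq)
  qed
  also have "\<dots> = (\<Sum>\<theta>\<in>?R. \<Sum>b\<in>A. \<Sum>c\<in>A. (\<Prod>b\<in>A. w (\<theta> b)) * (Z (\<theta> b) * Z (\<theta> c))) / s\<^sup>2"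
  proof -
    have "(\<Sum>b\<in>A. Z (\<theta> b))\<^sup>2 = (\<Sum>b\<in>A. \<Sum>c\<in>A. Z (\<theta> b) * Z (\<theta> c))" for \<theta>
      by (simp add: power2_eq_square sum_product)
    thus ?thesis by (simp add: sum_distrib_left sum_divide_distrib)
  qed
  also have "(\<Sum>\<theta>\<in>?R. \<Sum>b\<in>A. \<Sum>c\<in>A. (\<Prod>b\<in>A. w (\<theta> b)) * (Z (\<theta> b) * Z (\<theta> c)))
      = (\<Sum>b\<in>A. \<Sum>c\<in>A. \<Sum>\<theta>\<in>?R. (\<Prod>b\<in>A. w (\<theta> b)) * (Z (\<theta> b) * Z (\<theta> c)))"
    by (rule sum_swap3[symmetric])
  also have "\<dots> = card A * (\<Sum>q\<in>T. w q * (Z q)\<^sup>2)"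
    using fin by (simp add: cross)
  also have "(\<Sum>q\<in>T. w q * (Z q)\<^sup>2) \<le> K\<^sup>2"
  proof -
    have "(\<Sum>q\<in>T. w q * (Z q)\<^sup>2) = (\<Sum>q\<in>T. w q * (Y q)\<^sup>2 - 2 * \<mu> * (w q * Y q) + \<mu>\<^sup>2 * w q)"
      by (intro sum.cong refl) (simp add: Z_def power2_eq_square algebra_simps)
    also have "\<dots> = (\<Sum>q\<in>T. w q * (Y q)\<^sup>2) - \<mu>\<^sup>2"
      by (simp add: sum.distrib sum_subtractf sum_distrib_left[symmetric] \<mu>_def[symmetric] w power2_eq_square)
    also have "\<dots> \<le> (\<Sum>q\<in>T. w q * (Y q)\<^sup>2)" by simp
    also have "\<dots> \<le> (\<Sum>q\<in>T. w q * K\<^sup>2)"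
      using bound w by (intro sum_mono mult_left_mono power_mono) auto
    also have "\<dots> = K\<^sup>2" by (simp add: sum_distrib_right[symmetric] w)
    finally show ?thesis .
  qed
  finally show ?thesis by (simp add: divide_right_mono mult_left_mono)
qed

text \<open>Triangle inequality for the square roots, then Cauchy-Schwarz over the \<open>m\<close>
  steps. The loss of a factor \<open>m\<close> is tolerable as it is used only for boundedly many
  blocks.\<close>

lemma hell_chain: "hell V (p 0) (p m) \<le> real m * (\<Sum>j<m. hell V (p j) (p (Suc j)))"
proof -
  have "(sqrt (p 0 v) - sqrt (p m v))\<^sup>2 \<le> real m * (\<Sum>j<m. (sqrt (p j v) - sqrt (p (Suc j) v))\<^sup>2)" for v
  proof -
    have "sqrt (p 0 v) - sqrt (p m v) = (\<Sum>j<m. sqrt (p j v) - sqrt (p (Suc j) v))"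
      by (induction m) auto
    also have "(\<dots>)\<^sup>2 \<le> (\<Sum>j<m. (sqrt (p j v) - sqrt (p (Suc j) v))\<^sup>2) * card {..<m}"
      by (rule sum_squared_le_sum_of_squares)
    finally show ?thesis by (simp add: mult.commute)
  qed
  hence "hell V (p 0) (p m) \<le> (\<Sum>v\<in>V. real m * (\<Sum>j<m. (sqrt (p j v) - sqrt (p (Suc j) v))\<^sup>2))"
    unfolding hell_def by (rule sum_mono)
  also have "\<dots> = real m * (\<Sum>j<m. hell V (p j) (p (Suc j)))"
    unfolding hell_def by (subst sum_distrib_left[symmetric], subst sum.swap, rule refl)
  finally show ?thesis .
qed

context board
begin

type_synonym sample = "pub \<times> bool \<times> bool \<times> nat set"

definition Theta :: "sample set" where "Theta = Pub \<times> UNIV \<times> UNIV \<times> Pow {..<n}"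

definition sample0 :: sample where "sample0 = (pub0, False, False, {})"

definition blk :: "sample \<Rightarrow> nat \<Rightarrow> nat \<Rightarrow> bool" where
  "blk \<theta> i l = (case \<theta> of ((M, m, D, \<tau>, z), a, b, u) \<Rightarrow> i < k \<and> l < n \<and>
     (if l = M then (if i < k div 2 then a else b) else i = D l \<and> (if \<tau> \<and> l = m then z else l \<in> u)))"

definition SS :: "(nat \<Rightarrow> sample) set" where "SS = PiE_dflt {..<B} sample0 (\<lambda>_. Theta)"

definition sample_input :: "(nat \<Rightarrow> sample) \<Rightarrow> input" where
  "sample_input \<theta> i b l = blk (\<theta> b) i l"

lemma finite_Theta: "finite Theta" by (simp add: Theta_def finite_Pub)

lemma finite_SS: "finite SS" by (simp add: SS_def finite_PiE_dflt finite_Theta)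

text \<open>The additional randomness \<open>m\<close>, \<open>\<tau>\<close>, \<open>z\<close> does
  not change the law of a block: overwriting a fair bit at an independently chosen coordinate by a
  fresh fair bit leaves the vector of bits equally distributed. This is what permits conditioning on
  the pinned bit.\<close>

lemma psi_eq:
  assumes n: "n > 0"
  shows "psi k n = map_pmf blk (pmf_of_set Theta)"
proof -
  define coin where "coin = bernoulli_pmf (1/2)"
  define PV where "PV = Pi_pmf {..<n} False (\<lambda>_. coin)"
  define R where "R D M a b U = return_pmf (\<lambda>i l. i < k \<and> l < n \<and>
         (if l = M then (if i < k div 2 then a else b) else i = D l \<and> U l))"
    for D :: "nat \<Rightarrow> nat" and M :: nat and a b :: bool and U :: "nat \<Rightarrow> bool"
  have coin: "pmf_of_set UNIV = coin" by (simp add: coin_def bernoulli_pmf_half_conv_pmf_of_set)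
  have ne: "{..<n} \<noteq> {}" using n by auto
  have Pub: "pmf_of_set Pub = pair_pmf (pmf_of_set {..<n}) (pair_pmf (pmf_of_set {..<n})
      (pair_pmf (pmf_of_set DD) (pair_pmf coin coin)))"
  proof -
    have "pmf_of_set (UNIV :: (bool \<times> bool) set) = pair_pmf coin coin"
      using pmf_of_set_Times[of "UNIV :: bool set" "UNIV :: bool set"] by (simp add: coin)
    thus ?thesis unfolding Pub_def using ne finite_DD DD_nonempty by (simp add: pmf_of_set_Times)
  qed
  have Pubne: "Pub \<noteq> {}" using ne DD_nonempty by (auto simp: Pub_def)
  have Th: "pmf_of_set Theta = pair_pmf (pmf_of_set Pub) (pair_pmf coin (pair_pmf coin (pmf_of_set (Pow {..<n}))))"
    unfolding Theta_def using Pubne finite_Pub by (simp add: pmf_of_set_Times coin Pow_not_empty)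
  have u: "pmf_of_set (Pow {..<n}) = map_pmf (\<lambda>V. {l \<in> {..<n}. V l}) PV"
    unfolding PV_def coin_def by (rule pmf_of_set_Pow_conv_bernoulli[symmetric]) simp
  have "map_pmf blk (pmf_of_set Theta) = do {M \<leftarrow> pmf_of_set {..<n}; m \<leftarrow> pmf_of_set {..<n}; D \<leftarrow> pmf_of_set DD;
      \<tau> \<leftarrow> coin; z \<leftarrow> coin; a \<leftarrow> coin; b \<leftarrow> coin; V \<leftarrow> PV;
      return_pmf (blk ((M, m, D, \<tau>, z), a, b, {l \<in> {..<n}. V l}))}"
    unfolding Th Pub u
    by (simp add: pair_pmf_def map_bind_pmf bind_map_pmf bind_assoc_pmf bind_return_pmf)
  also have "\<dots> = do {M \<leftarrow> pmf_of_set {..<n}; m \<leftarrow> pmf_of_set {..<n}; D \<leftarrow> pmf_of_set DD;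
      \<tau> \<leftarrow> coin; z \<leftarrow> coin; a \<leftarrow> coin; b \<leftarrow> coin; V \<leftarrow> PV; R D M a b (if \<tau> then V(m := z) else V)}"
    unfolding R_def by (intro bind_pmf_cong refl arg_cong[where f = return_pmf] ext) (auto simp: blk_def)
  also have "\<dots> = do {M \<leftarrow> pmf_of_set {..<n}; m \<leftarrow> pmf_of_set {..<n}; D \<leftarrow> pmf_of_set DD;
      \<tau> \<leftarrow> coin; a \<leftarrow> coin; b \<leftarrow> coin; z \<leftarrow> coin; V \<leftarrow> PV; R D M a b (if \<tau> then V(m := z) else V)}"
  proof -
    have "do {z \<leftarrow> coin; a \<leftarrow> coin; b \<leftarrow> coin; F z a b} = do {a \<leftarrow> coin; b \<leftarrow> coin; z \<leftarrow> coin; F z a b}"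
      for F :: "bool \<Rightarrow> bool \<Rightarrow> bool \<Rightarrow> (nat \<Rightarrow> nat \<Rightarrow> bool) pmf"
    proof -
      have "do {z \<leftarrow> coin; a \<leftarrow> coin; b \<leftarrow> coin; F z a b} = do {a \<leftarrow> coin; z \<leftarrow> coin; b \<leftarrow> coin; F z a b}"
        by (rule bind_commute_pmf)
      also have "\<dots> = do {a \<leftarrow> coin; b \<leftarrow> coin; z \<leftarrow> coin; F z a b}"
        by (rule bind_pmf_cong[OF refl], rule bind_commute_pmf)
      finally show ?thesis .
    qed
    thus ?thesis
      by - (rule bind_pmf_cong[OF refl], rule bind_pmf_cong[OF refl], rule bind_pmf_cong[OF refl],
        rule bind_pmf_cong[OF refl])
  qed
  also have "\<dots> = do {M \<leftarrow> pmf_of_set {..<n}; m \<leftarrow> pmf_of_set {..<n}; D \<leftarrow> pmf_of_set DD;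
      \<tau> \<leftarrow> coin; a \<leftarrow> coin; b \<leftarrow> coin; V \<leftarrow> PV; R D M a b V}"
  proof (intro bind_pmf_cong refl)
    fix M m D \<tau> a b assume "m \<in> set_pmf (pmf_of_set {..<n})"
    hence "m \<in> {..<n}" using ne by simp
    hence "do {z \<leftarrow> coin; V \<leftarrow> PV; R D M a b (V(m := z))} = bind_pmf PV (R D M a b)"
      unfolding PV_def using Pi_pmf_refresh[of "{..<n}" m "\<lambda>_. coin" False "R D M a b"] by simp
    thus "do {z \<leftarrow> coin; V \<leftarrow> PV; R D M a b (if \<tau> then V(m := z) else V)} = do {V \<leftarrow> PV; R D M a b V}"
      by (cases \<tau>) simp_all
  qed
  also have "\<dots> = do {M \<leftarrow> pmf_of_set {..<n}; D \<leftarrow> pmf_of_set DD; a \<leftarrow> coin; b \<leftarrow> coin; V \<leftarrow> PV; R D M a b V}"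
    by simp
  also have "\<dots> = do {D \<leftarrow> pmf_of_set DD; M \<leftarrow> pmf_of_set {..<n}; a \<leftarrow> coin; b \<leftarrow> coin; V \<leftarrow> PV; R D M a b V}"
    by (rule bind_commute_pmf)
  also have "\<dots> = do {D \<leftarrow> pmf_of_set DD; M \<leftarrow> pmf_of_set {..<n}; a \<leftarrow> coin; V \<leftarrow> PV; b \<leftarrow> coin; R D M a b V}"
    by (intro bind_pmf_cong refl) (rule bind_commute_pmf)
  also have "\<dots> = do {D \<leftarrow> pmf_of_set DD; M \<leftarrow> pmf_of_set {..<n}; V \<leftarrow> PV; a \<leftarrow> coin; b \<leftarrow> coin; R D M a b V}"
    by (rule bind_pmf_cong[OF refl], rule bind_pmf_cong[OF refl], rule bind_commute_pmf)
  also have "\<dots> = do {D \<leftarrow> pmf_of_set DD; V \<leftarrow> PV; M \<leftarrow> pmf_of_set {..<n}; a \<leftarrow> coin; b \<leftarrow> coin; R D M a b V}"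
    by (rule bind_pmf_cong[OF refl], rule bind_commute_pmf)
  also have "pmf_of_set DD = Pi_pmf {..<n} 0 (\<lambda>_. pmf_of_set {..<k})"
    unfolding DD_def using k_pos by (subst Pi_pmf_of_set) auto
  finally show ?thesis unfolding psi_def R_def PV_def coin_def by simp
qed

lemma nu_eq:
  assumes "n > 0"
  shows "nu k B n = map_pmf sample_input (pmf_of_set SS)"
proof -
  have blk0: "blk sample0 = (\<lambda>_ _. False)" by (auto simp: blk_def sample0_def pub0_def fun_eq_iff)
  have Tne: "Theta \<noteq> {}" using assms DD_nonempty by (auto simp: Theta_def Pub_def)
  have "Pi_pmf {..<B} (\<lambda>_ _. False) (\<lambda>_. psi k n) =
      map_pmf (\<lambda>h. blk \<circ> h) (Pi_pmf {..<B} sample0 (\<lambda>_. pmf_of_set Theta))"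
    unfolding psi_eq[OF assms] by (rule Pi_pmf_map) (auto simp: blk0)
  also have "Pi_pmf {..<B} sample0 (\<lambda>_. pmf_of_set Theta) = pmf_of_set SS"
    unfolding SS_def using Tne finite_Theta by (subst Pi_pmf_of_set) auto
  finally show ?thesis
    unfolding nu_def by (simp add: pmf.map_comp comp_def sample_input_def[abs_def])
qed

text \<open>Transposes the sample of \<open>B\<close> blocks: all public parts, the two vectors of
  planted bits, and one set of coin flips for the cells.\<close>

definition zip_sample :: "(nat \<Rightarrow> pub) \<Rightarrow> nat set \<Rightarrow> nat set \<Rightarrow> (nat \<times> nat) set \<Rightarrow> nat \<Rightarrow> sample" where
  "zip_sample r x y U b = (r b, b \<in> x, b \<in> y, {l. (b, l) \<in> U})"

lemma sum_SS:
  fixes h :: "(nat \<Rightarrow> sample) \<Rightarrow> real"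
  shows "(\<Sum>\<theta>\<in>SS. h \<theta>) = (\<Sum>r\<in>RR. \<Sum>x\<in>Pow {..<B}. \<Sum>y\<in>Pow {..<B}. \<Sum>U\<in>Pow cells. h (zip_sample r x y U))"
proof -
  have "(\<Sum>r\<in>RR. \<Sum>x\<in>Pow {..<B}. \<Sum>y\<in>Pow {..<B}. \<Sum>U\<in>Pow cells. h (zip_sample r x y U))
      = (\<Sum>p\<in>RR \<times> Pow {..<B} \<times> Pow {..<B} \<times> Pow cells. case p of (r, x, y, U) \<Rightarrow> h (zip_sample r x y U))"
    by (simp only: sum.cartesian_product' prod.case)
  also have "\<dots> = (\<Sum>\<theta>\<in>SS. h \<theta>)"
  proof -
    define i where "i \<theta> = (fst \<circ> \<theta>, {b. fst (snd (\<theta> b))}, {b. fst (snd (snd (\<theta> b)))},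
       {(b, l). l \<in> snd (snd (snd (\<theta> b)))})" for \<theta> :: "nat \<Rightarrow> sample"
    define j where "j = (\<lambda>(r, x, y, U). zip_sample r x y U)"
    show ?thesis
    proof (rule sum.reindex_bij_witness[of _ i j])
      fix p assume p: "p \<in> RR \<times> Pow {..<B} \<times> Pow {..<B} \<times> Pow cells"
      show "i (j p) = p"
        by (cases p) (auto simp: i_def j_def zip_sample_def comp_def)
      show "j p \<in> SS"
        using p by (cases p) (auto simp: j_def SS_def RR_def zip_sample_def PiE_dflt_def Theta_def sample0_def)
      show "h (j p) = (case p of (r, x, y, U) \<Rightarrow> h (zip_sample r x y U))"
        by (cases p) (simp add: j_def)
    next
      fix \<theta> assume \<theta>: "\<theta> \<in> SS"
      show "j (i \<theta>) = \<theta>"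
        by (auto simp: i_def j_def zip_sample_def fun_eq_iff)
      have out: "\<theta> b = sample0" if "\<not> b < B" for b using \<theta> that by (auto simp: SS_def PiE_dflt_def)
      have inn: "\<theta> b \<in> Theta" if "b < B" for b using \<theta> that by (auto simp: SS_def PiE_dflt_def)
      have "fst \<circ> \<theta> \<in> RR"
        using out inn by (auto simp: RR_def PiE_dflt_def sample0_def Theta_def mem_Times_iff)
      moreover have "{b. fst (snd (\<theta> b))} \<subseteq> {..<B}" "{b. fst (snd (snd (\<theta> b)))} \<subseteq> {..<B}"
        using out by (force simp: sample0_def)+
      moreover have "{(b, l). l \<in> snd (snd (snd (\<theta> b)))} \<subseteq> cells"
      proof (rule subrelI)
        fix b l assume "(b, l) \<in> {(b, l). l \<in> snd (snd (snd (\<theta> b)))}"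
        hence l: "l \<in> snd (snd (snd (\<theta> b)))" by simp
        have b: "b < B" using l out[of b] by (cases "b < B") (auto simp: sample0_def)
        from inn[OF b] l show "(b, l) \<in> cells" using b by (auto simp: Theta_def mem_Times_iff)
      qed
      ultimately show "i \<theta> \<in> RR \<times> Pow {..<B} \<times> Pow {..<B} \<times> Pow cells" by (simp add: i_def)
    qed
  qed
  finally show ?thesis ..
qed

lemma inp_conf:
  assumes "r \<in> RR" "x \<subseteq> {..<B}" "y \<subseteq> {..<B}" "U \<subseteq> cells"
  shows "inp (conf r x y) U = sample_input (zip_sample r x y U)"
proof (intro ext)
  fix i b l
  show "inp (conf r x y) U i b l = sample_input (zip_sample r x y U) i b l"
  proof (cases "b < B")
    case True
    obtain M m D \<tau> z where r: "r b = (M, m, D, \<tau>, z)" by (cases "r b")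
    show ?thesis using True
      by (auto simp: inp_def sample_input_def zip_sample_def blk_def conf_def r pat_def)
  next
    case False
    hence "r b = pub0" using assms by (auto simp: RR_def PiE_dflt_def)
    moreover have "b \<notin> x" "b \<notin> y" "(b, l) \<notin> U" for l using False assms by auto
    ultimately show ?thesis using False
      by (auto simp: inp_def sample_input_def zip_sample_def blk_def pub0_def)
  qed
qed

end

section \<open>Affinity of transcript distributions\<close>

text \<open>An event that is rare under \<open>Q\<close> and whose complement is rare under
  \<open>P\<close> forces a small affinity: apply Cauchy-Schwarz on the event and on its complement,
  jointly over \<open>r\<close> and \<open>v\<close>.\<close>

lemma affinity_le:
  fixes P Q :: "'a \<Rightarrow> 'v \<Rightarrow> real"
  assumes A: "finite A" "A \<noteq> {}" and nn: "\<And>r v. 0 \<le> P r v" "\<And>r v. 0 \<le> Q r v"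
    and mass: "\<And>r. r \<in> A \<Longrightarrow> (\<Sum>v\<in>V. P r v) \<le> 1" "\<And>r. r \<in> A \<Longrightarrow> (\<Sum>v\<in>V. Q r v) \<le> 1"
  shows "mean A (\<lambda>r. \<Sum>v\<in>V. sqrt (P r v * Q r v))
     \<le> sqrt (mean A (\<lambda>r. \<Sum>v\<in>V. of_bool (e v) * Q r v)) + sqrt (mean A (\<lambda>r. \<Sum>v\<in>V. of_bool (\<not> e v) * P r v))"
proof -
  have c: "real (card A) > 0" using A by (simp add: card_gt_0_iff)
  have cs: "mean A (\<lambda>r. \<Sum>v\<in>V. of_bool (f v) * sqrt (P r v * Q r v))
      \<le> sqrt (mean A (\<lambda>r. \<Sum>v\<in>V. of_bool (f v) * P r v)) * sqrt (mean A (\<lambda>r. \<Sum>v\<in>V. of_bool (f v) * Q r v))" for f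
  proof -
    define p where "p = (\<lambda>(r, v). of_bool (f v) * P r v)"
    define q where "q = (\<lambda>(r, v). of_bool (f v) * Q r v)"
    have "(\<Sum>z\<in>A \<times> V. sqrt (p z) * sqrt (q z))\<^sup>2 \<le> (\<Sum>z\<in>A \<times> V. (sqrt (p z))\<^sup>2) * (\<Sum>z\<in>A \<times> V. (sqrt (q z))\<^sup>2)"
      by (rule Cauchy_Schwarz_ineq_sum)
    also have "(\<Sum>z\<in>A \<times> V. (sqrt (p z))\<^sup>2) = (\<Sum>z\<in>A \<times> V. p z)" by (intro sum.cong) (auto simp: p_def nn)
    also have "(\<Sum>z\<in>A \<times> V. (sqrt (q z))\<^sup>2) = (\<Sum>z\<in>A \<times> V. q z)" by (intro sum.cong) (auto simp: q_def nn)
    finally have "(\<Sum>z\<in>A \<times> V. sqrt (p z) * sqrt (q z)) \<le> sqrt ((\<Sum>z\<in>A \<times> V. p z) * (\<Sum>z\<in>A \<times> V. q z))"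
      by (rule real_le_rsqrt)
    moreover have "(\<Sum>z\<in>A \<times> V. sqrt (p z) * sqrt (q z)) = (\<Sum>r\<in>A. \<Sum>v\<in>V. of_bool (f v) * sqrt (P r v * Q r v))"
      unfolding sum.cartesian_product by (intro sum.cong) (auto simp: p_def q_def real_sqrt_mult)
    moreover have "(\<Sum>z\<in>A \<times> V. p z) = card A * mean A (\<lambda>r. \<Sum>v\<in>V. of_bool (f v) * P r v)"
      unfolding mean_def p_def using c by (simp add: sum.cartesian_product)
    moreover have "(\<Sum>z\<in>A \<times> V. q z) = card A * mean A (\<lambda>r. \<Sum>v\<in>V. of_bool (f v) * Q r v)"
      unfolding mean_def q_def using c by (simp add: sum.cartesian_product)
    moreover have "sqrt ((c * a) * (c * b)) = c * (sqrt a * sqrt b)" if "c \<ge> 0" for a b c :: real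
    proof -
      have "sqrt ((c * a) * (c * b)) = sqrt (c\<^sup>2 * (a * b))" by (simp add: power2_eq_square mult_ac)
      also have "\<dots> = c * (sqrt a * sqrt b)" using that by (simp only: real_sqrt_mult real_sqrt_abs abs_of_nonneg)
      finally show ?thesis .
    qed
    ultimately have "(\<Sum>r\<in>A. \<Sum>v\<in>V. of_bool (f v) * sqrt (P r v * Q r v)) \<le>
       card A * (sqrt (mean A (\<lambda>r. \<Sum>v\<in>V. of_bool (f v) * P r v)) * sqrt (mean A (\<lambda>r. \<Sum>v\<in>V. of_bool (f v) * Q r v)))"
      using c by simp
    thus ?thesis using c by (simp add: mean_def[of A "\<lambda>r. \<Sum>v\<in>V. of_bool (f v) * sqrt (P r v * Q r v)"] divide_le_eq mult.commute)
  qed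
  have le1: "sqrt (mean A (\<lambda>r. \<Sum>v\<in>V. of_bool (f v) * R r v)) \<le> 1"
    if "\<And>r v. 0 \<le> R r v" "\<And>r. r \<in> A \<Longrightarrow> (\<Sum>v\<in>V. R r v) \<le> 1" for f and R :: "'a \<Rightarrow> 'v \<Rightarrow> real"
  proof -
    have "mean A (\<lambda>r. \<Sum>v\<in>V. of_bool (f v) * R r v) \<le> mean A (\<lambda>_. 1)"
    proof (rule mean_mono)
      fix r assume "r \<in> A"
      have "(\<Sum>v\<in>V. of_bool (f v) * R r v) \<le> (\<Sum>v\<in>V. R r v)"
        using that(1) by (intro sum_mono) auto
      thus "(\<Sum>v\<in>V. of_bool (f v) * R r v) \<le> 1" using that(2)[OF \<open>r \<in> A\<close>] by simp
    qed
    thus ?thesis using A by (simp add: mean_const)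
  qed
  have nnm: "0 \<le> sqrt (mean A (\<lambda>r. \<Sum>v\<in>V. of_bool (f v) * R r v))"
    if "\<And>r v. 0 \<le> R r v" for f and R :: "'a \<Rightarrow> 'v \<Rightarrow> real"
    using that by (auto intro!: mean_nonneg sum_nonneg)
  have "mean A (\<lambda>r. \<Sum>v\<in>V. sqrt (P r v * Q r v)) =
      mean A (\<lambda>r. (\<Sum>v\<in>V. of_bool (e v) * sqrt (P r v * Q r v)) + (\<Sum>v\<in>V. of_bool (\<not> e v) * sqrt (P r v * Q r v)))"
    unfolding sum.distrib[symmetric] by (intro mean_cong sum.cong) auto
  also have "\<dots> = mean A (\<lambda>r. \<Sum>v\<in>V. of_bool (e v) * sqrt (P r v * Q r v))
      + mean A (\<lambda>r. \<Sum>v\<in>V. of_bool (\<not> e v) * sqrt (P r v * Q r v))" by (rule mean_add)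
  also have "\<dots> \<le> 1 * sqrt (mean A (\<lambda>r. \<Sum>v\<in>V. of_bool (e v) * Q r v))
      + sqrt (mean A (\<lambda>r. \<Sum>v\<in>V. of_bool (\<not> e v) * P r v)) * 1"
  proof (intro add_mono order_trans[OF cs])
    show "sqrt (mean A (\<lambda>r. \<Sum>v\<in>V. of_bool (e v) * P r v)) * sqrt (mean A (\<lambda>r. \<Sum>v\<in>V. of_bool (e v) * Q r v))
        \<le> 1 * sqrt (mean A (\<lambda>r. \<Sum>v\<in>V. of_bool (e v) * Q r v))"
      by (intro mult_right_mono le1 nnm nn mass)
    show "sqrt (mean A (\<lambda>r. \<Sum>v\<in>V. of_bool (\<not> e v) * P r v)) * sqrt (mean A (\<lambda>r. \<Sum>v\<in>V. of_bool (\<not> e v) * Q r v))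
        \<le> sqrt (mean A (\<lambda>r. \<Sum>v\<in>V. of_bool (\<not> e v) * P r v)) * 1"
      by (intro mult_left_mono le1[of Q "\<lambda>v. \<not> e v"] nnm[of P "\<lambda>v. \<not> e v"] nn mass)
  qed
  finally show ?thesis by simp
qed

context board
begin

lemma Pr_event: "(\<Sum>v\<in>TR. of_bool (e v) * Pr \<kappa> v) = mean (Pow cells) (\<lambda>U. of_bool (e (trace t (inp \<kappa> U))))"
proof -
  have "(\<Sum>v\<in>TR. of_bool (e v) * Pr \<kappa> v) =
      mean (Pow cells) (\<lambda>U. \<Sum>v\<in>TR. of_bool (e v) * of_bool (trace t (inp \<kappa> U) = v))"
    unfolding Pr_def prob_eq_def mean_sum mean_cmult ..
  also have "\<dots> = mean (Pow cells) (\<lambda>U. of_bool (e (trace t (inp \<kappa> U))))"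
  proof (rule mean_cong)
    fix U
    have "(\<Sum>v\<in>TR. of_bool (e v) * of_bool (trace t (inp \<kappa> U) = v)) =
        (\<Sum>v\<in>TR. if v = trace t (inp \<kappa> U) then of_bool (e v) else (0::real))"
      by (intro sum.cong) auto
    thus "(\<Sum>v\<in>TR. of_bool (e v) * of_bool (trace t (inp \<kappa> U) = v)) = (of_bool (e (trace t (inp \<kappa> U))) :: real)"
      using finite_TR trace_in_TR by simp
  qed
  finally show ?thesis .
qed

definition RA :: "(nat \<Rightarrow> pub) set" where "RA = PiE_dflt {..<B} pub0 (\<lambda>_. Act)"

lemma finite_RA: "finite RA" by (simp add: RA_def finite_PiE_dflt finite_Act)

lemma Act_pos: "n \<ge> 2 \<Longrightarrow> real (card Act) > 0"
  unfolding card_Act using finite_DD DD_nonempty by (auto simp: card_gt_0_iff)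

lemma RA_nonempty: "n \<ge> 2 \<Longrightarrow> RA \<noteq> {}"
  using Act_pos by (auto simp: RA_def)

text \<open>One factor \<open>B\<close> comes from the chain of blocks. The other arises because the
  configurations along the chain differ, so \<open>sum_block_info_le\<close> cannot be shared
  between the blocks and each one is charged the whole bound.\<close>

lemma mean_small_hell:
  assumes n: "n \<ge> 2"
  shows "mean RA (\<lambda>r. hell TR (Pr (conf r {} {})) (Pr (conf r {..<B} {..<B})))
     \<le> 32 * (real B)\<^sup>2 * real k * real C * ln 2 / (real n - 1)"
proof -
  have step: "hell TR (Pr (conf r {..<j} {..<j})) (Pr (conf r {..<Suc j} {..<Suc j})) \<le> 8 * togs r {..<j} {..<j} j" for r j
  proof -
    have c0: "conf r {..<j} {..<j} = upd (conf r {..<j} {..<j}) j (spec r j) (Det {})"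
      using conf_ins[of j "{..<j}" "{..<j}" r False False] by (simp add: pat_def)
    have c1: "conf r {..<Suc j} {..<Suc j} = upd (conf r {..<j} {..<j}) j (spec r j) (Det (pat True True))"
      using conf_ins[of j "{..<j}" "{..<j}" r True True] by (simp add: lessThan_Suc)
    show ?thesis
      using hell_planted_le(1,4)[of r "{..<j}" "{..<j}" j] unfolding c0[symmetric] c1[symmetric] by simp
  qed
  have dd: "real (card DD) > 0" using finite_DD DD_nonempty by (simp add: card_gt_0_iff)
  have tog: "(\<Sum>r\<in>RA. togs r {..<j} {..<j} j) \<le> card RA * (4 * real k * real C * ln 2 / (real n - 1))" if "j < B" for j
  proof -
    have "real (card Act) * (\<Sum>r\<in>RA. togs r {..<j} {..<j} j) = (\<Sum>r\<in>RA. \<Sum>q\<in>Act. togs (r(j := q)) {..<j} {..<j} j)"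
      unfolding RA_def using that finite_Act
      by (subst sum_PiE_dflt_resample[where f = "\<lambda>r. togs r {..<j} {..<j} j"]) auto
    also have "\<dots> \<le> (\<Sum>r\<in>RA. real k * (\<Sum>m<n. \<Sum>D\<in>DD. 4 * real C * ln 2))"
    proof (intro sum_mono)
      fix r
      have "(\<Sum>q\<in>Act. togs (r(j := q)) {..<j} {..<j} j)
         \<le> real k * (\<Sum>m<n. \<Sum>D\<in>DD. block_info j (conf (r(j := (m, 0, D, False, False))) {..<j} {..<j}))"
        by (rule sum_togs_Act_le) auto
      also have "\<dots> \<le> real k * (\<Sum>m<n. \<Sum>D\<in>DD. 4 * real C * ln 2)"
      proof (intro mult_left_mono sum_mono)
        fix m D
        let ?c = "conf (r(j := (m, 0, D, False, False))) {..<j} {..<j}"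
        have "block_info j ?c \<le> (\<Sum>b<B. block_info b ?c)"
          using that block_info_nonneg by (intro member_le_sum) auto
        thus "block_info j ?c \<le> 4 * real C * ln 2" using sum_block_info_le[of ?c] by linarith
      qed auto
      finally show "(\<Sum>q\<in>Act. togs (r(j := q)) {..<j} {..<j} j) \<le> real k * (\<Sum>m<n. \<Sum>D\<in>DD. 4 * real C * ln 2)" .
    qed
    also have "\<dots> = real (card Act) * (card RA * (4 * real k * real C * ln 2 / (real n - 1)))"
      unfolding card_Act using n dd by (simp add: field_simps)
    finally show ?thesis using Act_pos[OF n] by (simp only: mult_le_cancel_left_pos)
  qed
  have "(\<Sum>r\<in>RA. hell TR (Pr (conf r {} {})) (Pr (conf r {..<B} {..<B})))
      \<le> (\<Sum>r\<in>RA. real B * (\<Sum>j<B. 8 * togs r {..<j} {..<j} j))"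
  proof (rule sum_mono)
    fix r
    have "hell TR (Pr (conf r {} {})) (Pr (conf r {..<B} {..<B})) \<le>
       real B * (\<Sum>j<B. hell TR (Pr (conf r {..<j} {..<j})) (Pr (conf r {..<Suc j} {..<Suc j})))"
      using hell_chain[of TR "\<lambda>j. Pr (conf r {..<j} {..<j})" B] by simp
    also have "\<dots> \<le> real B * (\<Sum>j<B. 8 * togs r {..<j} {..<j} j)"
      by (intro mult_left_mono sum_mono step) auto
    finally show "hell TR (Pr (conf r {} {})) (Pr (conf r {..<B} {..<B})) \<le> real B * (\<Sum>j<B. 8 * togs r {..<j} {..<j} j)" .
  qed
  also have "\<dots> = 8 * real B * (\<Sum>j<B. \<Sum>r\<in>RA. togs r {..<j} {..<j} j)"
    by (subst sum.swap) (simp add: sum_distrib_left mult_ac)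
  also have "\<dots> \<le> 8 * real B * (\<Sum>j<B. card RA * (4 * real k * real C * ln 2 / (real n - 1)))"
    by (intro mult_left_mono sum_mono tog) auto
  also have "\<dots> = card RA * (32 * (real B)\<^sup>2 * real k * real C * ln 2 / (real n - 1))"
    by (simp add: power2_eq_square)
  finally show ?thesis
    using finite_RA RA_nonempty[OF n] unfolding mean_def
    by (subst pos_divide_le_eq) (auto simp: card_gt_0_iff mult.commute)
qed

lemma small_affinity_ge:
  assumes n: "n \<ge> 2"
  shows "1 - 16 * (real B)\<^sup>2 * real k * real C * ln 2 / (real n - 1)
     \<le> mean RA (\<lambda>r. \<Sum>v\<in>TR. sqrt (Pr (conf r {..<B} {..<B}) v * Pr (conf r {} {}) v))"
proof -
  have "mean RA (\<lambda>r. \<Sum>v\<in>TR. sqrt (Pr (conf r {..<B} {..<B}) v * Pr (conf r {} {}) v))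
      = mean RA (\<lambda>r. 1 + (- 1 / 2) * hell TR (Pr (conf r {} {})) (Pr (conf r {..<B} {..<B})))"
    by (rule mean_cong) (simp add: hell_eq Pr_nonneg Pr_mass mult.commute diff_divide_distrib)
  also have "\<dots> = 1 + (- 1 / 2) * mean RA (\<lambda>r. hell TR (Pr (conf r {} {})) (Pr (conf r {..<B} {..<B})))"
    unfolding mean_add mean_cmult using finite_RA RA_nonempty[OF n] by (subst mean_const) auto
  finally show ?thesis using mean_small_hell[OF n] by simp
qed

end

section \<open>Reweighted inputs and the frequency moment\<close>

context board
begin

text \<open>Density of the distribution in which the planted bits of active blocks have correlation \<open>\<rho>\<close>.\<close>

definition wgt :: "real \<Rightarrow> sample \<Rightarrow> real" where
  "wgt \<rho> \<theta> = (case \<theta> of (q, a, b, u) \<Rightarrow> 4 * kern (if active q then \<rho> else 0) a b / card Theta)"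

definition EE :: "real \<Rightarrow> (input \<Rightarrow> real) \<Rightarrow> real" where
  "EE \<rho> h = (\<Sum>\<theta>\<in>SS. (\<Prod>b<B. wgt \<rho> (\<theta> b)) * h (sample_input \<theta>))"

lemma sum_Theta:
  fixes f :: "sample \<Rightarrow> real"
  shows "(\<Sum>\<theta>\<in>Theta. f \<theta>) = (\<Sum>q\<in>Pub. \<Sum>a\<in>UNIV. \<Sum>b\<in>UNIV. \<Sum>u\<in>Pow {..<n}. f (q, a, b, u))"
  by (simp only: Theta_def sum.cartesian_product')

lemma card_Theta: "real (card Theta) = real (card Pub) * 4 * 2 ^ n"
  using sum_Theta[of "\<lambda>_. 1"] by (simp add: UNIV_bool card_Pow)

lemma Pub_pos: "n > 0 \<Longrightarrow> real (card Pub) > 0"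
  using DD_nonempty finite_Pub by (auto simp: card_gt_0_iff Pub_def)

lemma card_Pub: "real (card Pub) = real n * real n * real (card DD) * 4"
  using sum_Pub[of "\<lambda>_. 1"] by (simp add: UNIV_bool)

lemma kern_sum: "kern r False False + kern r False True + (kern r True False + kern r True True) = 1"
  by (simp add: kern_def field_simps)

lemma wgt_nonneg: "0 \<le> \<rho> \<Longrightarrow> \<rho> \<le> 1/2 \<Longrightarrow> 0 \<le> wgt \<rho> \<theta>"
  by (cases \<theta>) (auto simp: wgt_def kern_def)

lemma sum_wgt: "n > 0 \<Longrightarrow> (\<Sum>\<theta>\<in>Theta. wgt \<rho> \<theta>) = 1"
proof -
  assume n: "n > 0"
  have "(\<Sum>\<theta>\<in>Theta. wgt \<rho> \<theta>) = (\<Sum>q\<in>Pub. 2 ^ n * 4 / card Theta *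
      (\<Sum>a\<in>UNIV. \<Sum>b\<in>UNIV. kern (if active q then \<rho> else 0) a b))"
    unfolding sum_Theta by (intro sum.cong refl) (simp add: wgt_def card_Pow UNIV_bool algebra_simps)
  also have "\<dots> = (\<Sum>q\<in>Pub. 2 ^ n * 4 / card Theta)"
    by (simp add: UNIV_bool kern_sum)
  also have "\<dots> = 1" using Pub_pos[OF n] by (simp add: card_Theta)
  finally show ?thesis .
qed

lemma EE_eq:
  assumes n: "n > 0" and \<rho>: "0 \<le> \<rho>" "\<rho> \<le> 1/2"
  shows "EE \<rho> h = mean RR (\<lambda>r. \<Sum>x\<in>Pow {..<B}. \<Sum>y\<in>Pow {..<B}. wt (rhof \<rho> r) {..<B} x y *
     mean (Pow cells) (\<lambda>U. h (inp (conf r x y) U)))"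
proof -
  have r01: "0 \<le> rhof \<rho> r j" "rhof \<rho> r j \<le> 1/2" for r j using \<rho> by (auto simp: rhof_def)
  define Z :: real where "Z = real (card RR) * 2 ^ (B * n)"
  have cardRR: "real (card RR) = real (card Pub) ^ B"
    by (simp add: RR_def card_PiE_dflt finite_Pub)
  have Z: "(4 / card Theta) ^ B = 1 / Z"
    using Pub_pos[OF n] unfolding Z_def card_Theta cardRR
    by (simp add: power_divide power_mult_distrib power_mult mult.commute[of B n])
  have W: "(\<Prod>b<B. wgt \<rho> (zip_sample r x y U b)) = wt (rhof \<rho> r) {..<B} x y / Z" for r x y U
  proof -
    have "(\<Prod>b<B. wgt \<rho> (zip_sample r x y U b)) = (\<Prod>b<B. 4 / card Theta * kern (rhof \<rho> r b) (b \<in> x) (b \<in> y))"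
      by (simp add: wgt_def zip_sample_def rhof_def)
    also have "\<dots> = (4 / card Theta) ^ B * wt (rhof \<rho> r) {..<B} x y"
      unfolding wt_def[OF r01] by (simp only: prod.distrib prod_constant card_lessThan)
    finally show ?thesis by (simp add: Z)
  qed
  have "EE \<rho> h = (\<Sum>r\<in>RR. \<Sum>x\<in>Pow {..<B}. \<Sum>y\<in>Pow {..<B}. \<Sum>U\<in>Pow cells.
      wt (rhof \<rho> r) {..<B} x y / Z * h (inp (conf r x y) U))"
    unfolding EE_def sum_SS W by (intro sum.cong refl) (simp add: inp_conf)
  also have "\<dots> = (\<Sum>r\<in>RR. \<Sum>x\<in>Pow {..<B}. \<Sum>y\<in>Pow {..<B}.
      wt (rhof \<rho> r) {..<B} x y * mean (Pow cells) (\<lambda>U. h (inp (conf r x y) U)) / card RR)"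
    by (intro sum.cong refl)
       (simp add: mean_def Z_def card_Pow card_cartesian_product sum_distrib_left sum_divide_distrib mult_ac)
  finally show ?thesis by (simp add: mean_def sum_divide_distrib)
qed

lemma Pcorr_event:
  assumes "n > 0" "0 \<le> \<rho>" "\<rho> \<le> 1/2"
  shows "mean RR (\<lambda>r. \<Sum>v\<in>TR. of_bool (e v) * Pcorr \<rho> r v) = EE \<rho> (\<lambda>x. of_bool (e (trace t x)))"
proof -
  have "(\<Sum>v\<in>TR. of_bool (e v) * Pcorr \<rho> r v) = (\<Sum>x\<in>Pow {..<B}. \<Sum>y\<in>Pow {..<B}.
      wt (rhof \<rho> r) {..<B} x y * (\<Sum>v\<in>TR. of_bool (e v) * Pr (conf r x y) v))" for r
  proof -
    have "(\<Sum>v\<in>TR. of_bool (e v) * Pcorr \<rho> r v) = (\<Sum>v\<in>TR. \<Sum>x\<in>Pow {..<B}. \<Sum>y\<in>Pow {..<B}.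
        wt (rhof \<rho> r) {..<B} x y * (of_bool (e v) * Pr (conf r x y) v))"
      unfolding Pcorr_def by (simp add: sum_distrib_left mult_ac)
    also have "\<dots> = (\<Sum>x\<in>Pow {..<B}. \<Sum>y\<in>Pow {..<B}. \<Sum>v\<in>TR.
        wt (rhof \<rho> r) {..<B} x y * (of_bool (e v) * Pr (conf r x y) v))"
      by (rule sum_swap3[symmetric])
    finally show ?thesis by (simp only: sum_distrib_left)
  qed
  thus ?thesis unfolding EE_eq[OF assms] Pr_event by simp
qed

lemma Pcorr_mass:
  assumes "0 \<le> \<rho>" "\<rho> \<le> 1/2"
  shows "(\<Sum>v\<in>TR. Pcorr \<rho> r v) = 1"
proof -
  have r01: "0 \<le> rhof \<rho> r j" "rhof \<rho> r j \<le> 1/2" for j using assms by (auto simp: rhof_def)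
  have "(\<Sum>v\<in>TR. Pcorr \<rho> r v) = (\<Sum>x\<in>Pow {..<B}. \<Sum>y\<in>Pow {..<B}. wt (rhof \<rho> r) {..<B} x y * (\<Sum>v\<in>TR. Pr (conf r x y) v))"
    unfolding Pcorr_def sum_distrib_left by (rule sum_swap3[symmetric])
  also have "\<dots> = (\<Sum>x\<in>Pow {..<B}. 1 / 2 ^ card {..<B})"
    by (intro sum.cong refl) (use sum_wt[OF r01, of "{..<B}"] in \<open>simp add: Pr_mass\<close>)
  also have "\<dots> = 1" by (simp add: card_Pow)
  finally show ?thesis .
qed

lemma prod_wgt_nonneg: "0 \<le> \<rho> \<Longrightarrow> \<rho> \<le> 1/2 \<Longrightarrow> 0 \<le> (\<Prod>b<B. wgt \<rho> (\<theta> b))"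
  by (intro prod_nonneg) (auto simp: wgt_nonneg)

lemma EE_union_le:
  assumes "0 \<le> \<rho>" "\<rho> \<le> 1/2" "\<And>x. Q x \<Longrightarrow> R x \<or> S x"
  shows "EE \<rho> (\<lambda>x. of_bool (Q x)) \<le> EE \<rho> (\<lambda>x. of_bool (R x)) + EE \<rho> (\<lambda>x. of_bool (S x))"
  unfolding EE_def sum.distrib[symmetric] distrib_left[symmetric]
  using assms by (intro sum_mono mult_left_mono prod_wgt_nonneg) (auto simp: of_bool_def)

lemma wgt_0: "wgt 0 \<theta> = 1 / card Theta"
  by (cases \<theta>) (simp add: wgt_def kern_def)

lemma card_SS: "real (card SS) = real (card Theta) ^ B"
  by (simp add: SS_def card_PiE_dflt finite_Theta)

lemma EE_0: "EE 0 h = (\<Sum>\<theta>\<in>SS. h (sample_input \<theta>)) / card SS"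
  unfolding EE_def wgt_0 card_SS by (simp add: sum_divide_distrib power_divide)

lemma nu_prob:
  assumes "n > 0"
  shows "measure_pmf.prob (nu k B n) {x. Q x} = EE 0 (\<lambda>x. of_bool (Q x))"
proof -
  have ne: "SS \<noteq> {}" using assms DD_nonempty by (auto simp: SS_def Theta_def Pub_def)
  have "measure_pmf.prob (nu k B n) {x. Q x} = measure_pmf.prob (pmf_of_set SS) {\<theta>. Q (sample_input \<theta>)}"
    unfolding nu_eq[OF assms] by (simp add: vimage_def)
  also have "\<dots> = card (SS \<inter> {\<theta>. Q (sample_input \<theta>)}) / card SS"
    using ne finite_SS by (rule measure_pmf_of_set)
  finally show ?thesis unfolding EE_0 using finite_SS by (simp add: Int_def)
qed

text \<open>Cauchy-Schwarz with the second moment of the density, at most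
  \<open>1 + \<rho>\<^sup>2\<close> per block. For \<rho> of order \<open>1 / sqrt B\<close> the
  product over the blocks stays bounded.\<close>

lemma EE_change:
  assumes n: "n > 0" and \<rho>: "0 \<le> \<rho>" "\<rho> \<le> 1/2"
  shows "EE \<rho> (\<lambda>x. of_bool (Q x)) \<le> sqrt (exp (real B * \<rho>\<^sup>2) * EE 0 (\<lambda>x. of_bool (Q x)))"
proof -
  define g where "g \<theta> = wgt \<rho> \<theta> * card Theta" for \<theta>
  have cT: "real (card Theta) > 0" using Pub_pos[OF n] by (simp add: card_Theta)
  have cS: "real (card SS) > 0" using cT by (simp add: card_SS)
  define G where "G \<theta> = (\<Prod>b<B. g (\<theta> b))" for \<theta> :: "nat \<Rightarrow> sample"
  have W: "(\<Prod>b<B. wgt \<rho> (\<theta> b)) = G \<theta> / card SS" for \<theta>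
    unfolding G_def g_def card_SS using cT by (simp add: prod.distrib)
  have gsq: "(\<Sum>\<theta>\<in>Theta. (g \<theta>)\<^sup>2) \<le> (1 + \<rho>\<^sup>2) * card Theta"
  proof -
    have gk: "g (q, a, b, u) = 4 * kern (if active q then \<rho> else 0) a b" for q a b u
      using cT by (simp add: g_def wgt_def)
    have "(\<Sum>\<theta>\<in>Theta. (g \<theta>)\<^sup>2) = (\<Sum>q\<in>Pub. 2 ^ n * (4 * (1 + (if active q then \<rho> else 0)\<^sup>2)))"
      unfolding sum_Theta gk
      by (intro sum.cong refl) (simp add: UNIV_bool kern_def card_Pow power2_eq_square field_simps)
    also have "\<dots> \<le> (\<Sum>q\<in>Pub. 2 ^ n * (4 * (1 + \<rho>\<^sup>2)))"
      by (intro sum_mono mult_left_mono) auto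
    also have "\<dots> = (1 + \<rho>\<^sup>2) * card Theta" by (simp add: card_Theta)
    finally show ?thesis .
  qed
  have "(\<Sum>\<theta>\<in>SS. G \<theta> * of_bool (Q (sample_input \<theta>)))\<^sup>2
      \<le> (\<Sum>\<theta>\<in>SS. (G \<theta>)\<^sup>2) * (\<Sum>\<theta>\<in>SS. (of_bool (Q (sample_input \<theta>)))\<^sup>2)"
    by (rule Cauchy_Schwarz_ineq_sum)
  also have "(\<Sum>\<theta>\<in>SS. (G \<theta>)\<^sup>2) = (\<Sum>\<theta>\<in>Theta. (g \<theta>)\<^sup>2) ^ B"
    unfolding G_def SS_def prod_power_distrib
    using sum_PiE_dflt_prod[of "{..<B}" Theta "\<lambda>_ q. (g q)\<^sup>2" sample0] finite_Theta by simp
  also have "\<dots> * (\<Sum>\<theta>\<in>SS. (of_bool (Q (sample_input \<theta>)))\<^sup>2) \<le>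
      ((1 + \<rho>\<^sup>2) * card Theta) ^ B * (\<Sum>\<theta>\<in>SS. (of_bool (Q (sample_input \<theta>)))\<^sup>2)"
    using gsq by (intro mult_right_mono power_mono sum_nonneg) auto
  also have "\<dots> = (1 + \<rho>\<^sup>2) ^ B * EE 0 (\<lambda>x. of_bool (Q x)) * (card SS)\<^sup>2"
    using cS unfolding EE_0 power_mult_distrib card_SS[symmetric]
    by (simp add: power2_eq_square flip: of_bool_conj)
  also have "\<dots> \<le> exp (real B * \<rho>\<^sup>2) * EE 0 (\<lambda>x. of_bool (Q x)) * (card SS)\<^sup>2"
  proof -
    have "(1 + \<rho>\<^sup>2) ^ B \<le> exp (\<rho>\<^sup>2) ^ B" by (intro power_mono) auto
    also have "\<dots> = exp (real B * \<rho>\<^sup>2)" by (simp add: exp_of_nat_mult)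
    finally show ?thesis
      using cS by (intro mult_right_mono) (auto simp: EE_0 sum_nonneg)
  qed
  finally have "((\<Sum>\<theta>\<in>SS. G \<theta> * of_bool (Q (sample_input \<theta>))) / card SS)\<^sup>2
      \<le> exp (real B * \<rho>\<^sup>2) * EE 0 (\<lambda>x. of_bool (Q x))"
    using cS by (simp add: power_divide divide_le_eq)
  hence "(\<Sum>\<theta>\<in>SS. G \<theta> * of_bool (Q (sample_input \<theta>))) / card SS
      \<le> sqrt (exp (real B * \<rho>\<^sup>2) * EE 0 (\<lambda>x. of_bool (Q x)))" by (rule real_le_rsqrt)
  thus ?thesis unfolding EE_def W by (simp add: sum_divide_distrib)
qed

section \<open>The frequency moment of one block\<close>

definition Yv :: "real \<Rightarrow> sample \<Rightarrow> real" where
  "Yv p \<theta> = (\<Sum>l<n. real (card {i. i < k \<and> blk \<theta> i l}) powr p)"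

lemma Fp_sample: "Fp p k B n (sample_input \<theta>) = (\<Sum>b<B. Yv p (\<theta> b))"
  unfolding Fp_def Yv_def sample_input_def by (simp add: sum.cartesian_product)

definition gv :: "real \<Rightarrow> bool \<Rightarrow> bool \<Rightarrow> real" where
  "gv p a b = real (card {i. i < k \<and> (if i < k div 2 then a else b)}) powr p"

definition Nv :: "pub \<Rightarrow> nat set \<Rightarrow> real" where
  "Nv q u = (\<Sum>l\<in>{..<n} - {fst q}. of_bool (case q of (M, m, D, \<tau>, z) \<Rightarrow> D l < k \<and> (if \<tau> \<and> l = m then z else l \<in> u)))"

text \<open>An ordinary coordinate is held by at most one site, so its power is 0 or 1 for every
  \<open>p\<close> and \<open>Nv\<close> merely counts ones. Only the planted coordinate feels the
  exponent.\<close>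

lemma Yv_eq:
  assumes "fst q < n"
  shows "Yv p (q, a, b, u) = gv p a b + Nv q u"
proof -
  obtain M m D \<tau> z where q: "q = (M, m, D, \<tau>, z)" by (cases q)
  have M: "M < n" using assms q by simp
  have "Yv p (q, a, b, u) = real (card {i. i < k \<and> blk (q, a, b, u) i M}) powr p
      + (\<Sum>l\<in>{..<n} - {M}. real (card {i. i < k \<and> blk (q, a, b, u) i l}) powr p)"
    unfolding Yv_def using M by (intro sum.remove) auto
  also have "{i. i < k \<and> blk (q, a, b, u) i M} = {i. i < k \<and> (if i < k div 2 then a else b)}"
    using M by (auto simp: blk_def q)
  also have "(\<Sum>l\<in>{..<n} - {M}. real (card {i. i < k \<and> blk (q, a, b, u) i l}) powr p) = Nv q u"
    unfolding Nv_def q fst_conv prod.case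
  proof (intro sum.cong refl)
    fix l assume l: "l \<in> {..<n} - {M}"
    let ?c = "D l < k \<and> (if \<tau> \<and> l = m then z else l \<in> u)"
    have "{i. i < k \<and> blk ((M, m, D, \<tau>, z), a, b, u) i l} = (if ?c then {D l} else {})"
      using l by (auto simp: blk_def)
    thus "real (card {i. i < k \<and> blk ((M, m, D, \<tau>, z), a, b, u) i l}) powr p = of_bool ?c" by simp
  qed
  finally show ?thesis by (simp add: gv_def)
qed

lemma gv_simps:
  "gv p False False = 0" "gv p True True = real k powr p"
  "gv p True False = 2 powr (- p) * real k powr p" "gv p False True = 2 powr (- p) * real k powr p"
proof -
  obtain m where m: "k = 2 ^ Suc m" using k_pow by auto
  have half: "real (k div 2) = real k / 2" "real (k - k div 2) = real k / 2" by (auto simp: m)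
  have pw: "(real k / 2) powr p = 2 powr (- p) * real k powr p"
    by (simp add: powr_divide powr_minus field_simps)
  have c1: "{i. i < k \<and> (if i < k div 2 then True else False)} = {..<k div 2}" by auto
  have c2: "{i. i < k \<and> (if i < k div 2 then False else True)} = {k div 2..<k}" by auto
  show "gv p False False = 0" "gv p True True = real k powr p" by (simp_all add: gv_def)
  show "gv p True False = 2 powr (- p) * real k powr p"
    unfolding gv_def c1 card_lessThan half pw ..
  show "gv p False True = 2 powr (- p) * real k powr p"
    unfolding gv_def c2 card_atLeastLessThan half pw ..
qed

lemma Nv_bounds: "fst q < n \<Longrightarrow> 0 \<le> Nv q u \<and> Nv q u \<le> real n - 1"
proof -
  assume q: "fst q < n"
  have "Nv q u \<le> (\<Sum>l\<in>{..<n} - {fst q}. 1)" unfolding Nv_def by (intro sum_mono) auto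
  also have "\<dots> = real n - 1" using q by (simp add: of_nat_diff)
  finally show ?thesis by (auto simp: Nv_def intro!: sum_nonneg)
qed

lemma Yv_bounds:
  assumes "p > 0" "real n - 1 \<le> real k powr p" "\<theta> \<in> Theta"
  shows "0 \<le> Yv p \<theta> \<and> Yv p \<theta> \<le> 2 * real k powr p"
proof -
  obtain q a b u where \<theta>: "\<theta> = (q, a, b, u)" by (cases \<theta>)
  have q: "fst q < n" using assms(3) by (auto simp: \<theta> Theta_def Pub_def)
  have "2 powr (- p) \<le> 1" using powr_mono[of "- p" 0 "2 :: real"] assms(1) by simp
  hence "2 powr (- p) * real k powr p \<le> real k powr p" by (simp add: mult_left_le_one_le)
  hence "0 \<le> gv p a b \<and> gv p a b \<le> real k powr p" by (cases a; cases b) (simp_all add: gv_simps)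
  thus ?thesis using Nv_bounds[OF q, of u] assms(2) unfolding \<theta> Yv_eq[OF q] by linarith
qed

text \<open>Correlation preserves the marginals, so only the mixed difference
  \<open>gv 11 - gv 10 - gv 01 + gv 00\<close> survives; it is positive for \<open>p > 1\<close>. A
  block is active with probability \<open>(n - 1) / (4 * n)\<close>, and the kernel shifts each pair
  by \<rho>/4.\<close>

lemma Yv_shift:
  assumes n: "n > 0"
  shows "(\<Sum>\<theta>\<in>Theta. wgt \<rho> \<theta> * Yv p \<theta>) - (\<Sum>\<theta>\<in>Theta. wgt 0 \<theta> * Yv p \<theta>)
     = \<rho> * (1 - 2 * 2 powr (- p)) * real k powr p * ((real n - 1) / (16 * real n))"
proof -
  define K where "K = real k powr p"
  define L where "L = (1 - 2 * 2 powr (- p)) * K"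
  have "(\<Sum>\<theta>\<in>Theta. wgt \<rho> \<theta> * Yv p \<theta>) - (\<Sum>\<theta>\<in>Theta. wgt 0 \<theta> * Yv p \<theta>)
      = (\<Sum>q\<in>Pub. \<Sum>a\<in>UNIV. \<Sum>b\<in>UNIV. \<Sum>u\<in>Pow {..<n}. (wgt \<rho> (q, a, b, u) - wgt 0 (q, a, b, u)) * Yv p (q, a, b, u))"
    unfolding sum_subtractf[symmetric] left_diff_distrib[symmetric] by (rule sum_Theta)
  also have "\<dots> = (\<Sum>q\<in>Pub. of_bool (active q) * (2 ^ n * \<rho> * L / card Theta))"
  proof (rule sum.cong[OF refl])
    fix q assume "q \<in> Pub"
    hence q: "fst q < n" by (auto simp: Pub_def)
    define r where "r = (if active q then \<rho> else 0)"
    have w: "wgt \<rho> (q, a, b, u) - wgt 0 (q, a, b, u) = (if a = b then r else - r) / card Theta" for a b u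
      by (simp add: wgt_def kern_def r_def diff_divide_distrib[symmetric] add_divide_distrib[symmetric])
    have "(\<Sum>a\<in>UNIV. \<Sum>b\<in>UNIV. \<Sum>u\<in>Pow {..<n}. (wgt \<rho> (q, a, b, u) - wgt 0 (q, a, b, u)) * Yv p (q, a, b, u))
        = (\<Sum>u\<in>Pow {..<n}. \<Sum>a\<in>UNIV. \<Sum>b\<in>UNIV. (if a = b then r else - r) / card Theta * (gv p a b + Nv q u))"
      unfolding w Yv_eq[OF q] by (rule sum_swap3)
    also have "\<dots> = (\<Sum>u\<in>Pow {..<n}. r * L / card Theta)"
      by (intro sum.cong refl)
         (simp add: UNIV_bool gv_simps L_def K_def add_divide_distrib diff_divide_distrib algebra_simps)
    also have "\<dots> = of_bool (active q) * (2 ^ n * \<rho> * L / card Theta)"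
      by (simp add: card_Pow r_def)
    finally show "(\<Sum>a\<in>UNIV. \<Sum>b\<in>UNIV. \<Sum>u\<in>Pow {..<n}. (wgt \<rho> (q, a, b, u) - wgt 0 (q, a, b, u)) * Yv p (q, a, b, u))
        = of_bool (active q) * (2 ^ n * \<rho> * L / card Theta)" .
  qed
  also have "\<dots> = real (card Act) * (2 ^ n * \<rho> * L / card Theta)"
    unfolding sum_distrib_right[symmetric] Act_def using finite_Pub by (simp add: Int_def)
  also have "\<dots> = \<rho> * L * ((real n - 1) / (16 * real n))"
    using n finite_DD DD_nonempty unfolding card_Act card_Theta card_Pub by (simp add: field_simps)
  finally show ?thesis by (simp add: L_def K_def mult_ac)
qed

lemma EE_chebyshev:
  assumes n: "n > 0" and \<rho>: "0 \<le> \<rho>" "\<rho> \<le> 1/2" and p: "p > 0" "real n - 1 \<le> real k powr p" and s: "s > 0"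
  shows "EE \<rho> (\<lambda>x. of_bool (\<bar>Fp p k B n x - real B * (\<Sum>\<theta>\<in>Theta. wgt \<rho> \<theta> * Yv p \<theta>)\<bar> \<ge> s))
     \<le> real B * (2 * real k powr p)\<^sup>2 / s\<^sup>2"
  using product_weights_chebyshev[of "{..<B}" Theta "wgt \<rho>" "Yv p" "2 * real k powr p" s sample0]
    finite_Theta wgt_nonneg[OF \<rho>] sum_wgt[OF n] Yv_bounds[OF p] s
  by (simp add: EE_def Fp_sample SS_def)

end

section \<open>The lower bound\<close>

context board
begin

lemma large_case:
  fixes p \<epsilon> \<delta> \<omega> c :: real
  assumes p: "p > 1" and n3: "n \<ge> 3" and nK: "real n - 1 \<le> real k powr p" and Kn: "real k powr p \<le> real n"
    and B: "B \<ge> 1" and eps: "\<epsilon> = 1 / sqrt (real B)"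
    and om: "\<omega> > 0" "\<omega> / sqrt (real B) \<le> 1/2" "\<omega> * (1 - 2 * 2 powr (- p)) = 2400"
    and err: "EE 0 (\<lambda>x. of_bool (\<not> is_approx \<epsilon> (Fp p k B n x) (result t x))) \<le> \<delta>"
    and del: "\<delta> \<le> 1/256" "exp (\<omega>\<^sup>2) * \<delta> \<le> 1/65536"
    and C: "real C \<le> c * real k powr (p - 1) * real B" and c: "0 < c" "352 * \<omega>\<^sup>2 * c \<le> 1"
  shows False
proof -
  define K where "K = real k powr p"
  define sB where "sB = sqrt (real B)"
  define \<rho> where "\<rho> = \<omega> / sB"
  define \<mu> where "\<mu> r = (\<Sum>\<theta>\<in>Theta. wgt r \<theta> * Yv p \<theta>)" for r
  \<comment> \<open>Chosen so that Chebyshev's bound \<open>B * (2 * K)\<^sup>2 / s\<^sup>2\<close>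
    equals 1/256.\<close>
  define s where "s = 32 * sB * K"
  define bad where "bad x \<longleftrightarrow> \<not> is_approx \<epsilon> (Fp p k B n x) (result t x)" for x
  have K: "K > 0" using k_pos by (simp add: K_def)
  have sB: "sB \<ge> 1" "sB * sB = real B" using B by (simp_all add: sB_def)
  have \<rho>: "0 \<le> \<rho>" "\<rho> \<le> 1/2" using om sB by (auto simp: \<rho>_def sB_def)
  have \<rho>2: "real B * \<rho>\<^sup>2 = \<omega>\<^sup>2" using sB by (simp add: \<rho>_def power2_eq_square field_simps flip: sB(2))
  have B\<rho>: "real B * \<rho> = \<omega> * sB" using sB by (simp add: \<rho>_def field_simps flip: sB(2))
  have n0: "n > 0" using n3 by simp
  have spos: "s > 0" using K sB by (simp add: s_def)
  have shift: "real B * \<mu> \<rho> - real B * \<mu> 0 \<ge> 100 * sB * K"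
  proof -
    have "real B * \<mu> \<rho> - real B * \<mu> 0 = real B * (\<rho> * (1 - 2 * 2 powr (- p)) * K * ((real n - 1) / (16 * real n)))"
      using Yv_shift[OF n0, of \<rho> p] by (simp add: \<mu>_def K_def right_diff_distrib[symmetric])
    also have "\<dots> = (real B * \<rho>) * (1 - 2 * 2 powr (- p)) * K * ((real n - 1) / (16 * real n))" by simp
    also have "\<dots> = (\<omega> * (1 - 2 * 2 powr (- p))) * sB * K * ((real n - 1) / (16 * real n))"
      unfolding B\<rho> by simp
    also have "\<dots> = 2400 * sB * K * ((real n - 1) / (16 * real n))" unfolding om(3) ..
    \<comment> \<open>For \<open>n \<ge> 3\<close> the fraction is at least 1/24; the normalisation
      of \<omega> to 2400 is made to leave a gap of 100.\<close>
    also have "\<dots> \<ge> 2400 * sB * K * (1 / 24)"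
      using n3 K sB by (intro mult_left_mono) (auto simp: field_simps)
    finally show ?thesis by (simp add: mult_ac)
  qed
  have \<mu>0: "\<mu> 0 \<le> 2 * K"
  proof -
    have "\<mu> 0 \<le> (\<Sum>\<theta>\<in>Theta. wgt 0 \<theta> * (2 * K))"
      unfolding \<mu>_def using Yv_bounds[of p] p nK wgt_nonneg[of 0]
      by (intro sum_mono mult_left_mono) (auto simp: K_def)
    also have "\<dots> = 2 * K" using sum_wgt[OF n0, of 0] by (simp flip: sum_distrib_right)
    finally show ?thesis .
  qed
  have cheb: "EE r (\<lambda>x. of_bool (\<bar>Fp p k B n x - real B * \<mu> r\<bar> \<ge> s)) \<le> 1/256" if "0 \<le> r" "r \<le> 1/2" for r
  proof -
    have "EE r (\<lambda>x. of_bool (\<bar>Fp p k B n x - real B * \<mu> r\<bar> \<ge> s)) \<le> real B * (2 * real k powr p)\<^sup>2 / s\<^sup>2"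
      unfolding \<mu>_def using n0 that _ nK spos by (rule EE_chebyshev) (use p in simp)
    also have "\<dots> = 1/256"
      using K sB(1) unfolding K_def[symmetric] s_def sB(2)[symmetric] by (simp add: power2_eq_square field_simps)
    finally show ?thesis .
  qed
  \<comment> \<open>The approximation never undershoots, so under correlation a correct output
    exceeds this threshold unless the moment deviates by \<open>s\<close>.\<close>
  define thr where "thr = real B * \<mu> \<rho> - s"
  have P0: "EE 0 (\<lambda>x. of_bool (result t x \<ge> thr)) \<le> 1/64"
  proof -
    have "EE 0 (\<lambda>x. of_bool (result t x \<ge> thr)) \<le> EE 0 (\<lambda>x. of_bool (bad x))
        + EE 0 (\<lambda>x. of_bool (\<bar>Fp p k B n x - real B * \<mu> 0\<bar> \<ge> s))"
    proof (rule EE_union_le)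
      fix x assume r: "result t x \<ge> thr"
      have "\<bar>Fp p k B n x - real B * \<mu> 0\<bar> \<ge> s" if "\<not> bad x"
      proof (rule ccontr)
        assume "\<not> ?thesis"
        hence F: "Fp p k B n x < real B * \<mu> 0 + s" by linarith
        have e: "0 \<le> \<epsilon>" "\<epsilon> * real B = sB" "\<epsilon> * sB = 1"
          using sB(1) by (auto simp: eps sB_def[symmetric] sB(2)[symmetric])
        have "thr \<le> (1 + \<epsilon>) * Fp p k B n x"
          using that r by (auto simp: bad_def is_approx_def)
        also have "\<dots> \<le> (1 + \<epsilon>) * (real B * \<mu> 0 + s)"
          using F e by (intro mult_left_mono) auto
        also have "\<dots> = real B * \<mu> 0 + s + (\<epsilon> * real B) * \<mu> 0 + (\<epsilon> * sB) * (32 * K)"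
          by (simp add: s_def algebra_simps)
        also have "\<dots> = real B * \<mu> 0 + s + sB * \<mu> 0 + 32 * K" unfolding e by simp
        \<comment> \<open>Without correlation a correct output exceeds the mean by less than 32
          (deviation), 2 (relative error of the mean) and 32 (relative error of the deviation) units
          of \<open>sB * K\<close>. With the 32 subtracted in \<open>thr\<close> this makes 98, less
          than the gap.\<close>
        also have "\<dots> \<le> real B * \<mu> 0 + s + sB * (2 * K) + 32 * (sB * K)"
          using sB(1) \<mu>0 K by (intro add_mono mult_left_mono) auto
        also have "\<dots> = real B * \<mu> 0 + 66 * (sB * K)" by (simp add: s_def)
        finally have "real B * \<mu> \<rho> - 32 * (sB * K) \<le> real B * \<mu> 0 + 66 * (sB * K)"
          by (simp add: thr_def s_def)
        moreover have "sB * K > 0" using sB(1) K by simp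
        ultimately show False using shift by linarith
      qed
      thus "bad x \<or> \<bar>Fp p k B n x - real B * \<mu> 0\<bar> \<ge> s" by blast
    qed auto
    also have "\<dots> \<le> \<delta> + 1/256" using err cheb[of 0] by (intro add_mono) (auto simp: bad_def)
    finally show ?thesis using del by simp
  qed
  have P1: "EE \<rho> (\<lambda>x. of_bool (\<not> result t x \<ge> thr)) \<le> 1/64"
  proof -
    have "EE \<rho> (\<lambda>x. of_bool (\<not> result t x \<ge> thr)) \<le> EE \<rho> (\<lambda>x. of_bool (bad x))
        + EE \<rho> (\<lambda>x. of_bool (\<bar>Fp p k B n x - real B * \<mu> \<rho>\<bar> \<ge> s))"
      using \<rho> by (rule EE_union_le) (auto simp: bad_def is_approx_def thr_def)
    also have "EE \<rho> (\<lambda>x. of_bool (bad x)) \<le> 1/256"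
    proof -
      have "EE \<rho> (\<lambda>x. of_bool (bad x)) \<le> sqrt (exp (real B * \<rho>\<^sup>2) * EE 0 (\<lambda>x. of_bool (bad x)))"
        by (rule EE_change[OF n0 \<rho>])
      also have "\<dots> \<le> sqrt (exp (\<omega>\<^sup>2) * \<delta>)"
        unfolding \<rho>2 using err by (intro real_sqrt_le_mono mult_left_mono) (auto simp: bad_def)
      \<comment> \<open>The bound 1/65536 is the square of 1/256, to survive the root from the
        change of measure.\<close>
      also have "\<dots> \<le> sqrt ((1/256)\<^sup>2)" using del by (intro real_sqrt_le_mono) (simp add: power2_eq_square)
      finally show ?thesis by simp
    qed
    also have "EE \<rho> (\<lambda>x. of_bool (\<bar>Fp p k B n x - real B * \<mu> \<rho>\<bar> \<ge> s)) \<le> 1/256" by (rule cheb[OF \<rho>])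
    finally show ?thesis by simp
  qed
  have RRne: "RR \<noteq> {}" using n0 DD_nonempty by (auto simp: RR_def Pub_def)
  define Aff where "Aff = mean RR (\<lambda>r. \<Sum>v\<in>TR. sqrt (Pcorr \<rho> r v * Pcorr 0 r v))"
  have "Aff \<le> sqrt (mean RR (\<lambda>r. \<Sum>v\<in>TR. of_bool (out_of t v \<ge> thr) * Pcorr 0 r v))
      + sqrt (mean RR (\<lambda>r. \<Sum>v\<in>TR. of_bool (\<not> out_of t v \<ge> thr) * Pcorr \<rho> r v))"
    unfolding Aff_def using finite_RR RRne Pcorr_nonneg \<rho> Pcorr_mass by (intro affinity_le) auto
  also have "\<dots> = sqrt (EE 0 (\<lambda>x. of_bool (result t x \<ge> thr))) + sqrt (EE \<rho> (\<lambda>x. of_bool (\<not> result t x \<ge> thr)))"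
    using Pcorr_event[OF n0, of 0 "\<lambda>v. out_of t v \<ge> thr"] Pcorr_event[OF n0 \<rho>, of "\<lambda>v. \<not> out_of t v \<ge> thr"]
    by (simp add: result_eq_out_of)
  also have "\<dots> \<le> sqrt ((1/8)\<^sup>2) + sqrt ((1/8)\<^sup>2)"
    using P0 P1 by (intro add_mono real_sqrt_le_mono) (auto simp: power2_eq_square)
  finally have up: "Aff \<le> 1/4" by simp
  have "\<rho>\<^sup>2 * 176 * real k * real C * ln 2 / real n \<le> 1/2"
  proof -
    have "real k * real C \<le> real k * (c * real k powr (p - 1) * real B)" using C by (intro mult_left_mono) auto
    also have "\<dots> = c * real B * K"
      using k_pos by (simp add: K_def powr_diff)
    also have "\<dots> \<le> c * real B * real n" using Kn c by (intro mult_left_mono) (auto simp: K_def)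
    finally have kC: "real k * real C \<le> c * real B * real n" .
    have "\<rho>\<^sup>2 * 176 * real k * real C * ln 2 / real n = \<rho>\<^sup>2 * 176 * ln 2 / real n * (real k * real C)" by simp
    also have "\<dots> \<le> \<rho>\<^sup>2 * 176 * ln 2 / real n * (c * real B * real n)"
      using kC by (intro mult_left_mono) auto
    also have "\<dots> = 176 * (real B * \<rho>\<^sup>2) * c * ln 2" using n0 by simp
    also have "\<dots> \<le> 176 * \<omega>\<^sup>2 * c * 1"
      unfolding \<rho>2 using c ln_le_minus_one[of 2] by (intro mult_left_mono) auto
    also have "\<dots> \<le> 1/2" using c by simp
    finally show ?thesis .
  qed
  moreover have "1 - \<rho>\<^sup>2 * 176 * real k * real C * ln 2 / real n \<le> Aff"
    unfolding Aff_def by (rule mean_affinity_ge[OF \<rho> n0])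
  ultimately show False using up by linarith
qed

section \<open>Boundedly many blocks\<close>

lemma mean_of_bool_mem:
  assumes "finite S" "e \<in> S"
  shows "mean (Pow S) (\<lambda>U. of_bool (e \<in> U)) = 1/2"
proof -
  have "mean (Pow S) (\<lambda>U. of_bool (e \<in> insert e U)) = mean (Pow S) (\<lambda>_. 1)"
    by (rule mean_cong) simp
  also have "\<dots> = 1" using assms by (subst mean_const) auto
  finally have 1: "mean (Pow S) (\<lambda>U. of_bool (e \<in> insert e U)) = 1" .
  have 0: "mean (Pow S) (\<lambda>U. of_bool (e \<in> U - {e})) = 0" by (simp add: mean_def)
  show ?thesis by (subst mean_Pow_split[OF assms]) (simp only: 0 1 add_0)
qed

lemma RA_subset: "RA \<subseteq> RR"
  by (auto simp: RA_def RR_def PiE_dflt_def Act_def)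

text \<open>A given pair of planted bits has probability 1/4 per block, and a public part is active
  with probability \<open>(n - 1) / (4 * n)\<close>, at least 1/6 for \<open>n \<ge> 3\<close>.
  Conditioning on both in all blocks therefore costs at most \<open>24 ^ B\<close>.\<close>

lemma RA_mean_le:
  assumes n3: "n \<ge> 3" and x: "x \<subseteq> {..<B}" "y \<subseteq> {..<B}" and h: "\<And>z. 0 \<le> h z"
  shows "mean RA (\<lambda>r. mean (Pow cells) (\<lambda>U. h (inp (conf r x y) U))) \<le> 24 ^ B * EE 0 h"
proof -
  define m where "m r x y = mean (Pow cells) (\<lambda>U. h (inp (conf r x y) U))" for r x y
  have mnn: "0 \<le> m r x y" for r x y unfolding m_def using h by (rule mean_nonneg)
  have n0: "n > 0" "n \<ge> 2" using n3 by auto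
  have z01: "0 \<le> rhof 0 r j" "rhof 0 r j \<le> 1/2" for r j by (auto simp: rhof_def)
  have w0: "wt (rhof 0 r) {..<B} x y = (1/4) ^ B" for r x y
  proof -
    have K: "kern (rhof 0 r j) u w = 1/4" for j u w by (simp add: rhof_def kern_def)
    show ?thesis unfolding wt_def[OF z01] K by simp
  qed
  have dd: "real (card DD) > 0" using finite_DD DD_nonempty by (simp add: card_gt_0_iff)
  have cA: "real (card RA) = real (card Act) ^ B" "real (card RR) = real (card Pub) ^ B"
    by (simp_all add: RA_def RR_def card_PiE_dflt finite_Act finite_Pub)
  have cpos: "real (card RA) > 0" "real (card RR) > 0"
    using Act_pos[OF n0(2)] Pub_pos[OF n0(1)] by (simp_all add: cA)
  have "(\<Sum>r\<in>RA. m r x y) * (1/4) ^ B \<le> (\<Sum>r\<in>RR. m r x y * (1/4) ^ B)"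
    unfolding sum_distrib_right using RA_subset finite_RR mnn by (intro sum_mono2) auto
  also have "\<dots> \<le> (\<Sum>r\<in>RR. \<Sum>x\<in>Pow {..<B}. \<Sum>y\<in>Pow {..<B}. wt (rhof 0 r) {..<B} x y * m r x y)"
  proof (rule sum_mono)
    fix r
    have "m r x y * (1/4) ^ B \<le> (\<Sum>y\<in>Pow {..<B}. wt (rhof 0 r) {..<B} x y * m r x y)"
      using x mnn by (subst mult.commute, subst w0[of r x y, symmetric])
        (intro member_le_sum[of y "Pow {..<B}" "\<lambda>y. wt (rhof 0 r) {..<B} x y * m r x y"], auto simp: w0)
    also have "\<dots> \<le> (\<Sum>x\<in>Pow {..<B}. \<Sum>y\<in>Pow {..<B}. wt (rhof 0 r) {..<B} x y * m r x y)"
      using x mnn by (intro member_le_sum[of x "Pow {..<B}" "\<lambda>x. \<Sum>y\<in>Pow {..<B}. wt (rhof 0 r) {..<B} x y * m r x y"])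
        (auto simp: w0 intro!: sum_nonneg)
    finally show "m r x y * (1/4) ^ B \<le> (\<Sum>x\<in>Pow {..<B}. \<Sum>y\<in>Pow {..<B}. wt (rhof 0 r) {..<B} x y * m r x y)" .
  qed
  also have "\<dots> = real (card RR) * EE 0 h"
    using cpos unfolding EE_eq[OF n0(1), of 0, simplified] m_def[symmetric] mean_def[of RR] by simp
  finally have 1: "(\<Sum>r\<in>RA. m r x y) \<le> 4 ^ B * (real (card RR) * EE 0 h)"
    by (simp add: power_divide field_simps)
  have E0: "0 \<le> EE 0 h" unfolding EE_0 using h by (intro divide_nonneg_nonneg sum_nonneg) auto
  have "real (card RR) \<le> 6 ^ B * real (card RA)"
  proof -
    have "4 * real n \<le> 6 * (real n - 1)" using n3 by simp
    hence "(4 * real n) * (real n * card DD) \<le> (6 * (real n - 1)) * (real n * card DD)"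
      using dd by (intro mult_right_mono) auto
    moreover have "real (card Pub) = (4 * real n) * (real n * card DD)" by (simp add: card_Pub)
    moreover have "6 * real (card Act) = (6 * (real n - 1)) * (real n * card DD)" by (simp add: card_Act)
    ultimately have "real (card Pub) \<le> 6 * real (card Act)" by linarith
    hence "real (card Pub) ^ B \<le> (6 * real (card Act)) ^ B" by (intro power_mono) auto
    thus ?thesis by (simp add: cA power_mult_distrib)
  qed
  hence "4 ^ B * (real (card RR) * EE 0 h) \<le> 4 ^ B * ((6 ^ B * real (card RA)) * EE 0 h)"
    using E0 by (intro mult_left_mono mult_right_mono) auto
  also have "\<dots> = (24 ^ B * EE 0 h) * real (card RA)"
    using power_mult_distrib[of "4::real" 6 B] by simp
  finally have "(\<Sum>r\<in>RA. m r x y) \<le> (24 ^ B * EE 0 h) * real (card RA)" using 1 by linarith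
  thus ?thesis using cpos unfolding m_def[symmetric] mean_def[of RA] by (simp add: divide_le_eq)
qed

lemma Pub_fst: "q \<in> Pub \<Longrightarrow> fst q < n"
  by (auto simp: Pub_def)

lemma Fp_planted_ge:
  assumes "r \<in> RR" "U \<subseteq> cells"
  shows "real B * real k powr p \<le> Fp p k B n (inp (conf r {..<B} {..<B}) U)"
proof -
  have "real k powr p \<le> Yv p (zip_sample r {..<B} {..<B} U b)" if "b < B" for b
  proof -
    have q: "fst (r b) < n" using assms that by (intro Pub_fst) (auto simp: RR_def PiE_dflt_def)
    show ?thesis using that Nv_bounds[OF q] by (simp add: zip_sample_def Yv_eq[OF q] gv_simps)
  qed
  hence "(\<Sum>b<B. real k powr p) \<le> (\<Sum>b<B. Yv p (zip_sample r {..<B} {..<B} U b))" by (intro sum_mono) auto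
  thus ?thesis using assms by (simp add: inp_conf Fp_sample)
qed

text \<open>Pinned bits of active blocks are 0 and can be bounded by fair bits, leaving
  \<open>n - 1\<close> coordinates of mean at most 1/2. The count \<open>n - 1\<close> matters: it
  is below \<open>k powr p\<close> after rounding up, while \<open>n\<close> need not be.\<close>

lemma mean_Fp_unplanted_le:
  assumes r: "r \<in> RA"
  shows "mean (Pow cells) (\<lambda>U. Fp p k B n (inp (conf r {} {}) U)) \<le> real B * (real n - 1) / 2"
proof -
  have RR: "r \<in> RR" using r RA_subset by auto
  have q: "fst (r b) < n" "active (r b)" if "b < B" for b
    using r that Pub_fst[of "r b"] by (auto simp: RA_def PiE_dflt_def Act_def)
  have "mean (Pow cells) (\<lambda>U. Fp p k B n (inp (conf r {} {}) U))
      \<le> mean (Pow cells) (\<lambda>U. \<Sum>b<B. \<Sum>l\<in>{..<n} - {fst (r b)}. of_bool ((b, l) \<in> U))"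
  proof (rule mean_mono)
    fix U assume U: "U \<in> Pow cells"
    have "Fp p k B n (inp (conf r {} {}) U) = (\<Sum>b<B. Yv p (zip_sample r {} {} U b))"
      using U RR by (simp add: inp_conf Fp_sample)
    also have "\<dots> \<le> (\<Sum>b<B. \<Sum>l\<in>{..<n} - {fst (r b)}. of_bool ((b, l) \<in> U))"
    proof (rule sum_mono)
      fix b assume "b \<in> {..<B}"
      hence b: "b < B" by simp
      have "Yv p (zip_sample r {} {} U b) = Nv (r b) {l. (b, l) \<in> U}"
        by (simp add: zip_sample_def Yv_eq[OF q(1)[OF b]] gv_simps)
      also have "\<dots> \<le> (\<Sum>l\<in>{..<n} - {fst (r b)}. of_bool ((b, l) \<in> U))"
        unfolding Nv_def using q(2)[OF b]
        by (intro sum_mono) (auto simp: active_def split: prod.splits if_splits)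
      finally show "Yv p (zip_sample r {} {} U b) \<le> (\<Sum>l\<in>{..<n} - {fst (r b)}. of_bool ((b, l) \<in> U))" .
    qed
    finally show "Fp p k B n (inp (conf r {} {}) U) \<le> (\<Sum>b<B. \<Sum>l\<in>{..<n} - {fst (r b)}. of_bool ((b, l) \<in> U))" .
  qed
  also have "\<dots> = (\<Sum>b<B. \<Sum>l\<in>{..<n} - {fst (r b)}. mean (Pow cells) (\<lambda>U. of_bool ((b, l) \<in> U)))"
    by (simp only: mean_sum)
  also have "\<dots> = (\<Sum>b<B. \<Sum>l\<in>{..<n} - {fst (r b)}. 1/2)"
    by (intro sum.cong refl mean_of_bool_mem) auto
  also have "\<dots> = (\<Sum>b<B. (real n - 1) / 2)"
  proof (intro sum.cong refl)
    fix b assume "b \<in> {..<B}"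
    thus "(\<Sum>l\<in>{..<n} - {fst (r b)}. 1/2) = (real n - 1) / 2" using q(1)[of b] by (simp add: of_nat_diff)
  qed
  finally show ?thesis by simp
qed

text \<open>All-one planted bits contribute at least \<open>B * K\<close>, all-zero ones have moment
  at most \<open>B * K / 2\<close> on average. With as few as two blocks no concentration is
  available; Markov's inequality already separates the two cases by a constant.\<close>

lemma small_case:
  fixes p \<epsilon> \<delta> c :: real
  assumes p: "p > 1" and n3: "n \<ge> 3" and nK: "real n - 1 \<le> real k powr p" and Kn: "real k powr p \<le> real n"
    and B: "B \<ge> 2" and eps: "\<epsilon> = 1 / sqrt (real B)"
    and err: "EE 0 (\<lambda>x. of_bool (\<not> is_approx \<epsilon> (Fp p k B n x) (result t x))) \<le> \<delta>"
    and del: "24 ^ B * \<delta> \<le> 9/10000"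
    and C: "real C \<le> c * real k powr (p - 1) * real B" and c: "0 < c" "24 * c * real B ^ 3 \<le> 1/100"
  shows False
proof -
  define K where "K = real k powr p"
  define bad where "bad x \<longleftrightarrow> \<not> is_approx \<epsilon> (Fp p k B n x) (result t x)" for x
  let ?J = "{..<B}"
  have K: "K > 0" using k_pos by (simp add: K_def)
  have n2: "n \<ge> 2" using n3 by simp
  \<comment> \<open>Since \<open>B \<ge> 2\<close>, \<epsilon> is at most \<open>1 / sqrt 2\<close>,
    so that \<open>(1 + \<epsilon>) / 2\<close> stays below 1.\<close>
  have eps71: "0 \<le> \<epsilon>" "\<epsilon> \<le> 71/100"
  proof -
    have "100/71 \<le> sqrt (real B)"
      using B by (intro real_le_rsqrt) (simp add: power2_eq_square)
    hence "1 / sqrt (real B) \<le> 1 / (100/71)" using B by (intro divide_left_mono) auto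
    thus "\<epsilon> \<le> 71/100" by (simp add: eps)
  qed (simp add: eps)
  have badRA: "mean RA (\<lambda>r. mean (Pow cells) (\<lambda>U. of_bool (bad (inp (conf r x x) U)))) \<le> 9/10000"
    if "x \<subseteq> ?J" for x
  proof -
    have "mean RA (\<lambda>r. mean (Pow cells) (\<lambda>U. of_bool (bad (inp (conf r x x) U)))) \<le> 24 ^ B * EE 0 (\<lambda>x. of_bool (bad x))"
      using RA_mean_le[OF n3 that that, of "\<lambda>z. of_bool (bad z)"] by simp
    also have "\<dots> \<le> 24 ^ B * \<delta>" using err by (intro mult_left_mono) (auto simp: bad_def)
    finally show ?thesis using del by simp
  qed
  define e where "e v \<longleftrightarrow> out_of t v \<ge> real B * K" for v
  have P1: "mean RA (\<lambda>r. \<Sum>v\<in>TR. of_bool (\<not> e v) * Pr (conf r ?J ?J) v) \<le> 9/10000"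
  proof -
    have "mean RA (\<lambda>r. \<Sum>v\<in>TR. of_bool (\<not> e v) * Pr (conf r ?J ?J) v)
        \<le> mean RA (\<lambda>r. mean (Pow cells) (\<lambda>U. of_bool (bad (inp (conf r ?J ?J) U))))"
      unfolding Pr_event
    proof (intro mean_mono)
      fix r U assume "r \<in> RA" "U \<in> Pow cells"
      hence "real B * K \<le> Fp p k B n (inp (conf r ?J ?J) U)"
        unfolding K_def using RA_subset by (intro Fp_planted_ge) auto
      thus "of_bool (\<not> e (trace t (inp (conf r ?J ?J) U))) \<le> (of_bool (bad (inp (conf r ?J ?J) U)) :: real)"
        by (auto simp: e_def bad_def is_approx_def result_eq_out_of)
    qed
    thus ?thesis using badRA[of ?J] by simp
  qed
  have P0: "mean RA (\<lambda>r. \<Sum>v\<in>TR. of_bool (e v) * Pr (conf r {} {}) v) \<le> 9025/10000"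
  proof -
    have "mean RA (\<lambda>r. \<Sum>v\<in>TR. of_bool (e v) * Pr (conf r {} {}) v)
        \<le> mean RA (\<lambda>r. mean (Pow cells) (\<lambda>U. of_bool (bad (inp (conf r {} {}) U))) + 855/1000)"
      unfolding Pr_event
    proof (rule mean_mono)
      fix r assume r: "r \<in> RA"
      let ?F = "\<lambda>U. Fp p k B n (inp (conf r {} {}) U)"
      \<comment> \<open>Markov's inequality, written as a pointwise bound on the indicator.\<close>
      have "mean (Pow cells) (\<lambda>U. of_bool (e (trace t (inp (conf r {} {}) U))))
          \<le> mean (Pow cells) (\<lambda>U. of_bool (bad (inp (conf r {} {}) U)) + (1 + \<epsilon>) / (real B * K) * ?F U)"
      proof (rule mean_mono)
        fix U
        have BK: "real B * K > 0" using B K by simp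
        have F0: "0 \<le> ?F U" unfolding Fp_def by (intro sum_nonneg) auto
        show "of_bool (e (trace t (inp (conf r {} {}) U))) \<le>
            of_bool (bad (inp (conf r {} {}) U)) + (1 + \<epsilon>) / (real B * K) * ?F U"
        proof (cases "e (trace t (inp (conf r {} {}) U)) \<and> \<not> bad (inp (conf r {} {}) U)")
          case True
          hence "real B * K \<le> (1 + \<epsilon>) * ?F U"
            by (auto simp: e_def bad_def is_approx_def result_eq_out_of)
          hence "1 \<le> (1 + \<epsilon>) / (real B * K) * ?F U" using BK by (simp add: field_simps)
          thus ?thesis using True by simp
        next
          case False
          have "0 \<le> (1 + \<epsilon>) / (real B * K) * ?F U"
            using F0 K eps71 by (intro mult_nonneg_nonneg divide_nonneg_nonneg) auto
          thus ?thesis using False by auto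
        qed
      qed
      also have "\<dots> = mean (Pow cells) (\<lambda>U. of_bool (bad (inp (conf r {} {}) U)))
          + (1 + \<epsilon>) / (real B * K) * mean (Pow cells) ?F" unfolding mean_add mean_cmult ..
      also have "(1 + \<epsilon>) / (real B * K) * mean (Pow cells) ?F \<le> (1 + \<epsilon>) / (real B * K) * (real B * K / 2)"
      proof (intro mult_left_mono)
        have "mean (Pow cells) ?F \<le> real B * (real n - 1) / 2" by (rule mean_Fp_unplanted_le[OF r])
        also have "\<dots> \<le> real B * K / 2" using nK by (intro divide_right_mono mult_left_mono) (auto simp: K_def)
        finally show "mean (Pow cells) ?F \<le> real B * K / 2" .
        show "0 \<le> (1 + \<epsilon>) / (real B * K)" using eps71 K by (intro divide_nonneg_nonneg) auto
      qed
      also have "\<dots> = (1 + \<epsilon>) / 2" using B K by simp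
      also have "\<dots> \<le> 855/1000" using eps71 by simp
      finally show "mean (Pow cells) (\<lambda>U. of_bool (e (trace t (inp (conf r {} {}) U))))
          \<le> mean (Pow cells) (\<lambda>U. of_bool (bad (inp (conf r {} {}) U))) + 855/1000" by simp
    qed
    also have "\<dots> = mean RA (\<lambda>r. mean (Pow cells) (\<lambda>U. of_bool (bad (inp (conf r {} {}) U)))) + 855/1000"
      unfolding mean_add using finite_RA RA_nonempty[OF n2] by (simp add: mean_const)
    also have "\<dots> \<le> 9/10000 + 855/1000" using badRA[of "{}"] by simp
    finally show ?thesis by simp
  qed
  define Aff where "Aff = mean RA (\<lambda>r. \<Sum>v\<in>TR. sqrt (Pr (conf r ?J ?J) v * Pr (conf r {} {}) v))"
  have "Aff \<le> sqrt (mean RA (\<lambda>r. \<Sum>v\<in>TR. of_bool (e v) * Pr (conf r {} {}) v))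
      + sqrt (mean RA (\<lambda>r. \<Sum>v\<in>TR. of_bool (\<not> e v) * Pr (conf r ?J ?J) v))"
    unfolding Aff_def using finite_RA RA_nonempty[OF n2] Pr_nonneg Pr_mass by (intro affinity_le) auto
  \<comment> \<open>The two error bounds are rounded to squares: 0.95 + 0.03 stays below the 0.99
    enforced by a small \<open>C\<close>.\<close>
  also have "\<dots> \<le> sqrt ((95/100)\<^sup>2) + sqrt ((3/100)\<^sup>2)"
    using P0 P1 by (intro add_mono real_sqrt_le_mono) (auto simp: power2_eq_square)
  finally have up: "Aff \<le> 98/100" by simp
  have "16 * (real B)\<^sup>2 * real k * real C * ln 2 / (real n - 1) \<le> 1/100"
  proof -
    have "real k * real C \<le> real k * (c * real k powr (p - 1) * real B)" using C by (intro mult_left_mono) auto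
    also have "\<dots> = c * real B * K"
      using k_pos by (simp add: K_def powr_diff)
    also have "\<dots> \<le> c * real B * (3/2 * (real n - 1))"
      using Kn c n3 by (intro mult_left_mono) (auto simp: K_def)
    finally have kC: "real k * real C \<le> c * real B * (3/2 * (real n - 1))" .
    have "16 * (real B)\<^sup>2 * real k * real C * ln 2 / (real n - 1) = 16 * (real B)\<^sup>2 * ln 2 / (real n - 1) * (real k * real C)"
      by simp
    also have "\<dots> \<le> 16 * (real B)\<^sup>2 * ln 2 / (real n - 1) * (c * real B * (3/2 * (real n - 1)))"
      using kC n3 by (intro mult_left_mono) auto
    also have "\<dots> = 24 * c * real B ^ 3 * ln 2"
    proof -
      define d where "d = real n - 1"
      have "d > 0" using n3 by (simp add: d_def)
      thus ?thesis unfolding d_def[symmetric] by (simp add: power2_eq_square power3_eq_cube)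
    qed
    also have "\<dots> \<le> 24 * c * real B ^ 3 * 1"
      using c ln_le_minus_one[of 2] by (intro mult_left_mono) auto
    finally show ?thesis using c by simp
  qed
  moreover have "1 - 16 * (real B)\<^sup>2 * real k * real C * ln 2 / (real n - 1) \<le> Aff"
    unfolding Aff_def by (rule small_affinity_ge[OF n2])
  ultimately show False using up by linarith
qed

end

section \<open>Fixing the public coins and the constants\<close>

text \<open>The error probability is the average over \<open>P\<close> of the errors of the
  deterministic protocols, so one of them is no worse.\<close>

lemma exists_good_protocol:
  assumes "error_prob p \<epsilon> k B n P \<le> \<delta>"
  shows "\<exists>t\<in>set_pmf P. measure_pmf.prob (nu k B n) {x. \<not> is_approx \<epsilon> (Fp p k B n x) (result t x)} \<le> \<delta>"
proof (rule ccontr)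
  define S where "S = {(x, t). \<not> is_approx \<epsilon> (Fp p k B n x) (result t x)}"
  define f where "f t = measure_pmf.prob (nu k B n) {x. \<not> is_approx \<epsilon> (Fp p k B n x) (result t x)}" for t
  assume "\<not> ?thesis"
  hence gt: "\<delta> < f t" if "t \<in> set_pmf P" for t using that by (auto simp: f_def not_le)
  have int: "integrable (measure_pmf P) f"
    by (rule measure_pmf.integrable_const_bound[where B = 1]) (auto simp: f_def)
  have "pair_pmf (nu k B n) P = bind_pmf P (\<lambda>t. map_pmf (\<lambda>x. (x, t)) (nu k B n))"
    unfolding pair_pmf_def map_pmf_def by (rule bind_commute_pmf)
  hence "emeasure (pair_pmf (nu k B n) P) S = (\<integral>\<^sup>+t. emeasure (map_pmf (\<lambda>x. (x, t)) (nu k B n)) S \<partial>P)" by simp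
  also have "\<dots> = (\<integral>\<^sup>+t. ennreal (f t) \<partial>P)"
    by (intro nn_integral_cong) (simp add: f_def S_def vimage_def measure_pmf.emeasure_eq_measure)
  also have "\<dots> = ennreal (measure_pmf.expectation P f)"
    by (rule nn_integral_eq_integral[OF int]) (simp add: f_def)
  finally have "measure_pmf.prob (pair_pmf (nu k B n) P) S = measure_pmf.expectation P f"
    by (simp add: measure_pmf.emeasure_eq_measure f_def)
  moreover have "\<delta> < measure_pmf.expectation P f"
    using int by (rule measure_pmf.expectation_greater) (auto simp: AE_measure_pmf_iff gt)
  ultimately show False using assms by (simp add: error_prob_def S_def)
qed

theorem theorem8:
  fixes p :: real
  assumes "p > 1"
  shows "\<exists>\<delta>>0. \<exists>c>0. \<forall>(k::nat) (\<epsilon>::real) (B::nat) (n::nat) (P::protocol pmf).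
    k \<ge> 2 \<longrightarrow> (\<exists>m. k = 2 ^ m) \<longrightarrow>
    0 < \<epsilon> \<longrightarrow> \<epsilon> < 1 \<longrightarrow> real B = 1 / \<epsilon>\<^sup>2 \<longrightarrow>
    n = nat \<lceil>real k powr p\<rceil> \<longrightarrow>
    blackboard_protocol k P \<longrightarrow>
    error_prob p \<epsilon> k B n P \<le> \<delta> \<longrightarrow>
    communication_complexity k B n P \<ge> ereal (c * (real k powr (p - 1) / \<epsilon>\<^sup>2))"
proof -
  define L where "L = 1 - 2 * 2 powr (- p)"
  have "2 * 2 powr (- p) = (2 :: real) powr (1 - p)" by (simp add: powr_diff powr_minus field_simps)
  also have "\<dots> < 2 powr 0" using assms by (intro powr_less_mono) auto
  finally have L: "L > 0" by (simp add: L_def)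
  define \<omega> where "\<omega> = 2400 / L"
  have om: "\<omega> > 0" "\<omega> * (1 - 2 * 2 powr (- p)) = 2400" using L by (simp_all add: \<omega>_def flip: L_def)
  \<comment> \<open>\<open>\<omega> / sqrt B \<le> 1/2\<close> fails only if
    \<open>B < 4 * \<omega>\<^sup>2\<close>, so \<open>B0\<close> bounds the number of blocks in the
    remaining case.\<close>
  define B0 where "B0 = nat \<lceil>4 * \<omega>\<^sup>2\<rceil>"
  have B0: "4 * \<omega>\<^sup>2 \<le> real B0" unfolding B0_def by linarith
  have B0pos: "real B0 > 0" using B0 om(1) by (smt (verit) zero_less_power)
  \<comment> \<open>The three terms serve the test without correlation, the change of measure to
    correlated pairs, and the conditioning on active blocks for \<open>B \<le> B0\<close>.\<close>
  define \<delta> where "\<delta> = min (1/256) (min (1 / (65536 * exp (\<omega>\<^sup>2))) (9 / (10000 * 24 ^ B0)))"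
  define c where "c = min (1 / (352 * \<omega>\<^sup>2)) (1 / (2400 * real B0 ^ 3))"
  have del: "\<delta> > 0" "\<delta> \<le> 1/256" by (auto simp: \<delta>_def)
  have "\<delta> \<le> 1 / (65536 * exp (\<omega>\<^sup>2))" by (auto simp: \<delta>_def)
  hence del2: "exp (\<omega>\<^sup>2) * \<delta> \<le> 1/65536" by (simp add: field_simps)
  have "\<delta> \<le> 9 / (10000 * 24 ^ B0)" by (auto simp: \<delta>_def)
  hence del3: "24 ^ B0 * \<delta> \<le> 9/10000" by (simp add: field_simps)
  have c: "c > 0" using om(1) B0pos by (auto simp: c_def)
  have "c \<le> 1 / (352 * \<omega>\<^sup>2)" by (auto simp: c_def)
  hence c2: "352 * \<omega>\<^sup>2 * c \<le> 1" using om(1) by (simp add: field_simps)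
  have "c \<le> 1 / (2400 * real B0 ^ 3)" by (auto simp: c_def)
  hence c3: "24 * c * real B0 ^ 3 \<le> 1/100" using B0pos by (simp add: field_simps)
  have main: "communication_complexity k B n P \<ge> ereal (c * (real k powr (p - 1) / \<epsilon>\<^sup>2))"
    if k2: "k \<ge> 2" and kpow: "\<exists>m. k = 2 ^ m" and eps: "0 < \<epsilon>" "\<epsilon> < 1" and B: "real B = 1 / \<epsilon>\<^sup>2"
      and n: "n = nat \<lceil>real k powr p\<rceil>" and bp: "blackboard_protocol k P" and err: "error_prob p \<epsilon> k B n P \<le> \<delta>"
    for k B n :: nat and \<epsilon> :: real and P
  proof (rule ccontr)
    define X where "X = c * real k powr (p - 1) * real B"
    have X: "c * (real k powr (p - 1) / \<epsilon>\<^sup>2) = X" by (simp add: X_def B)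
    assume "\<not> ?thesis"
    hence less: "communication_complexity k B n P < ereal X" by (simp only: X not_le)
    obtain t where t: "t \<in> set_pmf P"
      "measure_pmf.prob (nu k B n) {x. \<not> is_approx \<epsilon> (Fp p k B n x) (result t x)} \<le> \<delta>"
      using exists_good_protocol[OF err] by auto
    \<comment> \<open>The number of bits written is an integer below \<open>X\<close>, so rounding
      down keeps it a bound.\<close>
    define C where "C = nat \<lfloor>X\<rfloor>"
    have Xnn: "X \<ge> 0" using c by (simp add: X_def)
    have CX: "real C \<le> X" using Xnn by (simp add: C_def)
    have bits: "bits_written t x \<le> C" if "x \<in> inputs k B n" for x
    proof -
      have "ereal (real (bits_written t x)) \<le> communication_complexity k B n P"
        unfolding communication_complexity_def using t(1) that by (intro SUP_upper2[of t] SUP_upper) auto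
      hence "real (bits_written t x) < X" using less by (metis ereal_less(2) le_less_trans less_ereal.simps(1))
      thus ?thesis unfolding C_def by linarith
    qed
    obtain m where m: "k = 2 ^ Suc m"
    proof -
      from kpow obtain m' where m': "k = 2 ^ m'" ..
      show ?thesis by (cases m') (use m' k2 that in auto)
    qed
    interpret board k B n C t
      using bp t(1) m bits by unfold_locales (auto simp: blackboard_protocol_def)
    have K2: "real k powr p > 2"
    proof -
      have "(2::real) = 2 powr 1" by simp
      also have "\<dots> < 2 powr p" using assms by (intro powr_less_mono) auto
      also have "\<dots> \<le> real k powr p" using k2 assms by (intro powr_mono2) auto
      finally show ?thesis .
    qed
    \<comment> \<open>Rounding up \<open>k powr p > 2\<close> gives both comparisons with
      \<open>n\<close> and also \<open>n \<ge> 3\<close>, from which the numerical constants above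
      are drawn.\<close>
    have Kn: "real k powr p \<le> real n" and nK: "real n - 1 \<le> real k powr p" unfolding n using K2 by linarith+
    have n3: "n \<ge> 3" using Kn K2 by linarith
    have epsB: "\<epsilon> = 1 / sqrt (real B)" using eps B by (simp add: real_sqrt_divide)
    have "real B > 1" using eps B by (simp add: power_less_one_iff)
    hence B2: "B \<ge> 2" by linarith
    have EE0: "EE 0 (\<lambda>x. of_bool (\<not> is_approx \<epsilon> (Fp p k B n x) (result t x))) \<le> \<delta>"
      using t(2) nu_prob[of "\<lambda>x. \<not> is_approx \<epsilon> (Fp p k B n x) (result t x)"] n3 by simp
    show False
    proof (cases "\<omega> / sqrt (real B) \<le> 1/2")
      case True
      show False
        by (rule large_case[OF assms n3 nK Kn _ epsB om(1) True om(2) EE0 del(2) del2 CX[unfolded X_def] c c2])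
          (use B2 in simp)
    next
      case False
      hence "sqrt (real B) < 2 * \<omega>" using B2 by (simp add: field_simps)
      hence "(sqrt (real B))\<^sup>2 < (2 * \<omega>)\<^sup>2" by (intro power_strict_mono) auto
      hence "real B < real B0" using B0 by simp
      hence BB0: "B \<le> B0" by simp
      have "24 ^ B * \<delta> \<le> 24 ^ B0 * \<delta>"
        using BB0 del by (intro mult_right_mono power_increasing) auto
      moreover have "24 * c * real B ^ 3 \<le> 24 * c * real B0 ^ 3"
        using BB0 c by (intro mult_left_mono power_mono) auto
      ultimately have "24 ^ B * \<delta> \<le> 9/10000" "24 * c * real B ^ 3 \<le> 1/100"
        using del3 c3 by linarith+
      thus False by (rule small_case[OF assms n3 nK Kn B2 epsB EE0 _ CX[unfolded X_def] c])
    qed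
  qed
  show ?thesis
    by (rule exI[of _ \<delta>], rule conjI[OF del(1)], rule exI[of _ c], rule conjI[OF c], intro allI impI, rule main)
qed

end
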